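(* Let $\Omega$ be $\mathbb{R}^2_+$, $\mathcal{S}$ or $\mathcal{D}$, let $p>1$, and let $(\mu,\lambda)$ belong to the negativity range. Then each minimizer $\omega\in S_{\mu,\lambda}$ satisfies $$\omega^{p-1}=\lambda(\psi-Wx_2)_+,\qquad\psi(x)=\int_\Omega G(x,y)\omega(y)\,dy,$$ (almost everywhere in $\Omega$) for some constant $W\in\mathbb{R}$ uniquely determined by $\omega$.
   Context: Write $x=(x_1,x_2)$, $\mathbb{R}^2_+=\{x\in\mathbb{R}^2: x_2>0\}$, and $s_+=\max\{s,0\}$. The domain $\Omega\subseteq\mathbb{R}^2_+$ is one of the following, with Dirichlet Green's function $G$ (for $-\Delta$): - the half-plane $\mathbb{R}^2_+$, with $G(x,y)=G_H(x,y)=\frac{1}{4\pi}\ln\left(1+\frac{4x_2y_2}{|x-y|^2}\right)$; - the strip $\mathcal{S}=\mathbb{R}\times(0,L)$, $L>0$, with $G(x,y)=\frac{1}{4\pi}\ln\left(1+\frac{\sin(\frac{\pi}{L}x_2)\sin(\frac{\pi}{L}y_2)}{\sinh(\frac{\pi}{2L}(x_1-y_1))^2+\sin(\frac{\pi}{2L}(x_2-y_2))^2}\right)$; - a domain $\mathcal{D}\subseteq\mathbb{R}^2_+$ satisfying the weak finite volume condition with some exponent $q\ge0$: setting $D_u=\mathcal{D}\cap\{x_2\ge1\}$ and $D_l=\mathcal{D}\cap\{x_2<1\}$, one has $\int_{D_l}x_2^q\,dx<\infty$ and $\mathrm{Vol}(D_u)<\infty$, and the Biot-Savart law is applicable on $\mathcal{D}$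 (the velocity of a flow in $\mathcal{D}$, tangent to the boundary, is recovered from its vorticity $\omega$ by $u=\nabla^\perp\int_{\mathcal{D}}G(\cdot,y)\omega(y)\,dy$, with $G=G_{\mathcal{D}}$ the Dirichlet Green's function of $\mathcal{D}$). $E[\omega]=\frac12\int_\Omega\int_\Omega G(x,y)\omega(x)\omega(y)\,dx\,dy$, $E_{p,\lambda}[\omega]=E[\omega]-\frac{1}{p\lambda}\|\omega\|_p^p$, $K_\mu=\{\omega\in L^p(\Omega):\omega\ge0,\ \int_\Omega x_2\omega(x)\,dx=\mu\}$, $I_{\mu,\lambda}=\inf_{\omega\in K_\mu}\{-E_{p,\lambda}[\omega]\}$, and $S_{\mu,\lambda}\subseteq K_\mu$ is the set of minimizers of this problem. The pair $(\mu,\lambda)$ belongs to the negativity range if $\mu>0$ and there is a measurable $K\subseteq\Omega$ with $0<|K|<\infty$ and $\int_Kx_2\,dx<\infty$ such that $\lambda>\lambda_{K,\mu}:=\frac{2\mu^{p-2}|K|}{p\int_K\int_KG(x,y)\,dy\,dx}\left(\int_Kx_2\,dx\right)^{2-p}$. *)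

theory Defs
  imports "HOL-Analysis.Analysis"
begin

section \<open>Partial derivatives, harmonic functions\<close>

definition partial :: "2 \<Rightarrow> (real^2 \<Rightarrow> real) \<Rightarrow> real^2 \<Rightarrow> real" where
  "partial i f x = frechet_derivative f (at x) (axis i 1)"

definition C1_on :: "(real^2) set \<Rightarrow> (real^2 \<Rightarrow> real) \<Rightarrow> bool" where
  "C1_on D f \<longleftrightarrow> (\<forall>x\<in>D. f differentiable (at x)) \<and> (\<forall>i. continuous_on D (partial i f))"

definition harmonic_on :: "(real^2) set \<Rightarrow> (real^2 \<Rightarrow> real) \<Rightarrow> bool" where
  "harmonic_on D f \<longleftrightarrow> C1_on D f \<and> (\<forall>i. C1_on D (partial i f))
     \<and> (\<forall>x\<in>D. partial 1 (partial 1 f) x + partial 2 (partial 2 f) x = 0)"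

section \<open>The Dirichlet Green's function of a general domain\<close>

text \<open>The fundamental solution of the operator \<open>-\<Delta>\<close> in the plane.\<close>

definition fund_sol :: "real^2 \<Rightarrow> real^2 \<Rightarrow> real" where
  "fund_sol x y = - (1 / (2 * pi)) * ln (norm (x - y))"

text \<open>For an arbitrary domain, with no regularity of the boundary, the Dirichlet Green's function
  with pole \<open>y\<close> is the fundamental solution minus its greatest harmonic minorant. Equivalently it is
  the least nonnegative function that is the fundamental solution plus a harmonic function, which
  is how the zero boundary condition is expressed when some boundary points may be irregular.
  Lemma \<open>dirichlet_greenI\<close> below shows that a function with the right singularity which vanishes
  at the boundary (and at infinity) in the classical sense is the Green's function so defined.
  The values on the diagonal are left unspecified.\<close>

definition dirichlet_green :: "(real^2) set \<Rightarrow> (real^2 \<Rightarrow> real^2 \<Rightarrow> real) \<Rightarrow> bool" where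
  "dirichlet_green D G \<longleftrightarrow> (\<forall>y\<in>D. \<exists>h.
      harmonic_on D h
    \<and> (\<forall>x\<in>D - {y}. h x \<le> fund_sol x y)
    \<and> (\<forall>k. harmonic_on D k \<and> (\<forall>x\<in>D - {y}. k x \<le> fund_sol x y) \<longrightarrow> (\<forall>x\<in>D. k x \<le> h x))
    \<and> (\<forall>x\<in>D - {y}. G x y = fund_sol x y - h x))"

lemma has_derivative_partial:
  assumes "f differentiable (at x)"
  shows "((\<lambda>t. f (x + t *\<^sub>R axis i 1)) has_real_derivative partial i f x) (at 0)"
proof -
  have f: "(f has_derivative frechet_derivative f (at (x + 0 *\<^sub>R axis i 1))) (at (x + 0 *\<^sub>R axis i 1))"
    using assms frechet_derivative_works by auto
  have l: "((\<lambda>t::real. x + t *\<^sub>R axis i 1) has_derivative (\<lambda>t. t *\<^sub>R axis i 1)) (at 0)"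
    by (auto intro!: derivative_eq_intros)
  have "((\<lambda>t. f (x + t *\<^sub>R axis i 1)) has_derivative
      (\<lambda>t. frechet_derivative f (at x) (t *\<^sub>R axis i 1))) (at 0)"
    using has_derivative_compose[OF l f] by simp
  moreover have "linear (frechet_derivative f (at x))"
    by (rule linear_frechet_derivative[OF assms])
  ultimately have "((\<lambda>t. f (x + t *\<^sub>R axis i 1)) has_derivative (\<lambda>t. t * partial i f x)) (at 0)"
    by (simp add: partial_def linear_cmul)
  then show ?thesis
    by (rule has_derivative_imp_has_field_derivative) simp
qed

lemma has_derivative_partial_line:
  assumes "f differentiable (at (x + s *\<^sub>R axis i 1))"
  shows "((\<lambda>t. f (x + t *\<^sub>R axis i 1)) has_real_derivative partial i f (x + s *\<^sub>R axis i 1)) (at s)"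
proof -
  have "((\<lambda>t. f ((x + s *\<^sub>R axis i 1) + t *\<^sub>R axis i 1)) has_real_derivative
      partial i f (x + s *\<^sub>R axis i 1)) (at 0)"
    using has_derivative_partial[OF assms] .
  then have "((\<lambda>t. f (x + (t + s) *\<^sub>R axis i 1)) has_real_derivative
      partial i f (x + s *\<^sub>R axis i 1)) (at 0)"
    by (simp add: algebra_simps)
  then show ?thesis
    using DERIV_shift[of "\<lambda>t. f (x + t *\<^sub>R axis i 1)" _ 0 s] by simp
qed

lemma second_derivative_local_max:
  fixes g g' :: "real \<Rightarrow> real"
  assumes "r > 0" and d: "\<And>t. \<bar>t\<bar> < r \<Longrightarrow> (g has_real_derivative g' t) (at t)"
    and dd: "(g' has_real_derivative c) (at 0)" and m: "\<And>t. \<bar>t\<bar> < r \<Longrightarrow> g t \<le> g 0"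
  shows "c \<le> 0"
proof (rule ccontr)
  assume "\<not> c \<le> 0"
  then obtain e where e: "e > 0" "\<And>h. 0 < h \<Longrightarrow> h < e \<Longrightarrow> g' 0 < g' h"
    using DERIV_pos_inc_right[OF dd] by auto
  have "g' 0 = 0"
    using DERIV_local_max[OF d[of 0], of r] \<open>r > 0\<close> m by (auto simp: abs_minus_commute)
  define s where "s = min e r / 2"
  have s: "0 < s" "s < e" "s < r" using e(1) \<open>r > 0\<close> by (auto simp: s_def)
  obtain z where "0 < z" "z < s" "g s - g 0 = (s - 0) * g' z"
    using MVT2[of 0 s g g'] s d by auto
  with e(2)[of z] s \<open>g' 0 = 0\<close> m[of s] show False
    by (smt (verit) mult_pos_pos)
qed

lemma harmonic_on_diff:
  assumes "open D" "harmonic_on D f" "harmonic_on D g"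
  shows "harmonic_on D (\<lambda>x. f x - g x)"
proof -
  have p: "partial i (\<lambda>x. f x - g x) x = partial i f x - partial i g x"
    if "f differentiable (at x)" "g differentiable (at x)" for f g :: "real^2 \<Rightarrow> real" and i x
  proof -
    have "((\<lambda>x. f x - g x) has_derivative
        (\<lambda>z. frechet_derivative f (at x) z - frechet_derivative g (at x) z)) (at x)"
      using that by (intro has_derivative_diff) (simp_all add: frechet_derivative_works[symmetric])
    from frechet_derivative_at[OF this] show ?thesis
      by (metis partial_def)
  qed
  have cong: "F differentiable (at x) \<and> partial j F x = partial j H x"
    if "\<And>z. z \<in> D \<Longrightarrow> F z = H z" "x \<in> D" "H differentiable (at x)" for F H :: "real^2 \<Rightarrow> real" and j x
  proof -
    have "(H has_derivative frechet_derivative H (at x)) (at x)"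
      using that(3) frechet_derivative_works by blast
    then have "(F has_derivative frechet_derivative H (at x)) (at x)"
      by (rule has_derivative_transform_within_open[OF _ \<open>open D\<close> \<open>x \<in> D\<close>]) (simp add: that(1))
    then show ?thesis
      by (auto simp: partial_def differentiable_def dest: frechet_derivative_at)
  qed
  have C: "C1_on D F" if "\<And>z. z \<in> D \<Longrightarrow> F z = f z - g z" "C1_on D f" "C1_on D g"
    for F f g :: "real^2 \<Rightarrow> real"
  proof -
    have d: "F differentiable (at x) \<and> partial j F x = partial j f x - partial j g x"
      if "x \<in> D" for x j
    proof -
      have fg: "f differentiable (at x)" "g differentiable (at x)"
        using \<open>C1_on D f\<close> \<open>C1_on D g\<close> \<open>x \<in> D\<close> by (auto simp: C1_on_def)
      then have "(\<lambda>x. f x - g x) differentiable (at x)" by auto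
      from cong[OF _ \<open>x \<in> D\<close> this, where F=F and j=j] p[OF fg] \<open>\<And>z. z \<in> D \<Longrightarrow> F z = f z - g z\<close>
      show ?thesis by auto
    qed
    have "continuous_on D (partial j F)" for j
    proof -
      have "continuous_on D (\<lambda>x. partial j f x - partial j g x)"
        using that by (auto simp: C1_on_def intro!: continuous_intros)
      then show ?thesis
        by (rule continuous_on_eq) (simp add: d)
    qed
    with d show ?thesis by (auto simp: C1_on_def)
  qed
  let ?v = "\<lambda>x. f x - g x"
  have f: "C1_on D f" "C1_on D (partial i f)" and g: "C1_on D g" "C1_on D (partial i g)" for i
    using assms by (auto simp: harmonic_on_def)
  have pv: "partial i ?v x = partial i f x - partial i g x" if "x \<in> D" for i x
    using p that f(1) g(1) by (auto simp: C1_on_def)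
  have ppv: "partial i (partial i ?v) x = partial i (partial i f) x - partial i (partial i g) x"
    if "x \<in> D" for i x
  proof -
    have d: "partial i f differentiable (at x)" "partial i g differentiable (at x)"
      using f(2)[of i] g(2)[of i] that by (auto simp: C1_on_def)
    then have "(\<lambda>x. partial i f x - partial i g x) differentiable (at x)" by auto
    from cong[OF pv that this, where j=i] p[OF d] show ?thesis by auto
  qed
  show ?thesis
    unfolding harmonic_on_def
  proof (intro conjI allI ballI)
    show "C1_on D ?v" by (rule C[OF _ f(1) g(1)]) simp
    show "C1_on D (partial i ?v)" for i by (rule C[OF pv f(2) g(2)])
    show "partial 1 (partial 1 ?v) x + partial 2 (partial 2 ?v) x = 0" if "x \<in> D" for x
    proof -
      have "partial 1 (partial 1 f) x + partial 2 (partial 2 f) x = 0"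
        "partial 1 (partial 1 g) x + partial 2 (partial 2 g) x = 0"
        using assms that by (auto simp: harmonic_on_def)
      then show ?thesis by (simp add: ppv[OF that])
    qed
  qed
qed

lemma harmonic_on_max_principle:
  assumes "open D" and v: "harmonic_on D v"
    and b: "\<And>e. e > 0 \<Longrightarrow> \<exists>C. compact C \<and> C \<subseteq> D \<and> (\<forall>x\<in>D - C. v x < e)"
    and "x0 \<in> D"
  shows "v x0 \<le> 0"
proof (rule ccontr)
  assume "\<not> v x0 \<le> 0"
  define M where "M = v x0"
  have "M > 0" using \<open>\<not> v x0 \<le> 0\<close> by (simp add: M_def)
  obtain C where C: "compact C" "C \<subseteq> D" "\<And>x. x \<in> D - C \<Longrightarrow> v x < M / 2"
    using b[of "M / 2"] \<open>M > 0\<close> by auto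
  have "x0 \<in> C" using C(3)[of x0] \<open>x0 \<in> D\<close> \<open>M > 0\<close> by (force simp: M_def)
  have dv: "v differentiable (at x)" if "x \<in> D" for x
    using v that by (auto simp: harmonic_on_def C1_on_def)
  have cv: "continuous_on D v"
    using dv by (meson continuous_at_imp_continuous_on differentiable_imp_continuous_within)
  obtain R where R: "R > 0" "\<And>x. x \<in> C \<Longrightarrow> norm (x - x0) \<le> R"
  proof -
    have "bounded ((\<lambda>x. x - x0) ` C)"
      using C(1) by (auto intro!: compact_imp_bounded compact_continuous_image continuous_intros)
    then show ?thesis using that by (auto simp: bounded_pos)
  qed
  define d where "d = M / (4 * R\<^sup>2)"
  have d: "d > 0" "d * R\<^sup>2 = M / 4" using \<open>M > 0\<close> R(1) by (auto simp: d_def)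
  define w where "w = (\<lambda>x. v x + d * ((x - x0) \<bullet> (x - x0)))"
  have "continuous_on C w"
    unfolding w_def using cv C(2) by (auto intro!: continuous_intros intro: continuous_on_subset)
  then obtain m where m: "m \<in> C" "\<And>x. x \<in> C \<Longrightarrow> w x \<le> w m"
    using continuous_attains_sup[OF C(1)] \<open>x0 \<in> C\<close> by blast
  have "m \<in> D" using m C by auto
  have "M \<le> w m" using m(2)[OF \<open>x0 \<in> C\<close>] by (simp add: w_def M_def)
  moreover have "(m - x0) \<bullet> (m - x0) \<le> R\<^sup>2"
    using R(2)[OF m(1)] by (metis dot_square_norm norm_ge_zero power_mono)
  then have "d * ((m - x0) \<bullet> (m - x0)) \<le> M / 4"
    using d by (metis mult_left_mono less_imp_le)
  ultimately have "v m > M / 2" using \<open>M > 0\<close> by (simp add: w_def)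
  have "open (D \<inter> v -` {M / 2 <..})"
    using continuous_open_preimage[OF cv \<open>open D\<close> open_greaterThan] .
  then obtain r where r: "r > 0" "ball m r \<subseteq> D \<inter> v -` {M / 2 <..}"
    using \<open>m \<in> D\<close> \<open>v m > M / 2\<close> by (meson IntI greaterThan_iff openE vimageI)
  then have rC: "ball m r \<subseteq> C" using C(3) by force
  have sq: "(a + t *\<^sub>R b - c) \<bullet> (a + t *\<^sub>R b - c)
      = (a - c) \<bullet> (a - c) + 2 * t * ((a - c) \<bullet> b) + t\<^sup>2 * (b \<bullet> b)" for a b c :: "real^2" and t
  proof -
    have "a + t *\<^sub>R b - c = (a - c) + t *\<^sub>R b" by simp
    then show ?thesis
      by (simp only: inner_add_left inner_add_right inner_scaleR_left inner_scaleR_right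
          inner_commute[of b "a - c"] power2_eq_square) (simp add: algebra_simps)
  qed
  have quad: "((\<lambda>t. d * (a + 2 * t * c + t\<^sup>2)) has_real_derivative d * (2 * c + 2 * t)) (at t)"
    and lin: "((\<lambda>t. d * (2 * c + 2 * t)) has_real_derivative 2 * d) (at t)" for a c t :: real
    by (auto intro!: derivative_eq_intros)
  have i: "partial i (partial i v) m + 2 * d \<le> 0" for i
  proof (rule second_derivative_local_max[OF r(1)])
    let ?l = "\<lambda>t. m + t *\<^sub>R axis i (1::real)"
    let ?g = "\<lambda>t. v (?l t) + d * ((m - x0) \<bullet> (m - x0) + 2 * t * ((m - x0) \<bullet> axis i 1) + t\<^sup>2)"
    let ?g' = "\<lambda>t. partial i v (?l t) + d * (2 * ((m - x0) \<bullet> axis i 1) + 2 * t)"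
    have ball: "?l t \<in> ball m r" if "\<bar>t\<bar> < r" for t
      using that by (simp add: dist_norm norm_axis_1)
    have gw: "?g t = w (?l t)" for t
    proof -
      have "axis i (1::real) \<bullet> axis i 1 = 1" by (simp add: inner_axis_axis)
      moreover have "(m + t *\<^sub>R axis i 1 - x0) \<bullet> (m + t *\<^sub>R axis i 1 - x0)
          = (m - x0) \<bullet> (m - x0) + 2 * t * ((m - x0) \<bullet> axis i 1) + t\<^sup>2 * (axis i 1 \<bullet> axis i (1::real))"
        by (rule sq)
      ultimately show ?thesis unfolding w_def by (simp only: mult_1_right)
    qed
    show "(?g has_real_derivative ?g' t) (at t)" if "\<bar>t\<bar> < r" for t
    proof -
      have "?l t \<in> D" using ball[OF that] r by auto
      from has_derivative_partial_line[OF dv[OF this]] show ?thesis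
        by (rule DERIV_add[OF _ quad])
    qed
    have "partial i v differentiable (at m)"
      using v \<open>m \<in> D\<close> by (auto simp: harmonic_on_def C1_on_def)
    from has_derivative_partial[OF this]
    show "(?g' has_real_derivative partial i (partial i v) m + 2 * d) (at 0)"
      by (rule DERIV_add[OF _ lin])
    show "?g t \<le> ?g 0" if "\<bar>t\<bar> < r" for t
    proof -
      have "w (?l t) \<le> w m" using m(2) ball[OF that] rC by blast
      moreover have "w (?l 0) = w m" by simp
      ultimately show ?thesis unfolding gw by linarith
    qed
  qed
  have "partial 1 (partial 1 v) m + partial 2 (partial 2 v) m = 0"
    using v \<open>m \<in> D\<close> by (auto simp: harmonic_on_def)
  with i[of 1] i[of 2] d(1) show False by linarith
qed

lemma dirichlet_greenI:
  assumes "open D"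
    and G: "\<And>y. y \<in> D \<Longrightarrow> \<exists>h. harmonic_on D h \<and> (\<forall>x\<in>D - {y}. G x y = fund_sol x y - h x)"
    and nonneg: "\<And>x y. x \<in> D \<Longrightarrow> y \<in> D \<Longrightarrow> x \<noteq> y \<Longrightarrow> 0 \<le> G x y"
    and zero: "\<And>y e. y \<in> D \<Longrightarrow> e > 0 \<Longrightarrow> \<exists>C. compact C \<and> C \<subseteq> D \<and> (\<forall>x\<in>D - C. G x y < e)"
  shows "dirichlet_green D G"
  unfolding dirichlet_green_def
proof
  fix y assume "y \<in> D"
  then obtain h where h: "harmonic_on D h" "\<And>x. x \<in> D - {y} \<Longrightarrow> G x y = fund_sol x y - h x"
    using G by blast
  have "k x \<le> h x" if k: "harmonic_on D k" "\<And>x. x \<in> D - {y} \<Longrightarrow> k x \<le> fund_sol x y" and "x \<in> D" for k x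
  proof -
    have "k x - h x \<le> 0"
    proof (rule harmonic_on_max_principle[OF \<open>open D\<close> harmonic_on_diff[OF \<open>open D\<close> k(1) h(1)] _ \<open>x \<in> D\<close>])
      fix e :: real assume "e > 0"
      then obtain C where C: "compact C" "C \<subseteq> D" "\<And>x. x \<in> D - C \<Longrightarrow> G x y < e"
        using zero[OF \<open>y \<in> D\<close> \<open>e > 0\<close>] by auto
      show "\<exists>C. compact C \<and> C \<subseteq> D \<and> (\<forall>x\<in>D - C. k x - h x < e)"
      proof (intro exI[of _ "insert y C"] conjI ballI)
        fix z assume "z \<in> D - insert y C"
        with C(3)[of z] k(2)[of z] h(2)[of z] show "k z - h z < e" by auto
      qed (use C \<open>y \<in> D\<close> in auto)
    qed
    then show ?thesis by simp
  qed
  moreover have "h x \<le> fund_sol x y" if "x \<in> D - {y}" for x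
    using h(2)[OF that] nonneg[of x y] \<open>y \<in> D\<close> that by auto
  ultimately show "\<exists>h. harmonic_on D h
    \<and> (\<forall>x\<in>D - {y}. h x \<le> fund_sol x y)
    \<and> (\<forall>k. harmonic_on D k \<and> (\<forall>x\<in>D - {y}. k x \<le> fund_sol x y) \<longrightarrow> (\<forall>x\<in>D. k x \<le> h x))
    \<and> (\<forall>x\<in>D - {y}. G x y = fund_sol x y - h x)"
    using h by (intro exI[of _ h]) auto
qed

section \<open>The domains\<close>

definition half_plane :: "(real^2) set" where
  "half_plane = {x. x $ 2 > 0}"

definition green_half_plane :: "real^2 \<Rightarrow> real^2 \<Rightarrow> real" where
  "green_half_plane x y = 1 / (4 * pi) * ln (1 + 4 * x $ 2 * y $ 2 / (norm (x - y))\<^sup>2)"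

definition strip :: "real \<Rightarrow> (real^2) set" where
  "strip L = {x. 0 < x $ 2 \<and> x $ 2 < L}"

definition green_strip :: "real \<Rightarrow> real^2 \<Rightarrow> real^2 \<Rightarrow> real" where
  "green_strip L x y = 1 / (4 * pi) * ln (1 +
     sin (pi / L * x $ 2) * sin (pi / L * y $ 2) /
     ((sinh (pi / (2 * L) * (x $ 1 - y $ 1)))\<^sup>2 + (sin (pi / (2 * L) * (x $ 2 - y $ 2)))\<^sup>2))"

definition weak_finite_volume :: "real \<Rightarrow> (real^2) set \<Rightarrow> bool" where
  "weak_finite_volume q D \<longleftrightarrow>
     integrable (lebesgue_on (D \<inter> {x. x $ 2 < 1})) (\<lambda>x. x $ 2 powr q)
   \<and> emeasure lebesgue (D \<inter> {x. x $ 2 \<ge> 1}) < \<infinity>"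

definition potential :: "(real^2) set \<Rightarrow> (real^2 \<Rightarrow> real^2 \<Rightarrow> real) \<Rightarrow> (real^2 \<Rightarrow> real) \<Rightarrow> real^2 \<Rightarrow> real" where
  "potential \<Omega> G \<omega> x = (LINT y|lebesgue_on \<Omega>. G x y * \<omega> y)"

text \<open>Velocity fields of finite energy which are incompressible and tangent to the boundary.
  As the boundary need not be smooth, tangency is the usual weak no-penetration condition, namely
  orthogonality in \<open>L\<^sup>2\<close> to all gradients in \<open>L\<^sup>2\<close>; when the boundary is smooth and the
  field is continuous up to it, this means that the normal component vanishes.\<close>

definition tangent_flow :: "(real^2) set \<Rightarrow> (real^2 \<Rightarrow> real^2) \<Rightarrow> bool" where
  "tangent_flow D u \<longleftrightarrow>
     (\<forall>i. C1_on D (\<lambda>x. u x $ i))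
   \<and> integrable (lebesgue_on D) (\<lambda>x. (norm (u x))\<^sup>2)
   \<and> (\<forall>x\<in>D. partial 1 (\<lambda>x. u x $ 1) x + partial 2 (\<lambda>x. u x $ 2) x = 0)
   \<and> (\<forall>f. C1_on D f \<and> (\<forall>i. integrable (lebesgue_on D) (\<lambda>x. (partial i f x)\<^sup>2)) \<longrightarrow>
        (LINT x|lebesgue_on D. u x $ 1 * partial 1 f x + u x $ 2 * partial 2 f x) = 0)"

definition vorticity :: "(real^2 \<Rightarrow> real^2) \<Rightarrow> real^2 \<Rightarrow> real" where
  "vorticity u x = partial 1 (\<lambda>x. u x $ 2) x - partial 2 (\<lambda>x. u x $ 1) x"

text \<open>The Biot-Savart law. Here \<open>\<nabla>\<^sup>\<bottom> = (\<partial>\<^sub>2, -\<partial>\<^sub>1)\<close>, which is the sign for which the field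
  \<open>\<nabla>\<^sup>\<bottom> \<psi>\<close> has vorticity \<open>-\<Delta>\<psi>\<close>. The law is only demanded of flows of finite energy whose
  vorticity has compact support in the domain: without a condition at infinity it fails even in
  the half-plane (constant horizontal flow). It holds on simply connected domains, and excludes
  domains with holes around which there is a circulation not seen by the vorticity.\<close>

definition biot_savart :: "(real^2) set \<Rightarrow> (real^2 \<Rightarrow> real^2 \<Rightarrow> real) \<Rightarrow> bool" where
  "biot_savart D G \<longleftrightarrow> (\<forall>u C. tangent_flow D u \<and> compact C \<and> C \<subseteq> D \<and> (\<forall>x\<in>D - C. vorticity u x = 0) \<longrightarrow>
     (\<forall>x\<in>D. potential D G (vorticity u) differentiable (at x)
        \<and> u x $ 1 = partial 2 (potential D G (vorticity u)) x
        \<and> u x $ 2 = - partial 1 (potential D G (vorticity u)) x))"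

definition admissible_domain :: "(real^2) set \<Rightarrow> (real^2 \<Rightarrow> real^2 \<Rightarrow> real) \<Rightarrow> bool" where
  "admissible_domain \<Omega> G \<longleftrightarrow>
     (\<Omega> = half_plane \<and> G = green_half_plane)
   \<or> (\<exists>L>0. \<Omega> = strip L \<and> G = green_strip L)
   \<or> (open \<Omega> \<and> connected \<Omega> \<and> \<Omega> \<noteq> {} \<and> \<Omega> \<subseteq> half_plane
       \<and> (\<exists>q\<ge>0. weak_finite_volume q \<Omega>) \<and> dirichlet_green \<Omega> G \<and> biot_savart \<Omega> G)"

section \<open>The variational problem\<close>

definition energy :: "(real^2) set \<Rightarrow> (real^2 \<Rightarrow> real^2 \<Rightarrow> real) \<Rightarrow> (real^2 \<Rightarrow> real) \<Rightarrow> real" where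
  "energy \<Omega> G \<omega> = 1/2 * (LINT x|lebesgue_on \<Omega>. LINT y|lebesgue_on \<Omega>. G x y * \<omega> x * \<omega> y)"

definition penalized_energy ::
    "(real^2) set \<Rightarrow> (real^2 \<Rightarrow> real^2 \<Rightarrow> real) \<Rightarrow> real \<Rightarrow> real \<Rightarrow> (real^2 \<Rightarrow> real) \<Rightarrow> real" where
  "penalized_energy \<Omega> G p lam \<omega> =
     energy \<Omega> G \<omega> - 1 / (p * lam) * (LINT x|lebesgue_on \<Omega>. \<bar>\<omega> x\<bar> powr p)"

definition admissible_vorticities :: "(real^2) set \<Rightarrow> real \<Rightarrow> real \<Rightarrow> (real^2 \<Rightarrow> real) set" where
  "admissible_vorticities \<Omega> p \<mu> = {\<omega>.
     \<omega> \<in> borel_measurable (lebesgue_on \<Omega>)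
   \<and> integrable (lebesgue_on \<Omega>) (\<lambda>x. \<bar>\<omega> x\<bar> powr p)
   \<and> (AE x in lebesgue_on \<Omega>. \<omega> x \<ge> 0)
   \<and> integrable (lebesgue_on \<Omega>) (\<lambda>x. x $ 2 * \<omega> x)
   \<and> (LINT x|lebesgue_on \<Omega>. x $ 2 * \<omega> x) = \<mu>}"

definition min_value :: "(real^2) set \<Rightarrow> (real^2 \<Rightarrow> real^2 \<Rightarrow> real) \<Rightarrow> real \<Rightarrow> real \<Rightarrow> real \<Rightarrow> ereal" where
  "min_value \<Omega> G p \<mu> lam =
     (INF \<omega>\<in>admissible_vorticities \<Omega> p \<mu>. ereal (- penalized_energy \<Omega> G p lam \<omega>))"

definition minimizers ::
    "(real^2) set \<Rightarrow> (real^2 \<Rightarrow> real^2 \<Rightarrow> real) \<Rightarrow> real \<Rightarrow> real \<Rightarrow> real \<Rightarrow> (real^2 \<Rightarrow> real) set" where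
  "minimizers \<Omega> G p \<mu> lam = {\<omega> \<in> admissible_vorticities \<Omega> p \<mu>.
     ereal (- penalized_energy \<Omega> G p lam \<omega>) = min_value \<Omega> G p \<mu> lam}"

definition negativity_threshold ::
    "(real^2 \<Rightarrow> real^2 \<Rightarrow> real) \<Rightarrow> real \<Rightarrow> (real^2) set \<Rightarrow> real \<Rightarrow> real" where
  "negativity_threshold G p K \<mu> =
     2 * \<mu> powr (p - 2) * measure lebesgue K
       / (p * (LINT x|lebesgue_on K. LINT y|lebesgue_on K. G x y))
     * (LINT x|lebesgue_on K. x $ 2) powr (2 - p)"

definition negativity_range ::
    "(real^2) set \<Rightarrow> (real^2 \<Rightarrow> real^2 \<Rightarrow> real) \<Rightarrow> real \<Rightarrow> (real \<times> real) set" where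
  "negativity_range \<Omega> G p = {(\<mu>, lam). \<mu> > 0 \<and>
     (\<exists>K. K \<in> sets lebesgue \<and> K \<subseteq> \<Omega> \<and> 0 < emeasure lebesgue K \<and> emeasure lebesgue K < \<infinity>
        \<and> integrable (lebesgue_on K) (\<lambda>x. x $ 2) \<and> lam > negativity_threshold G p K \<mu>)}"

end

theory Submission
  imports Defs "HOL-Complex_Analysis.Complex_Analysis" "HOL-Probability.Giry_Monad" "HOL-Real_Asymp.Real_Asymp"
begin

text \<open>The constraint set is convex, so a minimizer \<open>\<omega>\<close> can be compared with the segment from \<open>\<omega>\<close> to
  any other competitor \<open>v\<close>. Differentiating at \<open>\<omega>\<close> gives \<open>\<integral> \<Phi> v \<le> \<integral> \<Phi> \<omega>\<close> for
  \<open>\<Phi> = \<psi> - \<omega>\<^sup>p\<^sup>-\<^sup>1 / \<lambda>\<close>. Put \<open>W = \<integral> \<Phi> \<omega> / \<mu>\<close>. Competitors concentrated where \<open>\<Phi> > W x\<^sub>2\<close> show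
  that this set is null, and then \<open>\<integral> (W x\<^sub>2 - \<Phi>) \<omega> = 0\<close> forces \<open>\<Phi> = W x\<^sub>2\<close> wherever \<open>\<omega> > 0\<close>; these two
  facts are the claimed equation. As \<open>\<mu> > 0\<close>, the set \<open>{\<omega> > 0}\<close> is not null, and almost any of
  its points determines \<open>W\<close>. This is \<open>euler_lagrange\<close>, which is stated for an abstract measure, weight and kernel.

  The argument differentiates a quadratic form under the integral, for which two properties of the
  kernel are essential.

  Finite energy. All kernels are dominated by the one of the half-plane, for which
  \<open>\<integral>\<integral> G u u < \<infinity>\<close> whenever \<open>x\<^sub>2 u\<close> and \<open>u\<^sup>p\<close> are integrable. The bounds
  \<open>G \<le> C (x\<^sub>2 y\<^sub>2 / |x - y|\<^sup>2)\<^sup>a\<close> for two values of \<open>a\<close>, combined with weighted means of \<open>x\<^sub>2 u\<close> and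
  \<open>u\<^sup>p\<close>, lead to an integrable majorant (\<open>green_half_plane_product_bound\<close>).

  Symmetry and joint measurability. These are visible for the half-plane and the strip. For a general
  domain, the Green's function is only known as the fundamental solution minus its greatest harmonic
  minorant, separately for each pole. Up to an explicit harmonic term this is the greatest harmonic
  minorant of the half-plane kernel \<open>k\<close>, and that is the limit of repeated sweeps of \<open>k\<close>: replace the
  function on a disc by the Poisson integral of its boundary values, running through countably many
  discs so that each occurs infinitely often. For \<open>k\<close> itself a sweep in the first
  variable equals the same sweep in the second variable, and sweeps in different variables commute;
  hence a sequence of sweeps in the first variable equals the reversed sequence in the second
  (\<open>sweeps_transpose\<close>). Every nonnegative minorant of \<open>k\<close> which is harmonic in one of its variables therefore lies
  below all the swept kernels, and comparing the limits yields the symmetry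
  (\<open>greatest_harmonic_minorant_symmetric\<close>). As a limit of measurable functions of both variables the
  minorant is also jointly measurable.\<close>

section \<open>The Euler-Lagrange equation of a weighted quadratic energy\<close>

lemma powr_diff_le_tangent:
  fixes a b p :: real
  assumes "p > 1" "a \<ge> 0" "b \<ge> 0"
  shows "a powr p - b powr p \<le> p * (a - b) * a powr (p - 1)"
proof (cases "a = 0 \<or> b = 0")
  case True
  then show ?thesis
  proof
    assume "b = 0"
    then have "a powr p - b powr p = a * a powr (p - 1)"
      using assms powr_mult_base[of a "p - 1"] by simp
    moreover have "\<dots> \<le> p * (a * a powr (p - 1))"
      using mult_right_mono[of 1 p "a * a powr (p - 1)"] assms by simp
    ultimately show ?thesis using \<open>b = 0\<close> by (simp add: mult.assoc)
  qed (use assms in auto)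
next
  case False
  then have pos: "a > 0" "b > 0" using assms by auto
  have "((\<lambda>x. x powr p) has_real_derivative p * a powr (p - 1)) (at a within {0<..})"
    using pos by (auto intro!: derivative_eq_intros)
  then have "p * a powr (p - 1) * (b - a) \<le> b powr p - a powr p"
    using pos assms by (intro convex_on_imp_above_tangent[OF powr_convex]) (auto simp: interior_open)
  then show ?thesis by (simp add: algebra_simps)
qed

lemma powr_add_le_double:
  fixes a b p :: real
  assumes "p > 0" "a \<ge> 0" "b \<ge> 0"
  shows "(a + b) powr p \<le> 2 powr p * (a powr p + b powr p)"
proof -
  have "(a + b) powr p \<le> (2 * max a b) powr p"
    using assms by (intro powr_mono2) auto
  also have "\<dots> = 2 powr p * max a b powr p" using assms by (simp add: powr_mult)
  also have "max a b powr p \<le> a powr p + b powr p" by (simp add: max_def)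
  finally show ?thesis by simp
qed

text \<open>The setting of the variational argument: a measure stands for the domain, a positive weight \<open>w\<close>
  for the height \<open>x\<^sub>2\<close>, and a symmetric measurable kernel for the Green's function.\<close>

locale weighted_energy = sigma_finite_measure M for M :: "'a measure" +
  fixes w :: "'a \<Rightarrow> real" and g :: "'a \<Rightarrow> 'a \<Rightarrow> real" and p :: real
  assumes w_measurable [measurable]: "w \<in> borel_measurable M"
    and w_pos: "\<And>x. x \<in> space M \<Longrightarrow> w x > 0"
    and g_measurable [measurable]: "case_prod g \<in> borel_measurable (M \<Otimes>\<^sub>M M)"
    and g_sym: "\<And>x y. x \<in> space M \<Longrightarrow> y \<in> space M \<Longrightarrow> g x y = g y x"
    and p_gt_1: "p > 1"
begin

definition densities :: "('a \<Rightarrow> real) set" where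
  "densities = {u \<in> borel_measurable M. integrable M (\<lambda>x. \<bar>u x\<bar> powr p)
     \<and> (AE x in M. u x \<ge> 0) \<and> integrable M (\<lambda>x. w x * u x)}"

definition form :: "('a \<Rightarrow> real) \<Rightarrow> ('a \<Rightarrow> real) \<Rightarrow> real" where
  "form u v = (LINT z|(M \<Otimes>\<^sub>M M). g (fst z) (snd z) * u (fst z) * v (snd z))"

definition pot :: "('a \<Rightarrow> real) \<Rightarrow> 'a \<Rightarrow> real" where
  "pot u x = (LINT y|M. g x y * u y)"

definition functional :: "real \<Rightarrow> ('a \<Rightarrow> real) \<Rightarrow> real" where
  "functional lam u = 1 / 2 * form u u - 1 / (p * lam) * (LINT x|M. \<bar>u x\<bar> powr p)"

sublocale MM: pair_sigma_finite M M ..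

lemma densities_combine:
  assumes u: "u \<in> densities" and v: "v \<in> densities" and "a \<ge> 0" "b \<ge> 0"
  shows "(\<lambda>x. a * u x + b * v x) \<in> densities"
proof -
  have [measurable]: "u \<in> borel_measurable M" "v \<in> borel_measurable M"
    using u v by (auto simp: densities_def)
  have nn: "AE x in M. u x \<ge> 0" "AE x in M. v x \<ge> 0" using u v by (auto simp: densities_def)
  have "integrable M (\<lambda>x. 2 powr p * (a powr p * \<bar>u x\<bar> powr p + b powr p * \<bar>v x\<bar> powr p))"
    using u v by (auto simp: densities_def)
  then have "integrable M (\<lambda>x. \<bar>a * u x + b * v x\<bar> powr p)"
  proof (rule Bochner_Integration.integrable_bound)
    show "AE x in M. norm (\<bar>a * u x + b * v x\<bar> powr p)
        \<le> norm (2 powr p * (a powr p * \<bar>u x\<bar> powr p + b powr p * \<bar>v x\<bar> powr p))"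
      using nn
    proof eventually_elim
      case (elim x)
      have "(a * u x + b * v x) powr p \<le> 2 powr p * ((a * u x) powr p + (b * v x) powr p)"
        using elim assms p_gt_1 by (intro powr_add_le_double) auto
      with elim assms show ?case by (simp add: powr_mult)
    qed
  qed measurable
  moreover have "AE x in M. a * u x + b * v x \<ge> 0"
    using nn by eventually_elim (use assms in auto)
  moreover have "integrable M (\<lambda>x. a * (w x * u x) + b * (w x * v x))"
    using u v by (auto simp: densities_def)
  ultimately show ?thesis by (simp add: densities_def algebra_simps)
qed

lemma AE_pair_both:
  assumes "AE x in M. P x" and [measurable]: "Measurable.pred M P"
  shows "AE z in M \<Otimes>\<^sub>M M. P (fst z) \<and> P (snd z)"
proof (rule MM.AE_pair_measure)
  show "{x \<in> space (M \<Otimes>\<^sub>M M). P (fst x) \<and> P (snd x)} \<in> sets (M \<Otimes>\<^sub>M M)" by measurable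
  show "AE x in M. AE y in M. P (fst (x, y)) \<and> P (snd (x, y))"
    using assms(1) by eventually_elim (use assms(1) in auto)
qed

end

locale finite_weighted_energy = weighted_energy +
  assumes energy_integrable:
    "\<And>u. u \<in> densities \<Longrightarrow> integrable (M \<Otimes>\<^sub>M M) (\<lambda>z. g (fst z) (snd z) * u (fst z) * u (snd z))"
begin

lemma form_integrable:
  assumes u: "u \<in> densities" and v: "v \<in> densities"
  shows "integrable (M \<Otimes>\<^sub>M M) (\<lambda>z. g (fst z) (snd z) * u (fst z) * v (snd z))"
proof -
  have [measurable]: "u \<in> borel_measurable M" "v \<in> borel_measurable M"
    using u v by (auto simp: densities_def)
  have "(\<lambda>x. 1 * u x + 1 * v x) \<in> densities" using u v by (intro densities_combine) auto
  from energy_integrable[OF this] show ?thesis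
  proof (rule Bochner_Integration.integrable_bound)
    have "AE x in M. u x \<ge> 0 \<and> v x \<ge> 0" using u v by (auto simp: densities_def)
    then have "AE z in M \<Otimes>\<^sub>M M. (u (fst z) \<ge> 0 \<and> v (fst z) \<ge> 0) \<and> (u (snd z) \<ge> 0 \<and> v (snd z) \<ge> 0)"
      by (rule AE_pair_both) measurable
    then show "AE z in M \<Otimes>\<^sub>M M. norm (g (fst z) (snd z) * u (fst z) * v (snd z))
      \<le> norm (g (fst z) (snd z) * (1 * u (fst z) + 1 * v (fst z)) * (1 * u (snd z) + 1 * v (snd z)))"
    proof eventually_elim
      case (elim z)
      then have "u (fst z) * v (snd z) \<le> (u (fst z) + v (fst z)) * (u (snd z) + v (snd z))"
        by (intro mult_mono) auto
      with elim show ?case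
        by (simp add: abs_mult mult.assoc mult_left_mono)
    qed
  qed measurable
qed

lemma form_commute:
  assumes "u \<in> densities" "v \<in> densities"
  shows "form u v = form v u"
proof -
  have [measurable]: "u \<in> borel_measurable M" "v \<in> borel_measurable M"
    using assms by (auto simp: densities_def)
  have "form v u = (LINT z|(M \<Otimes>\<^sub>M M). g (snd z) (fst z) * v (snd z) * u (fst z))"
    unfolding form_def
    using MM.integral_product_swap[of "\<lambda>z. g (fst z) (snd z) * v (fst z) * u (snd z)"]
    by (simp add: case_prod_unfold)
  also have "\<dots> = form u v"
    unfolding form_def
    by (intro Bochner_Integration.integral_cong) (auto simp: space_pair_measure g_sym)
  finally show ?thesis by simp
qed

lemma form_eq_iterated:
  assumes "u \<in> densities" "v \<in> densities"
  shows "form u v = (LINT x|M. LINT y|M. g x y * u x * v y)"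
  using MM.integral_fst'[OF form_integrable[OF assms]] by (simp add: form_def)

lemma form_pot:
  assumes "u \<in> densities" "v \<in> densities"
  shows "integrable M (\<lambda>x. pot u x * v x)" "(LINT x|M. pot u x * v x) = form u v"
proof -
  have eq: "(LINT y|M. g x y * v x * u y) = pot u x * v x" for x
  proof -
    have "(LINT y|M. g x y * v x * u y) = (LINT y|M. v x * (g x y * u y))" by (simp add: mult_ac)
    then show ?thesis by (simp add: pot_def)
  qed
  show "integrable M (\<lambda>x. pot u x * v x)"
    using MM.integrable_fst'[OF form_integrable[OF assms(2,1)]] by (simp add: eq)
  show "(LINT x|M. pot u x * v x) = form u v"
    using form_eq_iterated[OF assms(2,1)] by (simp add: eq form_commute[OF assms])
qed

lemma form_segment:
  assumes u: "u \<in> densities" and v: "v \<in> densities"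
  shows "form (\<lambda>x. (1 - t) * u x + t * v x) (\<lambda>x. (1 - t) * u x + t * v x)
    = (1 - t)\<^sup>2 * form u u + 2 * t * (1 - t) * form u v + t\<^sup>2 * form v v"
proof -
  let ?i = "\<lambda>u v z. g (fst z) (snd z) * u (fst z) * v (snd z)"
  have "?i (\<lambda>x. (1 - t) * u x + t * v x) (\<lambda>x. (1 - t) * u x + t * v x) z
      = (1 - t)\<^sup>2 * ?i u u z + t * (1 - t) * ?i u v z + t * (1 - t) * ?i v u z + t\<^sup>2 * ?i v v z" for z
    by (simp add: power2_eq_square algebra_simps)
  then have "form (\<lambda>x. (1 - t) * u x + t * v x) (\<lambda>x. (1 - t) * u x + t * v x)
    = (LINT z|(M \<Otimes>\<^sub>M M). (1 - t)\<^sup>2 * ?i u u z + t * (1 - t) * ?i u v z + t * (1 - t) * ?i v u z + t\<^sup>2 * ?i v v z)"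
    unfolding form_def by presburger
  also have "\<dots> = (1 - t)\<^sup>2 * form u u + t * (1 - t) * form u v + t * (1 - t) * form v u + t\<^sup>2 * form v v"
    unfolding form_def
    using form_integrable[OF u u] form_integrable[OF u v] form_integrable[OF v u] form_integrable[OF v v]
    by (simp del: mult.assoc)
  finally show ?thesis using form_commute[OF u v] by simp
qed

lemma integrable_powr_mult:
  assumes u: "u \<in> densities" and v: "v \<in> densities"
  shows "integrable M (\<lambda>x. v x * u x powr (p - 1))"
proof -
  have [measurable]: "u \<in> borel_measurable M" "v \<in> borel_measurable M"
    using u v by (auto simp: densities_def)
  have "(\<lambda>x. 1 * u x + 1 * v x) \<in> densities" using u v by (intro densities_combine) auto
  then have "integrable M (\<lambda>x. \<bar>1 * u x + 1 * v x\<bar> powr p)" by (simp only: densities_def mem_Collect_eq)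
  then show ?thesis
  proof (rule Bochner_Integration.integrable_bound)
    have "AE x in M. u x \<ge> 0 \<and> v x \<ge> 0" using u v by (auto simp: densities_def)
    then show "AE x in M. norm (v x * u x powr (p - 1)) \<le> norm (\<bar>1 * u x + 1 * v x\<bar> powr p)"
    proof eventually_elim
      case (elim x)
      have "v x * u x powr (p - 1) \<le> (u x + v x) * (u x + v x) powr (p - 1)"
        using elim p_gt_1 by (intro mult_mono powr_mono2) auto
      also have "\<dots> = (u x + v x) powr p" using elim powr_mult_base[of "u x + v x" "p - 1"] by simp
      finally show ?case using elim by simp
    qed
  qed measurable
qed

text \<open>The constraint set is convex, so moving from the minimizer \<open>u\<close> towards any other competitor
  \<open>v\<close> is admissible. Dividing the energy inequality on the segment by \<open>t\<close> and letting \<open>t \<rightarrow> 0\<close>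
  yields the linear inequality below.\<close>

lemma first_variation:
  assumes lam: "lam > 0" and u: "u \<in> densities" and v: "v \<in> densities"
    and min: "\<And>t. 0 < t \<Longrightarrow> t \<le> 1 \<Longrightarrow>
      functional lam (\<lambda>x. (1 - t) * u x + t * v x) \<le> functional lam u"
  shows "(LINT x|M. (pot u x - u x powr (p - 1) / lam) * v x)
      \<le> (LINT x|M. (pot u x - u x powr (p - 1) / lam) * u x)"
proof -
  have [measurable]: "u \<in> borel_measurable M" "v \<in> borel_measurable M"
    using u v by (auto simp: densities_def)
  have nn: "AE x in M. u x \<ge> 0 \<and> v x \<ge> 0" using u v by (auto simp: densities_def)
  define q where "q t x = (1 - t) * u x + t * v x" for t x
  have [measurable]: "q t \<in> borel_measurable M" for t unfolding q_def by measurable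
  have qc: "q t \<in> densities" if "0 < t" "t \<le> 1" for t
    unfolding q_def using densities_combine[OF u v, of "1 - t" t] that by simp
  define d where "d t = (LINT x|M. (v x - u x) * q t x powr (p - 1))" for t
  have dint: "integrable M (\<lambda>x. (v x - u x) * f x powr (p - 1))" if "f \<in> densities" for f
    using integrable_powr_mult[OF that v] integrable_powr_mult[OF that u]
    by (simp add: left_diff_distrib)
  have key: "0 \<le> form u u - form u v + t * (form u v - form u u / 2 - form v v / 2) + d t / lam"
    if t: "0 < t" "t \<le> 1" for t
  proof -
    have iu: "integrable M (\<lambda>x. \<bar>u x\<bar> powr p)" and iq: "integrable M (\<lambda>x. \<bar>q t x\<bar> powr p)"
      using u qc[OF t] by (simp_all add: densities_def)
    have "(LINT x|M. \<bar>q t x\<bar> powr p) - (LINT x|M. \<bar>u x\<bar> powr p)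
        = (LINT x|M. \<bar>q t x\<bar> powr p - \<bar>u x\<bar> powr p)"
      using iu iq by simp
    also have "\<dots> \<le> (LINT x|M. (p * t) * ((v x - u x) * q t x powr (p - 1)))"
    proof (rule integral_mono_AE)
      show "AE x in M. \<bar>q t x\<bar> powr p - \<bar>u x\<bar> powr p \<le> p * t * ((v x - u x) * q t x powr (p - 1))"
        using nn
      proof eventually_elim
        case (elim x)
        then have "q t x \<ge> 0" using t by (simp add: q_def)
        with powr_diff_le_tangent[OF p_gt_1, of "q t x" "u x"] elim
        have "\<bar>q t x\<bar> powr p - \<bar>u x\<bar> powr p \<le> p * (q t x - u x) * q t x powr (p - 1)" by simp
        also have "q t x - u x = t * (v x - u x)" by (simp add: q_def algebra_simps)
        finally show ?case by (simp add: mult_ac)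
      qed
    qed (use iu iq dint[OF qc[OF t]] in auto)
    also have "\<dots> = p * t * d t" by (simp add: d_def)
    finally have Q: "(LINT x|M. \<bar>q t x\<bar> powr p) - (LINT x|M. \<bar>u x\<bar> powr p) \<le> p * t * d t" .
    have "1 / 2 * form (q t) (q t) - 1 / 2 * form u u
        \<le> 1 / (p * lam) * ((LINT x|M. \<bar>q t x\<bar> powr p) - (LINT x|M. \<bar>u x\<bar> powr p))"
      using min[OF t] unfolding functional_def q_def[abs_def] right_diff_distrib by linarith
    also have "\<dots> \<le> 1 / (p * lam) * (p * t * d t)"
      using Q lam p_gt_1 by (intro mult_left_mono) auto
    also have "\<dots> = t * (d t / lam)" using p_gt_1 by simp
    finally have "1 / 2 * form (q t) (q t) - 1 / 2 * form u u \<le> t * (d t / lam)" .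
    moreover have "1 / 2 * form (q t) (q t) - 1 / 2 * form u u
        = t * (form u v - form u u - t * (form u v - form u u / 2 - form v v / 2))"
      unfolding q_def form_segment[OF u v] by (simp add: power2_eq_square field_simps)
    ultimately have "t * (form u v - form u u - t * (form u v - form u u / 2 - form v v / 2)) \<le> t * (d t / lam)"
      by simp
    then have "form u v - form u u - t * (form u v - form u u / 2 - form v v / 2) \<le> d t / lam"
      using t(1) by (simp only: mult_le_cancel_left_pos)
    then show ?thesis by linarith
  qed
  \<comment> \<open>it remains to let \<open>t\<close> tend to \<open>0\<close>; the integrand of \<open>d t\<close> is dominated by \<open>(u + v)\<^sup>p\<close>\<close>
  define s where "s n = 1 / (real n + 1)" for n :: nat
  have s: "0 < s n" "s n \<le> 1" for n by (auto simp: s_def)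
  have s0: "s \<longlonglongrightarrow> 0" unfolding s_def by real_asymp
  have d_lim: "(\<lambda>n. d (s n)) \<longlonglongrightarrow> (LINT x|M. (v x - u x) * u x powr (p - 1))"
    unfolding d_def
  proof (rule integral_dominated_convergence)
    have "(\<lambda>x. 1 * u x + 1 * v x) \<in> densities" using u v by (intro densities_combine) auto
    then show "integrable M (\<lambda>x. \<bar>1 * u x + 1 * v x\<bar> powr p)" by (simp only: densities_def mem_Collect_eq)
    show "AE x in M. norm ((v x - u x) * q (s n) x powr (p - 1)) \<le> \<bar>1 * u x + 1 * v x\<bar> powr p" for n
      using nn
    proof eventually_elim
      case (elim x)
      have q: "0 \<le> q (s n) x" "q (s n) x \<le> u x + v x"
        using elim s[of n] mult_right_mono[of "1 - s n" 1 "u x"] mult_right_mono[of "s n" 1 "v x"]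
        by (auto simp: q_def)
      have "\<bar>v x - u x\<bar> * q (s n) x powr (p - 1) \<le> (u x + v x) * (u x + v x) powr (p - 1)"
        using elim p_gt_1 q by (intro mult_mono powr_mono2) auto
      also have "\<dots> = (u x + v x) powr p" using elim powr_mult_base[of "u x + v x" "p - 1"] by simp
      finally show ?case using elim by (simp add: abs_mult)
    qed
    show "AE x in M. (\<lambda>n. (v x - u x) * q (s n) x powr (p - 1)) \<longlonglongrightarrow> (v x - u x) * u x powr (p - 1)"
      using nn
    proof eventually_elim
      case (elim x)
      have "(\<lambda>n. (1 - s n) * u x + s n * v x) \<longlonglongrightarrow> (1 - 0) * u x + 0 * v x"
        by (intro tendsto_intros s0)
      then have "(\<lambda>n. q (s n) x) \<longlonglongrightarrow> u x" by (simp add: q_def)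
      moreover have "0 \<le> q (s n) x" for n using elim s[of n] by (auto simp: q_def)
      ultimately have "(\<lambda>n. q (s n) x powr (p - 1)) \<longlonglongrightarrow> u x powr (p - 1)"
        using p_gt_1 by (intro tendsto_powr'[OF _ tendsto_const]) auto
      from tendsto_mult_left[OF this] show ?case .
    qed
  qed measurable
  have "(\<lambda>n. form u u - form u v + s n * (form u v - form u u / 2 - form v v / 2) + d (s n) / lam)
      \<longlonglongrightarrow> form u u - form u v + 0 * (form u v - form u u / 2 - form v v / 2)
        + (LINT x|M. (v x - u x) * u x powr (p - 1)) / lam"
    using lam by (intro tendsto_intros s0 d_lim) auto
  then have lim: "0 \<le> form u u - form u v + (LINT x|M. (v x - u x) * u x powr (p - 1)) / lam"
    using LIMSEQ_le_const[of "\<lambda>n. form u u - form u v + s n * (form u v - form u u / 2 - form v v / 2)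
      + d (s n) / lam"] key[OF s] by simp
  have split: "(LINT x|M. (pot u x - u x powr (p - 1) / lam) * f x)
      = form u f - (LINT x|M. f x * u x powr (p - 1)) / lam" if "f \<in> densities" for f
  proof -
    have "(LINT x|M. (pot u x - u x powr (p - 1) / lam) * f x)
        = (LINT x|M. pot u x * f x - (f x * u x powr (p - 1)) / lam)"
      by (intro Bochner_Integration.integral_cong) (simp_all add: algebra_simps)
    then show ?thesis
      using form_pot[OF u that] integrable_powr_mult[OF u that] by simp
  qed
  have "(LINT x|M. (v x - u x) * u x powr (p - 1))
      = (LINT x|M. v x * u x powr (p - 1)) - (LINT x|M. u x * u x powr (p - 1))"
    using integrable_powr_mult[OF u v] integrable_powr_mult[OF u u] by (simp add: left_diff_distrib)
  with lim show ?thesis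
    by (simp add: split[OF u] split[OF v] diff_divide_distrib)
qed

lemma obtain_positive_density:
  obtains e where "e \<in> densities" "\<And>x. x \<in> space M \<Longrightarrow> e x > 0"
proof -
  obtain f where f [measurable]: "f \<in> borel_measurable M"
    and pos: "\<And>x. 0 < f x" "\<And>x. f x \<le> (1::real)" and int: "integrable M f"
    using obtain_positive_integrable_function by blast
  define e where "e x = f x / (1 + \<bar>w x\<bar>)" for x
  have [measurable]: "e \<in> borel_measurable M" unfolding e_def by measurable
  have e: "0 < e x" "e x \<le> f x" "\<bar>w x\<bar> * e x \<le> f x" for x
    using pos(1)[of x] by (auto simp: e_def divide_simps algebra_simps)
  have "e x powr p \<le> f x" for x
  proof -
    have "e x powr p \<le> e x powr 1"
      using e(1)[of x] e(2)[of x] pos(2)[of x] p_gt_1 by (intro powr_mono') auto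
    then show ?thesis using e(1)[of x] e(2)[of x] by simp
  qed
  then have "integrable M (\<lambda>x. \<bar>e x\<bar> powr p)"
    using e(1) pos(1) by (intro Bochner_Integration.integrable_bound[OF int]) (auto simp: less_imp_le abs_of_pos)
  moreover have "integrable M (\<lambda>x. w x * e x)"
    using e pos(1) by (intro Bochner_Integration.integrable_bound[OF int]) (auto simp: abs_mult abs_of_pos)
  ultimately show ?thesis
    using that[of e] e(1) by (auto simp: densities_def less_imp_le)
qed

text \<open>Write \<open>\<Phi> = pot u - u\<^sup>p\<^sup>-\<^sup>1 / lam\<close> for the derivative of the functional at \<open>u\<close>. By
  \<open>first_variation\<close>, \<open>u\<close> maximizes the linear functional \<open>v \<mapsto> \<integral> \<Phi> v\<close> under the constraint
  \<open>\<integral> w v = \<mu>\<close>, with maximum \<open>W \<mu>\<close> for \<open>W = \<integral> \<Phi> u / \<mu>\<close>. Testing with \<open>v\<close>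
  supported where \<open>\<Phi> > W w\<close> shows that this set is null, and as the maximum is attained at \<open>u\<close>,
  \<open>\<Phi> = W w\<close> where \<open>u > 0\<close>. The latter set is not null because \<open>\<mu> > 0\<close>, and each of its points
  determines \<open>W\<close>.\<close>

lemma euler_lagrange:
  assumes lam: "lam > 0" and \<mu>: "\<mu> > 0" and u: "u \<in> densities" "(LINT x|M. w x * u x) = \<mu>"
    and min: "\<And>v. v \<in> densities \<Longrightarrow> (LINT x|M. w x * v x) = \<mu> \<Longrightarrow>
      functional lam v \<le> functional lam u"
  shows "\<exists>!W. AE x in M. u x powr (p - 1) = lam * max 0 (pot u x - W * w x)"
proof -
  have [measurable]: "u \<in> borel_measurable M" using u by (auto simp: densities_def)
  have [measurable]: "pot u \<in> borel_measurable M" unfolding pot_def by measurable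
  have nn: "AE x in M. u x \<ge> 0" and iu: "integrable M (\<lambda>x. w x * u x)" using u by (auto simp: densities_def)
  define \<Phi> where "\<Phi> x = pot u x - u x powr (p - 1) / lam" for x
  have [measurable]: "\<Phi> \<in> borel_measurable M" unfolding \<Phi>_def by measurable
  have \<Phi>int: "integrable M (\<lambda>x. \<Phi> x * v x)" if "v \<in> densities" for v
  proof -
    have "\<Phi> x * v x = pot u x * v x - v x * u x powr (p - 1) / lam" for x
      by (simp add: \<Phi>_def left_diff_distrib)
    then show ?thesis
      using form_pot(1)[OF u(1) that] integrable_powr_mult[OF u(1) that] by simp
  qed
  have var: "(LINT x|M. \<Phi> x * v x) \<le> (LINT x|M. \<Phi> x * u x)"
    if v: "v \<in> densities" "(LINT x|M. w x * v x) = \<mu>" for v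
    unfolding \<Phi>_def
  proof (rule first_variation[OF lam u(1) v(1)])
    fix t :: real assume t: "0 < t" "t \<le> 1"
    have "(LINT x|M. w x * ((1 - t) * u x + t * v x))
        = (LINT x|M. (1 - t) * (w x * u x) + t * (w x * v x))" by (simp add: algebra_simps)
    also have "\<dots> = \<mu>" using iu v u(2) by (simp add: densities_def algebra_simps)
    finally show "functional lam (\<lambda>x. (1 - t) * u x + t * v x) \<le> functional lam u"
      using t densities_combine[OF u(1) v(1), of "1 - t" t] by (intro min) auto
  qed
  define W where "W = (LINT x|M. \<Phi> x * u x) / \<mu>"
  have le: "AE x in M. \<Phi> x \<le> W * w x"
  proof -
    obtain e where e: "e \<in> densities" "\<And>x. x \<in> space M \<Longrightarrow> e x > 0" using obtain_positive_density by blast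
    have [measurable]: "e \<in> borel_measurable M" using e(1) by (auto simp: densities_def)
    \<comment> \<open>the test density lives where the claim fails; it is normalized to mass \<open>\<mu>\<close> unless it is null\<close>
    define f where "f x = (if \<Phi> x > W * w x then e x else 0)" for x
    have fm [measurable]: "f \<in> borel_measurable M" unfolding f_def by measurable
    have fe: "0 \<le> f x" "f x \<le> e x" if "x \<in> space M" for x
      using e(2)[OF that] by (auto simp: f_def)
    have "integrable M (\<lambda>x. \<bar>f x\<bar> powr p)"
      by (rule Bochner_Integration.integrable_bound[of M "\<lambda>x. \<bar>e x\<bar> powr p"])
        (use e p_gt_1 in \<open>auto simp: densities_def f_def intro!: AE_I2 powr_mono2\<close>)
    moreover have "integrable M (\<lambda>x. w x * f x)"
      by (rule Bochner_Integration.integrable_bound[of M "\<lambda>x. w x * e x"])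
        (use e(1) fe in \<open>auto simp: densities_def f_def intro!: AE_I2\<close>)
    ultimately have f: "f \<in> densities" using fe by (auto simp: densities_def intro!: AE_I2)
    define m where "m = (LINT x|M. w x * f x)"
    have iwf: "integrable M (\<lambda>x. w x * f x)" using f by (simp add: densities_def)
    have wf: "0 \<le> w x * f x" if "x \<in> space M" for x
      using fe(1)[OF that] w_pos[OF that] by simp
    have "m \<ge> 0" unfolding m_def using wf by (intro integral_nonneg_AE AE_I2)
    have "(LINT x|M. \<Phi> x * f x) \<le> W * m"
    proof (cases "m = 0")
      case True
      have "AE x in M. w x * f x = 0"
        using integral_nonneg_eq_0_iff_AE[OF iwf] True wf by (auto simp: m_def intro!: AE_I2)
      then have "AE x in M. \<Phi> x * f x = 0"
        using AE_space by eventually_elim (use w_pos in force)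
      then have "(LINT x|M. \<Phi> x * f x) = (LINT x|M. 0)"
        by (intro integral_cong_AE) auto
      then show ?thesis using True by simp
    next
      case False
      then have "m > 0" using \<open>m \<ge> 0\<close> by simp
      have c: "(\<lambda>x. \<mu> / m * f x + 0 * f x) \<in> densities"
        using f \<mu> \<open>m > 0\<close> by (intro densities_combine) auto
      have "(LINT x|M. w x * (\<mu> / m * f x)) = (LINT x|M. \<mu> / m * (w x * f x))"
        by (simp add: mult_ac)
      also have "\<dots> = \<mu> / m * m" unfolding m_def by (rule integral_mult_right_zero)
      finally have "(LINT x|M. \<Phi> x * (\<mu> / m * f x)) \<le> W * \<mu>"
        using var[of "\<lambda>x. \<mu> / m * f x"] c \<open>m > 0\<close> \<mu> by (simp add: W_def)
      moreover have "(LINT x|M. \<Phi> x * (\<mu> / m * f x)) = (LINT x|M. \<mu> / m * (\<Phi> x * f x))"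
        by (simp add: mult_ac)
      ultimately have "\<mu> / m * (LINT x|M. \<Phi> x * f x) \<le> \<mu> / m * (W * m)"
        using \<open>m > 0\<close> integral_mult_right_zero[of M "\<mu> / m" "\<lambda>x. \<Phi> x * f x"]
        by (simp add: mult.commute[of \<mu> W])
      moreover have "\<mu> / m > 0" using \<mu> \<open>m > 0\<close> by simp
      ultimately show ?thesis by (simp only: mult_le_cancel_left_pos)
    qed
    moreover have i: "integrable M (\<lambda>x. \<Phi> x * f x - W * (w x * f x))"
      using \<Phi>int[OF f] iwf by simp
    moreover have "(LINT x|M. \<Phi> x * f x - W * (w x * f x)) = (LINT x|M. \<Phi> x * f x) - W * m"
      using \<Phi>int[OF f] iwf by (simp add: m_def)
    moreover have nonneg: "0 \<le> \<Phi> x * f x - W * (w x * f x)" if "x \<in> space M" for x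
    proof -
      have "0 \<le> (\<Phi> x - W * w x) * f x" using e(2)[OF that] by (auto simp: f_def)
      then show ?thesis by (simp add: algebra_simps)
    qed
    moreover have "0 \<le> (LINT x|M. \<Phi> x * f x - W * (w x * f x))"
      using nonneg by (intro integral_nonneg_AE AE_I2) auto
    ultimately have "AE x in M. \<Phi> x * f x - W * (w x * f x) = 0"
      using integral_nonneg_eq_0_iff_AE[OF i] by (auto intro!: AE_I2)
    then show ?thesis using AE_space
    proof eventually_elim
      case (elim x)
      then have "(\<Phi> x - W * w x) * f x = 0" by (simp add: algebra_simps)
      with e(2)[OF elim(2)] show ?case by (auto simp: f_def split: if_splits)
    qed
  qed
  have eq: "AE x in M. (W * w x - \<Phi> x) * u x = 0"
  proof -
    have i: "integrable M (\<lambda>x. W * (w x * u x) - \<Phi> x * u x)" using iu \<Phi>int[OF u(1)] by simp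
    have "(LINT x|M. W * (w x * u x) - \<Phi> x * u x) = W * \<mu> - (LINT x|M. \<Phi> x * u x)"
      using iu \<Phi>int[OF u(1)] u(2) by simp
    also have "\<dots> = 0" using \<mu> by (simp add: W_def)
    finally have "(LINT x|M. W * (w x * u x) - \<Phi> x * u x) = 0" .
    moreover have "AE x in M. 0 \<le> W * (w x * u x) - \<Phi> x * u x"
      using le nn
    proof eventually_elim
      case (elim x)
      then have "0 \<le> (W * w x - \<Phi> x) * u x" by simp
      then show ?case by (simp add: algebra_simps)
    qed
    ultimately show ?thesis
      using integral_nonneg_eq_0_iff_AE[OF i] by (simp add: algebra_simps)
  qed
  show ?thesis
  proof (rule ex1I[of _ W])
    show "AE x in M. u x powr (p - 1) = lam * max 0 (pot u x - W * w x)"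
      using le eq nn
    proof eventually_elim
      case (elim x)
      show ?case
      proof (cases "u x = 0")
        case True
        with elim show ?thesis by (simp add: \<Phi>_def)
      next
        case False
        with elim have "W * w x = \<Phi> x" by simp
        then have "pot u x - W * w x = u x powr (p - 1) / lam" by (simp add: \<Phi>_def)
        then show ?thesis using lam by simp
      qed
    qed
  next
    fix V assume V: "AE x in M. u x powr (p - 1) = lam * max 0 (pot u x - V * w x)"
    have "\<not> (AE x in M. u x = 0)"
    proof
      assume "AE x in M. u x = 0"
      then have "(LINT x|M. w x * u x) = (LINT x|M. 0)"
        by (intro integral_cong_AE) auto
      with u(2) \<mu> show False by simp
    qed
    then obtain x where x: "x \<in> space M" "u x \<noteq> 0" "u x \<ge> 0" "(W * w x - \<Phi> x) * u x = 0"
        "u x powr (p - 1) = lam * max 0 (pot u x - V * w x)"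
    proof -
      have "\<exists>x. x \<in> space M \<and> u x \<noteq> 0 \<and> u x \<ge> 0 \<and> (W * w x - \<Phi> x) * u x = 0 \<and>
          u x powr (p - 1) = lam * max 0 (pot u x - V * w x)"
      proof (rule ccontr)
        assume c: "\<nexists>x. x \<in> space M \<and> u x \<noteq> 0 \<and> u x \<ge> 0 \<and> (W * w x - \<Phi> x) * u x = 0 \<and>
          u x powr (p - 1) = lam * max 0 (pot u x - V * w x)"
        have "AE x in M. u x = 0"
          using AE_space nn eq V by eventually_elim (use c in blast)
        with \<open>\<not> (AE x in M. u x = 0)\<close> show False by simp
      qed
      then show ?thesis using that by blast
    qed
    have "u x powr (p - 1) > 0" using x(2) by (subst powr_gt_zero)
    then have "max 0 (pot u x - V * w x) = pot u x - V * w x"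
      using x(5) lam by (auto simp: max_def split: if_splits)
    then have "V * w x = pot u x - u x powr (p - 1) / lam" using x(5) lam by simp
    also have "\<dots> = W * w x" using x by (simp add: \<Phi>_def)
    finally show "V = W" using w_pos[OF x(1)] by simp
  qed
qed

end

section \<open>Finiteness of the energy in the half-plane\<close>

lemma ln_one_plus_le_powr:
  fixes X a :: real
  assumes "X > 0" "0 < a" "a \<le> 1"
  shows "ln (1 + X) \<le> X powr a / a"
proof -
  have "(1 + X) powr a = (1 + X) * (1 + X) powr (a - 1)"
    using assms powr_mult_base[of "1 + X" "a - 1"] by simp
  also have "\<dots> = (1 + X) powr (a - 1) + X * (1 + X) powr (a - 1)" by (simp add: algebra_simps)
  also have "\<dots> \<le> 1 + X * X powr (a - 1)"
  proof (intro add_mono mult_left_mono)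
    show "(1 + X) powr (a - 1) \<le> 1" using powr_mono[of "a - 1" 0 "1 + X"] assms by simp
    show "(1 + X) powr (a - 1) \<le> X powr (a - 1)" using assms by (intro powr_mono2') auto
  qed (use assms in auto)
  also have "\<dots> = 1 + X powr a" using assms powr_mult_base[of X "a - 1"] by simp
  finally have "ln ((1 + X) powr a) \<le> ln (1 + X powr a)"
    using assms by (subst ln_le_cancel_iff) (auto simp: add_pos_nonneg)
  also have "\<dots> \<le> X powr a" by (rule ln_add_one_self_le_self) simp
  finally show ?thesis using assms by (simp add: ln_powr field_simps)
qed

text \<open>Two geometric means lie behind the energy estimate: \<open>(u h\<^sup>a)\<^sup>r\<close> is one of the weighted mass \<open>h u\<close>
  and of \<open>u\<^sup>p\<close>, and \<open>(A B)\<^sup>1\<^sup>/\<^sup>r d\<^sup>-\<^sup>2\<^sup>a\<close> is one of \<open>A B\<close>, \<open>A d\<^sup>-\<^sup>e\<close> and \<open>B d\<^sup>-\<^sup>e\<close>. The second is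
  how Young's inequality for convolutions is proved; as it is kept pointwise and the means are
  bounded by sums, the result can be integrated directly, with \<open>d\<close> the distance of two points and
  \<open>h\<close>, \<open>k\<close> their heights.\<close>

lemma interpolated_kernel_bound:
  fixes p \<tau> d h k u v :: real
  assumes p: "p > 1" and \<tau>: "0 < \<tau>" "\<tau> < 1" "(p - 1) * \<tau> \<le> 1"
    and pos: "d > 0" "h > 0" "k > 0" "u \<ge> 0" "v \<ge> 0"
  defines "A \<equiv> h * u + u powr p" and "B \<equiv> k * v + v powr p"
    and "r \<equiv> 1 + (p - 1) * \<tau>" and "a \<equiv> (1 - \<tau>) / (1 + (p - 1) * \<tau>)"
    and "e \<equiv> (1 - \<tau>) / ((p - 1) * \<tau>)"
  shows "ln (1 + 4 * h * k / d\<^sup>2) * u * v \<le> 4 powr a / a * (A * B + (A + B) * d powr (- e))"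
proof (cases "u = 0 \<or> v = 0")
  case True
  have "0 \<le> A" "0 \<le> B" using pos by (auto simp: A_def B_def)
  moreover have "0 < a" using p \<tau> by (simp add: a_def add_pos_nonneg)
  ultimately have "0 \<le> 4 powr a / a * (A * B + (A + B) * d powr (- e))" by simp
  with True show ?thesis by (elim disjE) simp_all
next
  case False
  then have uv: "u > 0" "v > 0" using pos by auto
  define q where "q = (p - 1) * \<tau>"
  have q: "0 < q" "q \<le> 1" using p \<tau> by (auto simp: q_def)
  have r_eq: "r = 1 + q" by (simp add: r_def q_def)
  have r: "1 < r" "r \<le> 2" using q by (auto simp: r_eq)
  have a: "0 < a" "a \<le> 1" "a = (1 - \<tau>) / r"
    using q \<tau> by (simp_all add: a_def r_eq flip: q_def)
  have AB: "A > 0" "B > 0" using uv pos by (auto simp: A_def B_def add_pos_nonneg)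
  have ar: "a * r = 1 - \<tau>" using a(3) r by simp
  have e\<beta>: "e * (1 - 1 / r) = a"
  proof -
    have "1 - 1 / r = q / r" using q by (simp add: r_eq divide_simps)
    then show ?thesis using q by (simp add: a(3) e_def flip: q_def)
  qed
  have single: "s * c powr a \<le> (c * s + s powr p) powr (1 / r)" if "s > 0" "c > 0" for s c
  proof -
    define S where "S = c * s + s powr p"
    have S: "S > 0" "c * s \<le> S" "s powr p \<le> S" using that by (auto simp: S_def add_pos_pos)
    have "(s * c powr a) powr r = s powr r * c powr (1 - \<tau>)"
      using that by (simp add: powr_mult powr_powr ar)
    also have "s powr r = s powr (1 - \<tau>) * (s powr p) powr \<tau>"
      unfolding powr_powr powr_add[symmetric] by (simp add: r_def algebra_simps)
    also have "s powr (1 - \<tau>) * (s powr p) powr \<tau> * c powr (1 - \<tau>) = (c * s) powr (1 - \<tau>) * (s powr p) powr \<tau>"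
      using that by (simp add: powr_mult)
    also have "\<dots> \<le> S powr (1 - \<tau>) * S powr \<tau>"
      using S that \<tau> by (intro mult_mono powr_mono2) auto
    also have "\<dots> = S" using S unfolding powr_add[symmetric] by simp
    finally have "((s * c powr a) powr r) powr (1 / r) \<le> S powr (1 / r)"
      using r by (intro powr_mono2) auto
    then show ?thesis using that r by (simp add: powr_powr S_def)
  qed
  define \<kappa> where "\<kappa> = d powr (- e)"
  define S where "S = A * B + (A + B) * \<kappa>"
  have \<kappa>: "\<kappa> > 0" using pos by (simp add: \<kappa>_def)
  have S: "A * B \<le> S" "A * \<kappa> \<le> S" "B * \<kappa> \<le> S" "S > 0"
    using AB \<kappa> by (auto simp: S_def algebra_simps add_pos_pos)
  have "(A * B) powr (1 / r) * d powr (- (2 * a))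
      = (A * B) powr (2 / r - 1) * (A * \<kappa>) powr (1 - 1 / r) * (B * \<kappa>) powr (1 - 1 / r)"
  proof -
    have \<kappa>a: "\<kappa> powr (1 - 1 / r) = d powr (- a)"
      unfolding \<kappa>_def powr_powr by (simp only: mult_minus_left e\<beta>)
    have ex: "2 / r - 1 + (1 - 1 / r) = 1 / r" using r by (simp add: divide_simps)
    have "(A * B) powr (2 / r - 1) * (A * \<kappa>) powr (1 - 1 / r) * (B * \<kappa>) powr (1 - 1 / r)
        = (A powr (2 / r - 1) * A powr (1 - 1 / r)) * (B powr (2 / r - 1) * B powr (1 - 1 / r))
          * (\<kappa> powr (1 - 1 / r) * \<kappa> powr (1 - 1 / r))"
      using AB \<kappa> by (simp add: powr_mult mult_ac)
    also have "\<dots> = A powr (1 / r) * B powr (1 / r) * d powr (- (2 * a))"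
      unfolding \<kappa>a powr_add[symmetric] ex by simp
    finally show ?thesis using AB by (simp add: powr_mult)
  qed
  also have "\<dots> \<le> S powr (2 / r - 1) * S powr (1 - 1 / r) * S powr (1 - 1 / r)"
    using S AB \<kappa> r by (intro mult_mono powr_mono2) (auto simp: field_simps)
  also have "\<dots> = S"
  proof -
    have "2 / r - 1 + (1 - 1 / r) + (1 - 1 / r) = 1" using r by (simp add: divide_simps)
    then show ?thesis using S(4) unfolding powr_add[symmetric] by simp
  qed
  finally have interp: "(A * B) powr (1 / r) * d powr (- (2 * a)) \<le> S" .
  have "ln (1 + 4 * h * k / d\<^sup>2) \<le> (4 * h * k / d\<^sup>2) powr a / a"
    using pos a by (intro ln_one_plus_le_powr) auto
  also have "(4 * h * k / d\<^sup>2) powr a = 4 powr a * (h powr a * k powr a * d powr (- (2 * a)))"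
  proof -
    have "(d\<^sup>2) powr a = (d powr 2) powr a" using pos by (simp add: powr_numeral)
    also have "\<dots> = d powr (2 * a)" by (rule powr_powr)
    finally show ?thesis using pos by (simp add: powr_mult powr_divide powr_minus_divide)
  qed
  finally have "ln (1 + 4 * h * k / d\<^sup>2) * (u * v)
      \<le> 4 powr a * (h powr a * k powr a * d powr (- (2 * a))) / a * (u * v)"
    using uv by (intro mult_right_mono) auto
  also have "\<dots> = 4 powr a / a * ((u * h powr a) * (v * k powr a) * d powr (- (2 * a)))" by simp
  also have "\<dots> \<le> 4 powr a / a * (A powr (1 / r) * B powr (1 / r) * d powr (- (2 * a)))"
    using single[OF uv(1) pos(2)] single[OF uv(2) pos(3)] uv pos a(1)
    unfolding A_def B_def by (intro mult_left_mono mult_right_mono mult_mono) auto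
  also have "\<dots> \<le> 4 powr a / a * S"
    using interp AB a(1) by (intro mult_left_mono) (auto simp: powr_mult)
  finally show ?thesis by (simp add: S_def \<kappa>_def mult.assoc)
qed

text \<open>An integrable function on the line whose tensor square dominates \<open>min (1 / |z|) (1 / |z|\<^sup>3)\<close>.
  It has to be infinite at \<open>0\<close>, where real powers with negative exponent vanish.\<close>

definition decay :: "real \<Rightarrow> ennreal" where
  "decay t = (if t = 0 then \<infinity> else ennreal (min (\<bar>t\<bar> powr (- 1 / 2)) (\<bar>t\<bar> powr (- 3 / 2))))"

lemma decay_measurable [measurable]: "decay \<in> borel_measurable borel"
  unfolding decay_def by measurable

lemma decay_minus [simp]: "decay (- t) = decay t"
  by (simp add: decay_def)

lemma nn_integral_decay_finite: "(\<integral>\<^sup>+t. decay t \<partial>lborel) < \<infinity>"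
proof -
  define f where "f t = (if 0 \<le> t \<and> t \<le> 1 then t powr (- 1 / 2) else 0) + (if 1 \<le> t then t powr (- 3 / 2) else 0)"
    for t :: real
  have f0: "0 \<le> f t" for t by (simp add: f_def)
  have [measurable]: "f \<in> borel_measurable borel" unfolding f_def by measurable
  have "((\<lambda>t. t powr (- 1 / 2)) has_integral 2) {0..1 :: real}"
    using has_integral_powr_from_0[of "- 1 / 2" 1] by simp
  then have 1: "((\<lambda>t. if t \<in> {0..1} then t powr (- 1 / 2) else 0) has_integral 2) (UNIV :: real set)"
    by (simp only: has_integral_restrict_UNIV)
  have "((\<lambda>t. t powr (- 3 / 2)) has_integral 2) {1 :: real..}"
    using has_integral_powr_to_inf[of "- 3 / 2" 1] by simp
  then have 2: "((\<lambda>t. if t \<in> {1..} then t powr (- 3 / 2) else 0) has_integral 2) (UNIV :: real set)"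
    by (simp only: has_integral_restrict_UNIV)
  have "(f has_integral 4) UNIV"
    using has_integral_add[OF 1 2] by (simp add: f_def[abs_def])
  then have f: "(\<integral>\<^sup>+t. ennreal (f t) \<partial>lborel) = ennreal 4"
    by (intro nn_integral_has_integral_lborel f0) auto
  have "(\<integral>\<^sup>+t. decay t \<partial>lborel) \<le> (\<integral>\<^sup>+t. ennreal (f t) + ennreal (f (- t)) \<partial>lborel)"
  proof (rule nn_integral_mono_AE)
    show "AE t in lborel. decay t \<le> ennreal (f t) + ennreal (f (- t))"
      using AE_lborel_singleton[of 0]
    proof eventually_elim
      case (elim t)
      have "min (\<bar>t\<bar> powr (- 1 / 2)) (\<bar>t\<bar> powr (- 3 / 2)) \<le> f t + f (- t)"
        using elim by (auto simp: f_def min_def not_le)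
      with elim f0[of t] f0[of "- t"] show ?case
        by (simp add: decay_def ennreal_leI flip: ennreal_plus)
    qed
  qed
  also have "\<dots> = (\<integral>\<^sup>+t. ennreal (f t) \<partial>lborel) + (\<integral>\<^sup>+t. ennreal (f (- t)) \<partial>lborel)"
    by (rule nn_integral_add) measurable
  also have "(\<integral>\<^sup>+t. ennreal (f (- t)) \<partial>lborel) = (\<integral>\<^sup>+t. ennreal (f t) \<partial>distr lborel borel uminus)"
    by (subst nn_integral_distr) auto
  also have "\<dots> = ennreal 4" using f by (simp add: lborel_distr_uminus)
  finally show ?thesis by (simp add: f order_le_less_trans ennreal_add_eq_top less_top)
qed

lemma decay_mono:
  assumes "\<bar>s\<bar> \<le> \<bar>t\<bar>"
  shows "decay t \<le> decay s"
proof (cases "s = 0")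
  case False
  then have "t \<noteq> 0" "0 < \<bar>s\<bar>" using assms by auto
  moreover have "\<bar>t\<bar> powr (- 1 / 2) \<le> \<bar>s\<bar> powr (- 1 / 2)" "\<bar>t\<bar> powr (- 3 / 2) \<le> \<bar>s\<bar> powr (- 3 / 2)"
    using assms \<open>0 < \<bar>s\<bar>\<close> by (auto intro!: powr_mono2')
  ultimately show ?thesis using False by (auto simp: decay_def intro!: ennreal_leI min.mono)
qed (simp add: decay_def)

definition plane_decay :: "real^2 \<Rightarrow> ennreal" where
  "plane_decay z = decay (z $ 1) * decay (z $ 2)"

lemma plane_decay_measurable [measurable]: "plane_decay \<in> borel_measurable borel"
  unfolding plane_decay_def by measurable

lemma plane_decay_minus: "plane_decay (x - y) = plane_decay (y - x)"
  using decay_minus[of "x $ 1 - y $ 1"] decay_minus[of "x $ 2 - y $ 2"] by (simp add: plane_decay_def)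

lemma plane_decay_ge:
  assumes "norm z = d" "d > 0"
  shows "ennreal (min (d powr (- 1)) (d powr (- 3))) \<le> plane_decay z"
proof -
  have "ennreal (min (d powr (- 1)) (d powr (- 3))) \<le> decay d * decay d"
  proof -
    have sq: "d powr (- 1 / 2) * d powr (- 1 / 2) = d powr (- 1)" "d powr (- 3 / 2) * d powr (- 3 / 2) = d powr (- 3)"
      unfolding powr_add[symmetric] by simp_all
    have "min (d powr (- 1)) (d powr (- 3)) = min (d powr (- 1 / 2)) (d powr (- 3 / 2)) * min (d powr (- 1 / 2)) (d powr (- 3 / 2))"
    proof (cases "d powr (- 1 / 2) \<le> d powr (- 3 / 2)")
      case True
      have "d powr (- 1) \<le> d powr (- 3)"
        unfolding sq[symmetric] using True by (intro mult_mono) auto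
      then show ?thesis by (simp only: min_absorb1 True sq)
    next
      case False
      then have *: "d powr (- 3 / 2) \<le> d powr (- 1 / 2)" by simp
      have "d powr (- 3) \<le> d powr (- 1)"
        unfolding sq[symmetric] using * by (intro mult_mono) auto
      then show ?thesis by (simp only: min_absorb2 * sq)
    qed
    then show ?thesis using assms by (simp add: decay_def flip: ennreal_mult)
  qed
  also have "\<dots> \<le> plane_decay z"
    unfolding plane_decay_def
    using component_le_norm_cart[of z 1] component_le_norm_cart[of z 2] assms
    by (intro mult_mono decay_mono) auto
  finally show ?thesis .
qed

lemma nn_integral_plane_decay_finite: "(\<integral>\<^sup>+z. plane_decay z \<partial>lborel) < \<infinity>"
proof -
  have Basis: "(\<Prod>b\<in>(Basis :: (real^2) set). h b) = h (axis 1 1) * h (axis 2 1)" for h :: "real^2 \<Rightarrow> ennreal"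
  proof -
    have B: "(Basis :: (real^2) set) = {axis 1 1, axis 2 1}"
      by (auto simp: Basis_vec_def UNIV_2)
    have "axis 1 (1::real) \<noteq> (axis 2 1 :: real^2)" by (simp add: axis_eq_axis)
    then show ?thesis by (simp add: B)
  qed
  have "(\<integral>\<^sup>+z. plane_decay z \<partial>lborel) = (\<integral>\<^sup>+z. (\<Prod>b\<in>Basis. decay (z \<bullet> b)) \<partial>(lborel :: (real^2) measure))"
    by (simp add: Basis plane_decay_def inner_axis)
  also have "\<dots> = (\<Prod>b\<in>(Basis :: (real^2) set). \<integral>\<^sup>+t. decay t \<partial>lborel)"
    by (rule nn_integral_lborel_prod) auto
  also have "\<dots> < \<infinity>"
    using nn_integral_decay_finite by (simp add: Basis ennreal_mult_less_top power2_eq_square)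
  finally show ?thesis .
qed

lemma nn_integral_plane_decay_shift:
  assumes [measurable]: "\<Omega> \<in> sets lebesgue"
  shows "(\<integral>\<^sup>+y. plane_decay (x - y) \<partial>lebesgue_on \<Omega>) \<le> (\<integral>\<^sup>+z. plane_decay z \<partial>lborel)"
proof -
  have "(\<integral>\<^sup>+y. plane_decay (x - y) \<partial>lebesgue_on \<Omega>) = (\<integral>\<^sup>+y. plane_decay (y - x) * indicator \<Omega> y \<partial>lebesgue)"
    by (subst nn_integral_restrict_space) (auto simp: plane_decay_minus[of x])
  also have "\<dots> \<le> (\<integral>\<^sup>+y. plane_decay (y - x) \<partial>lebesgue)"
    by (intro nn_integral_mono) (auto split: split_indicator)
  also have "\<dots> = (\<integral>\<^sup>+y. plane_decay (y - x) \<partial>lborel)"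
    by (rule nn_integral_completion) 
  also have "\<dots> = (\<integral>\<^sup>+y. plane_decay y \<partial>distr lborel borel ((+) (- x)))"
    by (subst nn_integral_distr) auto
  also have "\<dots> = (\<integral>\<^sup>+y. plane_decay y \<partial>lborel)"
    by (simp add: lborel_distr_plus)
  finally show ?thesis .
qed

text \<open>The exponent in the interpolated bound is critical, namely \<open>-2\<close>, for \<open>\<tau> = 1 / (2 p - 1)\<close>, where
  the power of \<open>|x - y|\<close> fails to be integrable both at zero and at infinity. One parameter on each
  side of it gives the exponents \<open>-1\<close> and \<open>-3\<close>, and the minimum of these two powers is integrable
  over the plane.\<close>

lemma green_half_plane_product_bound:
  fixes p :: real
  assumes p: "p > 1"
  obtains C where "C \<ge> 0" "\<And>x y u v. x \<in> half_plane \<Longrightarrow> y \<in> half_plane \<Longrightarrow> u \<ge> 0 \<Longrightarrow> v \<ge> 0 \<Longrightarrow>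
    ennreal (green_half_plane x y * u * v)
      \<le> ennreal C * (ennreal (x $ 2 * u + u powr p) * ennreal (y $ 2 * v + v powr p)
        + (ennreal (x $ 2 * u + u powr p) + ennreal (y $ 2 * v + v powr p)) * plane_decay (x - y))"
proof -
  define \<tau>1 where "\<tau>1 = 1 / p"
  define \<tau>2 where "\<tau>2 = 1 / (3 * p - 2)"
  define c where "c \<tau> = 4 powr ((1 - \<tau>) / (1 + (p - 1) * \<tau>)) / ((1 - \<tau>) / (1 + (p - 1) * \<tau>))" for \<tau>
  have \<tau>1: "0 < \<tau>1" "\<tau>1 < 1" "(p - 1) * \<tau>1 \<le> 1" "(1 - \<tau>1) / ((p - 1) * \<tau>1) = 1"
    using p by (auto simp: \<tau>1_def field_simps)
  have \<tau>2: "0 < \<tau>2" "\<tau>2 < 1" "(p - 1) * \<tau>2 \<le> 1" "(1 - \<tau>2) / ((p - 1) * \<tau>2) = 3"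
  proof -
    show "0 < \<tau>2" "\<tau>2 < 1" "(p - 1) * \<tau>2 \<le> 1" using p by (auto simp: \<tau>2_def field_simps)
    have "1 - \<tau>2 = 3 * ((p - 1) * \<tau>2)" using p by (simp add: \<tau>2_def field_simps)
    then show "(1 - \<tau>2) / ((p - 1) * \<tau>2) = 3" using p \<open>0 < \<tau>2\<close> by simp
  qed
  define C where "C = max (c \<tau>1) (c \<tau>2)"
  have cpos: "c \<tau> > 0" if "0 < \<tau>" "\<tau> < 1" for \<tau> using p that by (simp add: c_def add_pos_nonneg)
  have C: "c \<tau>1 \<le> C" "c \<tau>2 \<le> C" "0 \<le> C" using cpos[OF \<tau>1(1,2)] by (auto simp: C_def)
  show ?thesis
  proof (rule that[OF C(3)])
    fix x y :: "real^2" and u v :: real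
    assume xy: "x \<in> half_plane" "y \<in> half_plane" and uv: "u \<ge> 0" "v \<ge> 0"
    define A where "A = x $ 2 * u + u powr p"
    define B where "B = y $ 2 * v + v powr p"
    have hk: "x $ 2 > 0" "y $ 2 > 0" using xy by (auto simp: half_plane_def)
    have AB: "0 \<le> A" "0 \<le> B" using uv hk by (auto simp: A_def B_def)
    show "ennreal (green_half_plane x y * u * v)
      \<le> ennreal C * (ennreal A * ennreal B + (ennreal A + ennreal B) * plane_decay (x - y))"
    proof (cases "x = y")
      case True
      then show ?thesis by (simp add: green_half_plane_def)
    next
      case False
      define d where "d = norm (x - y)"
      have d: "d > 0" using False by (simp add: d_def)
      define L where "L = ln (1 + 4 * x $ 2 * y $ 2 / d\<^sup>2)"
      have L: "0 \<le> L" using hk by (auto simp: L_def)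
      have "L * u * v \<le> c \<tau>1 * (A * B + (A + B) * d powr (- 1))"
        using interpolated_kernel_bound[OF p \<tau>1(1-3) d hk uv] by (simp add: \<tau>1(4) L_def A_def B_def c_def)
      also have "\<dots> \<le> C * (A * B + (A + B) * d powr (- 1))"
        using C AB by (intro mult_right_mono) auto
      finally have 1: "L * u * v \<le> C * (A * B + (A + B) * d powr (- 1))" .
      have "L * u * v \<le> c \<tau>2 * (A * B + (A + B) * d powr (- 3))"
        using interpolated_kernel_bound[OF p \<tau>2(1-3) d hk uv] by (simp add: \<tau>2(4) L_def A_def B_def c_def)
      also have "\<dots> \<le> C * (A * B + (A + B) * d powr (- 3))"
        using C AB by (intro mult_right_mono) auto
      finally have 2: "L * u * v \<le> C * (A * B + (A + B) * d powr (- 3))" .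
      define m where "m = min (d powr (- 1)) (d powr (- 3))"
      have m: "0 \<le> m" by (simp add: m_def)
      have "L * u * v \<le> C * (A * B + (A + B) * m)"
        using 1 2 by (simp add: m_def min_def)
      moreover have "green_half_plane x y * u * v \<le> L * u * v"
      proof -
        have "1 / (4 * pi) \<le> 1" using pi_ge_two by (simp add: divide_simps)
        then have "1 / (4 * pi) * L \<le> 1 * L" by (rule mult_right_mono) (rule L)
        then show ?thesis
          unfolding green_half_plane_def L_def d_def using uv by (intro mult_right_mono) auto
      qed
      ultimately have "ennreal (green_half_plane x y * u * v) \<le> ennreal (C * (A * B + (A + B) * m))"
        by (intro ennreal_leI) linarith
      also have "\<dots> = ennreal C * (ennreal A * ennreal B + (ennreal A + ennreal B) * ennreal m)"
        using C AB m by (simp add: ennreal_mult ennreal_plus)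
      also have "ennreal m \<le> plane_decay (x - y)"
        unfolding m_def using d by (intro plane_decay_ge) (simp_all add: d_def)
      finally show ?thesis by (simp add: mult_left_mono add_left_mono)
    qed
  qed
qed

lemma sigma_finite_lebesgue_on:
  assumes "\<Omega> \<in> sets (lebesgue :: 'a::euclidean_space measure)"
  shows "sigma_finite_measure (lebesgue_on \<Omega>)"
proof (rule sigma_finite_measure_restrict_space[OF _ assms])
  have "\<exists>A. countable A \<and> A \<subseteq> sets (lebesgue :: 'a measure) \<and> \<Union>A = space (lebesgue :: 'a measure)
      \<and> (\<forall>a\<in>A. emeasure lebesgue a \<noteq> \<infinity>)"
  proof -
    have "\<exists>A. countable A \<and> A \<subseteq> sets (lborel :: 'a measure) \<and> \<Union>A = space (lborel :: 'a measure)
        \<and> (\<forall>a\<in>A. emeasure lborel a \<noteq> \<infinity>)"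
      by (rule lborel.sigma_finite_countable)
    then show ?thesis
    proof (elim exE conjE)
      fix A :: "'a set set"
      assume A: "countable A" "A \<subseteq> sets lborel" "\<Union>A = space lborel" "\<forall>a\<in>A. emeasure lborel a \<noteq> \<infinity>"
      show ?thesis
      proof (intro exI[of _ A] conjI ballI)
        show "A \<subseteq> sets lebesgue" using A(2) sets_completionI_sets by blast
        show "\<Union>A = space lebesgue" using A(3) by simp
        show "emeasure lebesgue a \<noteq> \<infinity>" if "a \<in> A" for a
          using A(4) A(2) that emeasure_completion[of a lborel] by auto
      qed (rule A(1))
    qed
  qed
  then show "sigma_finite_measure (lebesgue :: 'a measure)"
    by (rule sigma_finite_measure.intro)
qed

text \<open>By the product bound the integrand is at most a multiple of
  \<open>A(x) A(y) + (A(x) + A(y)) \<kappa>(x - y)\<close> with \<open>A = x\<^sub>2 |u| + |u|\<^sup>p\<close> integrable and \<open>\<kappa>\<close> integrable over the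
  plane. Tonelli's theorem then bounds the energy by \<open>(\<integral> A)\<^sup>2 + 2 (\<integral> A) (\<integral> \<kappa>)\<close>.\<close>

lemma energy_integrable_dominated:
  fixes g :: "real^2 \<Rightarrow> real^2 \<Rightarrow> real" and u :: "real^2 \<Rightarrow> real"
  assumes \<Omega> [measurable]: "\<Omega> \<in> sets lebesgue" and sub: "\<Omega> \<subseteq> half_plane" and p: "p > 1"
    and [measurable]: "case_prod g \<in> borel_measurable (lebesgue_on \<Omega> \<Otimes>\<^sub>M lebesgue_on \<Omega>)"
    and g: "\<And>x y. x \<in> \<Omega> \<Longrightarrow> y \<in> \<Omega> \<Longrightarrow> 0 \<le> g x y \<and> g x y \<le> green_half_plane x y"
    and [measurable]: "u \<in> borel_measurable (lebesgue_on \<Omega>)"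
    and up: "integrable (lebesgue_on \<Omega>) (\<lambda>x. \<bar>u x\<bar> powr p)"
    and uw: "integrable (lebesgue_on \<Omega>) (\<lambda>x. x $ 2 * u x)"
  shows "integrable (lebesgue_on \<Omega> \<Otimes>\<^sub>M lebesgue_on \<Omega>) (\<lambda>z. g (fst z) (snd z) * u (fst z) * u (snd z))"
proof (rule integrableI_bounded)
  let ?M = "lebesgue_on \<Omega>"
  interpret sigma_finite_measure ?M by (rule sigma_finite_lebesgue_on[OF \<Omega>])
  interpret MM: pair_sigma_finite ?M ?M ..
  obtain C where C: "C \<ge> 0" "\<And>x y u v. x \<in> half_plane \<Longrightarrow> y \<in> half_plane \<Longrightarrow> u \<ge> 0 \<Longrightarrow> v \<ge> 0 \<Longrightarrow>
    ennreal (green_half_plane x y * u * v)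
      \<le> ennreal C * (ennreal (x $ 2 * u + u powr p) * ennreal (y $ 2 * v + v powr p)
        + (ennreal (x $ 2 * u + u powr p) + ennreal (y $ 2 * v + v powr p)) * plane_decay (x - y))"
    using green_half_plane_product_bound[OF p] by blast
  have sp: "space ?M = \<Omega>" by simp
  have [measurable]: "(\<lambda>x. x $ 2 :: real) \<in> borel_measurable ?M" 
    by (intro measurable_restrict_space1 measurable_completion) measurable
  have id1: "(\<lambda>x. x) \<in> ?M \<rightarrow>\<^sub>M borel"
    by (intro measurable_restrict_space1 measurable_completion) measurable
  have [measurable]: "(\<lambda>z. plane_decay (fst z - snd z)) \<in> borel_measurable (?M \<Otimes>\<^sub>M ?M)"
  proof -
    have "(\<lambda>z. fst z) \<in> ?M \<Otimes>\<^sub>M ?M \<rightarrow>\<^sub>M borel" "(\<lambda>z. snd z) \<in> ?M \<Otimes>\<^sub>M ?M \<rightarrow>\<^sub>M borel"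
      by (rule measurable_compose[OF measurable_fst id1] measurable_compose[OF measurable_snd id1])+
    then have "(\<lambda>z. fst z - snd z) \<in> ?M \<Otimes>\<^sub>M ?M \<rightarrow>\<^sub>M borel" by (rule borel_measurable_diff)
    then show ?thesis by (rule measurable_compose) measurable
  qed
  have [measurable]: "(\<lambda>y. plane_decay (x - y)) \<in> borel_measurable ?M" for x
    by (rule measurable_compose[OF id1]) measurable
  define A where "A x = ennreal (x $ 2 * \<bar>u x\<bar> + \<bar>u x\<bar> powr p)" for x
  have [measurable]: "A \<in> borel_measurable ?M" unfolding A_def by measurable
  have "integrable ?M (\<lambda>x. \<bar>x $ 2 * u x\<bar> + \<bar>u x\<bar> powr p)" using up uw by simp
  then have "(\<integral>\<^sup>+x. ennreal (norm (\<bar>x $ 2 * u x\<bar> + \<bar>u x\<bar> powr p)) \<partial>?M) < \<infinity>"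
    by (simp add: integrable_iff_bounded)
  also have "(\<integral>\<^sup>+x. ennreal (norm (\<bar>x $ 2 * u x\<bar> + \<bar>u x\<bar> powr p)) \<partial>?M) = (\<integral>\<^sup>+x. A x \<partial>?M)"
    using sub by (intro nn_integral_cong) (auto simp: A_def half_plane_def abs_mult)
  finally have A: "(\<integral>\<^sup>+x. A x \<partial>?M) < \<infinity>" .
  define K where "K = (\<integral>\<^sup>+z. plane_decay z \<partial>lborel)"
  have K: "K < \<infinity>" unfolding K_def by (rule nn_integral_plane_decay_finite)
  have row: "(\<integral>\<^sup>+y. plane_decay (x - y) \<partial>?M) \<le> K" for x
    unfolding K_def by (rule nn_integral_plane_decay_shift) measurable
  have 1: "(\<integral>\<^sup>+x. \<integral>\<^sup>+y. A x * A y \<partial>?M \<partial>?M) = (\<integral>\<^sup>+x. A x \<partial>?M) * (\<integral>\<^sup>+x. A x \<partial>?M)"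
    by (simp add: nn_integral_cmult nn_integral_multc)
  have 2: "(\<integral>\<^sup>+x. \<integral>\<^sup>+y. A x * plane_decay (x - y) \<partial>?M \<partial>?M) \<le> (\<integral>\<^sup>+x. A x \<partial>?M) * K"
  proof -
    have "(\<integral>\<^sup>+x. \<integral>\<^sup>+y. A x * plane_decay (x - y) \<partial>?M \<partial>?M) = (\<integral>\<^sup>+x. A x * (\<integral>\<^sup>+y. plane_decay (x - y) \<partial>?M) \<partial>?M)"
      by (intro nn_integral_cong) (simp add: nn_integral_cmult)
    also have "\<dots> \<le> (\<integral>\<^sup>+x. A x * K \<partial>?M)" by (intro nn_integral_mono mult_left_mono row) auto
    finally show ?thesis by (simp add: nn_integral_multc)
  qed
  have "(\<integral>\<^sup>+x. \<integral>\<^sup>+y. A y * plane_decay (x - y) \<partial>?M \<partial>?M) = (\<integral>\<^sup>+y. \<integral>\<^sup>+x. A y * plane_decay (x - y) \<partial>?M \<partial>?M)"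
    by (rule MM.Fubini'[symmetric]) measurable
  also have "\<dots> \<le> (\<integral>\<^sup>+x. A x \<partial>?M) * K"
    using 2 by (simp add: plane_decay_minus)
  finally have 3: "(\<integral>\<^sup>+x. \<integral>\<^sup>+y. A y * plane_decay (x - y) \<partial>?M \<partial>?M) \<le> (\<integral>\<^sup>+x. A x \<partial>?M) * K" .
  have "(\<integral>\<^sup>+z. ennreal (norm (g (fst z) (snd z) * u (fst z) * u (snd z))) \<partial>(?M \<Otimes>\<^sub>M ?M))
      = (\<integral>\<^sup>+x. \<integral>\<^sup>+y. ennreal (norm (g x y * u x * u y)) \<partial>?M \<partial>?M)"
    by (subst nn_integral_fst[symmetric]) simp_all
  also have "\<dots> \<le> (\<integral>\<^sup>+x. \<integral>\<^sup>+y. ennreal C * (A x * A y + (A x * plane_decay (x - y) + A y * plane_decay (x - y))) \<partial>?M \<partial>?M)"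
  proof (intro nn_integral_mono)
    fix x y assume "x \<in> space ?M" "y \<in> space ?M"
    then have xy: "x \<in> \<Omega>" "y \<in> \<Omega>" by auto
    have "norm (g x y * u x * u y) \<le> green_half_plane x y * \<bar>u x\<bar> * \<bar>u y\<bar>"
      using g[OF xy] by (simp add: abs_mult mult_right_mono)
    then have "ennreal (norm (g x y * u x * u y)) \<le> ennreal (green_half_plane x y * \<bar>u x\<bar> * \<bar>u y\<bar>)"
      by (rule ennreal_leI)
    also have "\<dots> \<le> ennreal C * (A x * A y + (A x + A y) * plane_decay (x - y))"
      unfolding A_def using xy sub by (intro C(2)) auto
    finally show "ennreal (norm (g x y * u x * u y))
        \<le> ennreal C * (A x * A y + (A x * plane_decay (x - y) + A y * plane_decay (x - y)))"
      by (simp add: distrib_right)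
  qed
  also have "\<dots> = ennreal C * ((\<integral>\<^sup>+x. \<integral>\<^sup>+y. A x * A y \<partial>?M \<partial>?M)
      + ((\<integral>\<^sup>+x. \<integral>\<^sup>+y. A x * plane_decay (x - y) \<partial>?M \<partial>?M) + (\<integral>\<^sup>+x. \<integral>\<^sup>+y. A y * plane_decay (x - y) \<partial>?M \<partial>?M)))"
    by (simp add: nn_integral_cmult nn_integral_add)
  also have "\<dots> \<le> ennreal C * ((\<integral>\<^sup>+x. A x \<partial>?M) * (\<integral>\<^sup>+x. A x \<partial>?M) + ((\<integral>\<^sup>+x. A x \<partial>?M) * K + (\<integral>\<^sup>+x. A x \<partial>?M) * K))"
    using 2 3 unfolding 1 by (intro mult_left_mono add_mono) auto
  also have "\<dots> < \<infinity>"
    using A K by (simp add: ennreal_mult_less_top)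
  finally show "(\<integral>\<^sup>+z. ennreal (norm (g (fst z) (snd z) * u (fst z) * u (snd z))) \<partial>(?M \<Otimes>\<^sub>M ?M)) < \<infinity>" .
qed measurable

section \<open>Comparison of the strip with the half-plane\<close>

lemma sin_quotient_antimono:
  fixes s \<sigma> :: real
  assumes "0 \<le> s" "s \<le> \<sigma>" "\<sigma> \<le> pi"
  shows "s * sin \<sigma> \<le> \<sigma> * sin s"
proof (cases "s = 0 \<or> s = \<sigma>")
  case False
  then have s: "0 < s" "s < \<sigma>" using assms by auto
  obtain a where a: "0 < a" "a < s" "sin s - sin 0 = (s - 0) * cos a"
    using MVT2[of 0 s sin cos] s by (auto intro: DERIV_sin)
  obtain b where b: "s < b" "b < \<sigma>" "sin \<sigma> - sin s = (\<sigma> - s) * cos b"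
    using MVT2[of s \<sigma> sin cos] s by (auto intro: DERIV_sin)
  have "cos b \<le> cos a" using a b assms by (intro cos_monotone_0_pi_le) auto
  then have "s * ((\<sigma> - s) * cos b) \<le> s * ((\<sigma> - s) * cos a)"
    using s by (intro mult_left_mono) auto
  moreover have "sin s = s * cos a" "sin \<sigma> = s * cos a + (\<sigma> - s) * cos b" using a b by auto
  ultimately have "s * sin \<sigma> \<le> s * (s * cos a) + s * ((\<sigma> - s) * cos a)"
    by (simp only: distrib_left)
  also have "\<dots> = \<sigma> * sin s" using a by (simp add: algebra_simps)
  finally show ?thesis .
qed auto

lemma abs_le_abs_sinh: "\<bar>t\<bar> \<le> \<bar>sinh t\<bar>" for t :: real
proof -
  have *: "s \<le> sinh s" if "s \<ge> 0" for s :: real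
  proof -
    have d: "((\<lambda>x. sinh x - x) has_real_derivative cosh x - 1) (at x)" for x :: real
      by (auto intro!: derivative_eq_intros)
    have "sinh 0 - 0 \<le> sinh s - s"
      by (rule DERIV_nonneg_imp_nondecreasing[OF that]) (use d cosh_real_ge_1 in \<open>force\<close>)
    then show ?thesis by simp
  qed
  show ?thesis using *[of t] *[of "- t"] by (cases "t \<ge> 0") auto
qed

text \<open>The Green's function increases with the domain. With \<open>\<sigma>\<close>, \<open>s\<close> the half sum and half difference
  of the rescaled heights, \<open>sin \<alpha> sin \<beta> = sin\<^sup>2 \<sigma> - sin\<^sup>2 s\<close> and \<open>\<alpha> \<beta> = \<sigma>\<^sup>2 - s\<^sup>2\<close>, so that the explicit
  formulas are compared by the monotonicity of \<open>sin t / t\<close> and by \<open>|t| \<le> |sinh t|\<close>.\<close>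

lemma green_strip_le_green_half_plane:
  assumes L: "L > 0" and x: "x \<in> strip L" and y: "y \<in> strip L" 
  shows "0 \<le> green_strip L x y \<and> green_strip L x y \<le> green_half_plane x y"
proof (cases "x = y")
  case True
  then show ?thesis by (simp add: green_strip_def green_half_plane_def)
next
  case False
  define \<alpha> where "\<alpha> = pi / L * x $ 2"
  define \<beta> where "\<beta> = pi / L * y $ 2"
  define a where "a = pi / (2 * L) * (x $ 1 - y $ 1)"
  define s where "s = (\<alpha> - \<beta>) / 2"
  define \<sigma> where "\<sigma> = (\<alpha> + \<beta>) / 2"
  have ab: "0 < \<alpha>" "\<alpha> < pi" "0 < \<beta>" "\<beta> < pi"
    using L x y by (auto simp: \<alpha>_def \<beta>_def strip_def field_simps)
  have s: "pi / (2 * L) * (x $ 2 - y $ 2) = s"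
    using L by (simp add: s_def \<alpha>_def \<beta>_def field_simps)
  have nz: "a \<noteq> 0 \<or> s \<noteq> 0"
  proof (rule ccontr)
    assume "\<not> (a \<noteq> 0 \<or> s \<noteq> 0)"
    then have "x $ 1 = y $ 1" "x $ 2 = y $ 2" using L s[symmetric] by (auto simp: a_def)
    then have "x = y" by (simp add: vec_eq_iff forall_2)
    with False show False by simp
  qed
  have prod: "sin \<alpha> * sin \<beta> = (sin \<sigma>)\<^sup>2 - (sin s)\<^sup>2"
  proof -
    have "\<alpha> = \<sigma> + s" "\<beta> = \<sigma> - s" by (simp_all add: \<sigma>_def s_def field_simps)
    then have "sin \<alpha> = sin \<sigma> * cos s + cos \<sigma> * sin s" "sin \<beta> = sin \<sigma> * cos s - cos \<sigma> * sin s"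
      by (simp_all only: sin_add sin_diff)
    then have "sin \<alpha> * sin \<beta> = (sin \<sigma> * cos s + cos \<sigma> * sin s) * (sin \<sigma> * cos s - cos \<sigma> * sin s)"
      by (simp only:)
    also have "\<dots> = (sin \<sigma>)\<^sup>2 * (cos s)\<^sup>2 - (cos \<sigma>)\<^sup>2 * (sin s)\<^sup>2"
      by (simp add: power2_eq_square algebra_simps)
    finally have "sin \<alpha> * sin \<beta> = (sin \<sigma>)\<^sup>2 * (cos s)\<^sup>2 - (cos \<sigma>)\<^sup>2 * (sin s)\<^sup>2" .
    then show ?thesis by (simp add: cos_squared_eq algebra_simps)
  qed
  have ss: "\<bar>s\<bar> \<le> \<sigma>" "\<sigma> \<le> pi" "\<bar>s\<bar> < pi" using ab by (auto simp: s_def \<sigma>_def)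
  have sin_s: "(sin s)\<^sup>2 \<le> s\<^sup>2" using abs_sin_x_le_abs_x[of s] by (simp add: abs_le_square_iff)
  have "(\<bar>s\<bar> * sin \<sigma>)\<^sup>2 \<le> (\<sigma> * sin \<bar>s\<bar>)\<^sup>2"
    using sin_quotient_antimono[of "\<bar>s\<bar>" \<sigma>] ss ab sin_ge_zero[of \<sigma>]
    by (intro power_mono) auto
  then have sq: "s\<^sup>2 * (sin \<sigma>)\<^sup>2 \<le> \<sigma>\<^sup>2 * (sin s)\<^sup>2"
    by (simp add: power_mult_distrib abs_if split: if_splits)
  have \<alpha>\<beta>: "\<alpha> * \<beta> = \<sigma>\<^sup>2 - s\<^sup>2" by (simp add: \<sigma>_def s_def power2_eq_square field_simps)
  have 1: "sin \<alpha> * sin \<beta> * s\<^sup>2 \<le> \<alpha> * \<beta> * (sin s)\<^sup>2"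
    using sq unfolding prod \<alpha>\<beta> by (simp add: algebra_simps)
  have sin_pos: "0 < sin \<alpha>" "0 < sin \<beta>" using ab by (auto intro: sin_gt_zero)
  have 2: "sin \<alpha> * sin \<beta> \<le> \<alpha> * \<beta>"
    using ab sin_pos by (intro mult_mono) (auto intro: sin_x_le_x)
  have "sin \<alpha> * sin \<beta> * (a\<^sup>2 + s\<^sup>2) \<le> \<alpha> * \<beta> * (a\<^sup>2 + (sin s)\<^sup>2)"
    using 1 mult_right_mono[OF 2, of "a\<^sup>2"] by (simp add: algebra_simps)
  also have "\<dots> \<le> \<alpha> * \<beta> * ((sinh a)\<^sup>2 + (sin s)\<^sup>2)"
    using ab abs_le_abs_sinh[of a] by (intro mult_left_mono add_right_mono) (auto simp: abs_le_square_iff)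
  finally have 3: "sin \<alpha> * sin \<beta> * (a\<^sup>2 + s\<^sup>2) \<le> \<alpha> * \<beta> * ((sinh a)\<^sup>2 + (sin s)\<^sup>2)" .
  have "a\<^sup>2 + s\<^sup>2 > 0" using nz by (auto simp: add_pos_nonneg add_nonneg_pos)
  moreover have "(sinh a)\<^sup>2 + (sin s)\<^sup>2 > 0"
  proof (cases "a = 0")
    case True
    then have "s \<noteq> 0" using nz by simp
    then have "sin s \<noteq> 0" using ss sin_gt_zero[of s] sin_gt_zero[of "- s"] by (cases "s > 0") auto
    then show ?thesis by (simp add: add_nonneg_pos)
  qed (simp add: add_pos_nonneg)
  ultimately have "sin \<alpha> * sin \<beta> / ((sinh a)\<^sup>2 + (sin s)\<^sup>2) \<le> \<alpha> * \<beta> / (a\<^sup>2 + s\<^sup>2)"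
    using 3 by (simp add: divide_simps mult.commute)
  also have "\<alpha> * \<beta> / (a\<^sup>2 + s\<^sup>2) = 4 * x $ 2 * y $ 2 / (norm (x - y))\<^sup>2"
  proof -
    have n: "(norm (x - y))\<^sup>2 = (x $ 1 - y $ 1)\<^sup>2 + (x $ 2 - y $ 2)\<^sup>2"
      by (simp add: norm_vec_def L2_set_def UNIV_2)
    have "a\<^sup>2 + s\<^sup>2 = (pi / (2 * L))\<^sup>2 * (norm (x - y))\<^sup>2"
      unfolding n s[symmetric] a_def power_mult_distrib distrib_left ..
    moreover have "\<alpha> * \<beta> = (pi / (2 * L))\<^sup>2 * (4 * x $ 2 * y $ 2)"
      by (simp add: \<alpha>_def \<beta>_def power2_eq_square)
    ultimately show ?thesis using L by simp
  qed
  finally have le: "sin \<alpha> * sin \<beta> / ((sinh a)\<^sup>2 + (sin s)\<^sup>2) \<le> 4 * x $ 2 * y $ 2 / (norm (x - y))\<^sup>2" .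
  have q0: "0 \<le> sin \<alpha> * sin \<beta> / ((sinh a)\<^sup>2 + (sin s)\<^sup>2)" using sin_pos by simp
  have gs: "green_strip L x y = 1 / (4 * pi) * ln (1 + sin \<alpha> * sin \<beta> / ((sinh a)\<^sup>2 + (sin s)\<^sup>2))"
    unfolding green_strip_def s \<alpha>_def[symmetric] \<beta>_def[symmetric] a_def[symmetric] ..
  have "ln (1 + sin \<alpha> * sin \<beta> / ((sinh a)\<^sup>2 + (sin s)\<^sup>2)) \<le> ln (1 + 4 * x $ 2 * y $ 2 / (norm (x - y))\<^sup>2)"
    using le q0 by (subst ln_le_cancel_iff) auto
  then show ?thesis
    using q0 unfolding gs green_half_plane_def by (intro conjI mult_left_mono mult_nonneg_nonneg) auto
qed

section \<open>The Poisson integral\<close>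

definition poisson :: "complex \<Rightarrow> real \<Rightarrow> complex \<Rightarrow> real \<Rightarrow> real" where
  "poisson c R \<zeta> t = (R\<^sup>2 - (norm (\<zeta> - c))\<^sup>2) / (norm (circlepath c R t - \<zeta>))\<^sup>2"

lemma circlepath_eq: "circlepath c R t = c + of_real R * exp (2 * of_real pi * \<i> * of_real t)"
  by (simp add: circlepath)

lemma norm_circlepath [simp]: "R \<ge> 0 \<Longrightarrow> norm (circlepath c R t - c) = R"
  by (simp add: circlepath_eq norm_mult)

lemma circlepath_measurable [measurable]: "circlepath c R \<in> borel_measurable borel"
proof -
  have "continuous_on UNIV (\<lambda>t. c + of_real R * exp (2 * of_real pi * \<i> * of_real t))"
    by (intro continuous_intros)
  then show ?thesis by (simp add: circlepath_eq[abs_def] borel_measurable_continuous_onI)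
qed

lemma poisson_measurable [measurable]:
  "(\<lambda>z. poisson c R (fst z) (snd z)) \<in> borel_measurable (borel \<Otimes>\<^sub>M borel)"
  unfolding poisson_def by measurable

lemma poisson_measurable' [measurable]: "poisson c R \<zeta> \<in> borel_measurable borel"
  unfolding poisson_def by measurable

lemma circlepath_neq:
  assumes "\<zeta> \<in> ball c R"
  shows "circlepath c R t \<noteq> \<zeta>"
proof -
  have "norm (\<zeta> - c) < R" using assms by (simp add: dist_norm norm_minus_commute)
  moreover from this have "R \<ge> 0" using norm_ge_zero[of "\<zeta> - c"] by linarith
  ultimately show ?thesis using norm_circlepath[of R c t] by auto
qed

lemma poisson_pos:
  assumes "\<zeta> \<in> ball c R"
  shows "poisson c R \<zeta> t > 0"
proof -
  have "norm (\<zeta> - c) < R" using assms by (simp add: dist_norm norm_minus_commute)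
  then have "(norm (\<zeta> - c))\<^sup>2 < R\<^sup>2" by (intro power_strict_mono) auto
  then show ?thesis using circlepath_neq[OF assms] by (simp add: poisson_def)
qed

lemma poisson_center: "R > 0 \<Longrightarrow> poisson c R c t = 1"
  by (simp add: poisson_def)

text \<open>Cauchy's formula at \<open>\<zeta>\<close> for the product of \<open>F\<close> with a function that equals \<open>1\<close> at \<open>\<zeta>\<close>
  and turns the Cauchy kernel into the Poisson kernel on the circle.\<close>

lemma poisson_formula:
  assumes F: "F holomorphic_on cball c R" and \<zeta>: "\<zeta> \<in> ball c R"
  shows "((\<lambda>t. of_real (poisson c R \<zeta> t) * F (circlepath c R t)) has_integral F \<zeta>) {0..1}"
proof -
  have R: "R > 0" using \<zeta> by (metis mem_ball zero_le_dist order.strict_trans1)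
  have \<zeta>R: "norm (\<zeta> - c) < R" using \<zeta> by (simp add: dist_norm norm_minus_commute)
  define N where "N = complex_of_real (R\<^sup>2 - (norm (\<zeta> - c))\<^sup>2)"
  define f where "f z = F z * N / (of_real (R\<^sup>2) - cnj (\<zeta> - c) * (z - c))" for z
  have "(norm (\<zeta> - c))\<^sup>2 < R\<^sup>2" using \<zeta>R by (intro power_strict_mono) auto
  then have N: "N \<noteq> 0" unfolding N_def of_real_eq_0_iff by linarith
  have nz: "of_real (R\<^sup>2) - cnj (\<zeta> - c) * (z - c) \<noteq> 0" if "z \<in> cball c R" for z
  proof
    assume "of_real (R\<^sup>2) - cnj (\<zeta> - c) * (z - c) = 0"
    then have "norm (complex_of_real (R\<^sup>2)) = norm (cnj (\<zeta> - c) * (z - c))" by simp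
    then have "R * R = norm (\<zeta> - c) * norm (z - c)"
      by (simp add: norm_mult norm_power power2_eq_square del: complex_cnj_diff)
    moreover have "norm (z - c) \<le> R" using that by (simp add: dist_norm norm_minus_commute)
    then have "norm (\<zeta> - c) * norm (z - c) < R * R"
      using \<zeta>R R by (meson mult_left_mono mult_strict_right_mono norm_ge_zero order_le_less_trans)
    ultimately show False by simp
  qed
  have "f holomorphic_on cball c R"
    unfolding f_def by (intro holomorphic_intros F nz)
  from Cauchy_integral_circlepath_simple[OF this \<zeta>R]
  have "((\<lambda>t. f (circlepath c R t) / (circlepath c R t - \<zeta>) * vector_derivative (circlepath c R) (at t))
      has_integral 2 * of_real pi * \<i> * f \<zeta>) {0..1}"
    by (simp add: has_contour_integral)
  from has_integral_mult_right[OF this, of "1 / (2 * of_real pi * \<i>)"]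
  have "((\<lambda>t. 1 / (2 * of_real pi * \<i>) * (f (circlepath c R t) / (circlepath c R t - \<zeta>)
      * vector_derivative (circlepath c R) (at t))) has_integral f \<zeta>) {0..1}"
    by simp
  moreover have "f \<zeta> = F \<zeta>"
  proof -
    have "of_real (R\<^sup>2) - cnj (\<zeta> - c) * (\<zeta> - c) = N"
      using complex_norm_square[of "\<zeta> - c"] by (simp add: N_def mult.commute)
    then show ?thesis using N by (simp add: f_def)
  qed
  moreover have "1 / (2 * of_real pi * \<i>) * (f (circlepath c R t) / (circlepath c R t - \<zeta>)
      * vector_derivative (circlepath c R) (at t)) = of_real (poisson c R \<zeta> t) * F (circlepath c R t)" for t
  proof -
    define z where "z = circlepath c R t"
    have z: "norm (z - c) = R" "z \<noteq> \<zeta>" using R circlepath_neq[OF \<zeta>] by (auto simp: z_def)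
    have v: "vector_derivative (circlepath c R) (at t) = 2 * of_real pi * \<i> * (z - c)"
      by (simp add: vector_derivative_circlepath z_def circlepath_eq)
    have "of_real (R\<^sup>2) = cnj (z - c) * (z - c)"
      using z(1) complex_norm_square[of "z - c"] by (simp add: mult.commute)
    then have den: "of_real (R\<^sup>2) - cnj (\<zeta> - c) * (z - c) = cnj (z - \<zeta>) * (z - c)"
      by (simp add: algebra_simps)
    have zc: "z - c \<noteq> 0" using z R by auto
    have "1 / (2 * of_real pi * \<i>) * (f z / (z - \<zeta>) * (2 * of_real pi * \<i> * (z - c)))
        = F z * N / (cnj (z - \<zeta>) * (z - c)) / (z - \<zeta>) * (z - c)"
      unfolding f_def den by simp
    also have "\<dots> = N / (cnj (z - \<zeta>) * (z - \<zeta>)) * F z"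
      using zc by (simp del: complex_cnj_diff)
    also have "cnj (z - \<zeta>) * (z - \<zeta>) = of_real ((norm (z - \<zeta>))\<^sup>2)"
      using complex_norm_square[of "z - \<zeta>"] by (simp add: mult.commute)
    also have "N / of_real ((norm (z - \<zeta>))\<^sup>2) * F z = of_real (poisson c R \<zeta> t) * F z"
      by (simp add: N_def poisson_def z_def)
    finally show ?thesis by (simp only: v z_def)
  qed
  ultimately show ?thesis by simp
qed

lemma poisson_formula_Re:
  assumes F: "F holomorphic_on cball c R" and \<zeta>: "\<zeta> \<in> ball c R"
  shows "((\<lambda>t. poisson c R \<zeta> t * Re (F (circlepath c R t))) has_integral Re (F \<zeta>)) {0..1}"
  using has_integral_Re[OF poisson_formula[OF F \<zeta>]] by simp

abbreviation unit_measure :: "real measure" where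
  "unit_measure \<equiv> restrict_space lborel {0..1}"

lemma nn_integral_poisson_Re:
  assumes F: "F holomorphic_on cball c R" and \<zeta>: "\<zeta> \<in> ball c R"
    and nonneg: "\<And>z. norm (z - c) = R \<Longrightarrow> Re (F z) \<ge> 0"
  shows "(\<integral>\<^sup>+t. ennreal (poisson c R \<zeta> t) * ennreal (Re (F (circlepath c R t))) \<partial>unit_measure) = ennreal (Re (F \<zeta>))"
proof -
  have R: "R \<ge> 0" using \<zeta> by (metis mem_ball zero_le_dist order.strict_trans1 less_imp_le)
  have pos: "0 \<le> poisson c R \<zeta> t" for t using poisson_pos[OF \<zeta>, of t] by simp
  have nn: "0 \<le> Re (F (circlepath c R t))" for t using R by (intro nonneg) simp
  have "(\<integral>\<^sup>+t. ennreal (poisson c R \<zeta> t) * ennreal (Re (F (circlepath c R t))) \<partial>unit_measure)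
      = (\<integral>\<^sup>+t. ennreal (poisson c R \<zeta> t * Re (F (circlepath c R t))) * indicator {0..1} t \<partial>lborel)"
    by (subst nn_integral_restrict_space) (auto simp: ennreal_mult pos nn)
  also have "\<dots> = ennreal (Re (F \<zeta>))"
    by (rule nn_integral_has_integral_lebesgue'[OF _ poisson_formula_Re[OF F \<zeta>]]) (simp add: pos nn)
  finally show ?thesis .
qed

text \<open>Expanding the kernel in a geometric series exhibits the Poisson integral of an integrable
  boundary function as the real part of a power series.\<close>

lemma poisson_integral_holomorphic:
  fixes u :: "real \<Rightarrow> real"
  assumes R: "R > 0" and u: "integrable unit_measure u"
  obtains F where "F holomorphic_on ball c R"
    "\<And>\<zeta>. \<zeta> \<in> ball c R \<Longrightarrow> Re (F \<zeta>) = (LINT t|unit_measure. poisson c R \<zeta> t * u t)"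
proof -
  have [measurable]: "u \<in> borel_measurable unit_measure" using u by simp
  define e where "e t = exp (2 * of_real pi * \<i> * complex_of_real t)" for t
  have e1: "norm (e t) = 1" for t by (simp add: e_def)
  have e0: "e t \<noteq> 0" for t by (simp add: e_def)
  have "continuous_on UNIV e" unfolding e_def by (intro continuous_intros)
  then have "e \<in> borel_measurable borel" by (rule borel_measurable_continuous_onI)
  then have [measurable]: "e \<in> borel_measurable unit_measure"
    by (intro measurable_restrict_space1) simp
  define a where "a n = (LINT t|unit_measure. of_real (u t) * inverse (e t) ^ n)" for n
  define \<xi> where "\<xi> \<zeta> = (\<zeta> - c) / of_real R" for \<zeta>
  have \<xi>: "norm (\<xi> \<zeta>) < 1" if "\<zeta> \<in> ball c R" for \<zeta>
    using that R by (simp add: \<xi>_def norm_divide dist_norm norm_minus_commute)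
  define G where "G \<zeta> = (LINT t|unit_measure. (\<Sum>n. of_real (u t) * (\<xi> \<zeta> / e t) ^ n))" for \<zeta>
  have ia: "integrable unit_measure (\<lambda>t. of_real (u t) * inverse (e t) ^ n)" for n
    by (rule Bochner_Integration.integrable_bound[OF u]) (auto simp: norm_mult norm_power norm_inverse e1)
  have geo: "(\<lambda>n. of_real (u t) * (\<xi> \<zeta> / e t) ^ n) sums (of_real (u t) * (e t / (e t - \<xi> \<zeta>)))"
    if "\<zeta> \<in> ball c R" for \<zeta> t
  proof -
    have "norm (\<xi> \<zeta> / e t) < 1" using \<xi>[OF that] by (simp add: norm_divide e1)
    from sums_mult[OF geometric_sums[OF this], of "of_real (u t)"]
    have "(\<lambda>n. of_real (u t) * (\<xi> \<zeta> / e t) ^ n) sums (of_real (u t) * (1 / (1 - \<xi> \<zeta> / e t)))" .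
    moreover have "1 / (1 - \<xi> \<zeta> / e t) = e t / (e t - \<xi> \<zeta>)" using e0[of t] by (simp add: field_simps)
    ultimately show ?thesis by simp
  qed
  have f_int: "integrable unit_measure (\<lambda>t. of_real (u t) * (\<xi> \<zeta> / e t) ^ n)" for \<zeta> n
  proof -
    have "integrable unit_measure (\<lambda>t. \<xi> \<zeta> ^ n * (of_real (u t) * inverse (e t) ^ n))" using ia by simp
    then show ?thesis by (simp add: power_divide power_inverse divide_inverse power_mult_distrib mult_ac)
  qed
  have f_norm: "norm (of_real (u t) * (\<xi> \<zeta> / e t) ^ n) = norm (\<xi> \<zeta>) ^ n * \<bar>u t\<bar>" for t \<zeta> n
    by (simp add: norm_mult norm_power norm_divide e1)
  have sum1: "AE t in unit_measure. summable (\<lambda>n. norm (of_real (u t) * (\<xi> \<zeta> / e t) ^ n))"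
    and sum2: "summable (\<lambda>n. LINT t|unit_measure. norm (of_real (u t) * (\<xi> \<zeta> / e t) ^ n))"
    if "\<zeta> \<in> ball c R" for \<zeta>
    using \<xi>[OF that] by (auto simp: f_norm intro!: summable_mult2 summable_geometric)
  have G: "(\<lambda>n. a n / of_real R ^ n * (\<zeta> - c) ^ n) sums G \<zeta>" if \<zeta>: "\<zeta> \<in> ball c R" for \<zeta>
  proof -
    have "(LINT t|unit_measure. of_real (u t) * (\<xi> \<zeta> / e t) ^ n) = a n / of_real R ^ n * (\<zeta> - c) ^ n" for n
    proof -
      have "(LINT t|unit_measure. of_real (u t) * (\<xi> \<zeta> / e t) ^ n)
          = (LINT t|unit_measure. \<xi> \<zeta> ^ n * (of_real (u t) * inverse (e t) ^ n))"
        by (intro Bochner_Integration.integral_cong) (simp_all add: power_divide power_inverse divide_inverse power_mult_distrib mult_ac)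
      also have "\<dots> = \<xi> \<zeta> ^ n * a n" by (simp add: a_def)
      finally show ?thesis by (simp add: \<xi>_def power_divide)
    qed
    then show ?thesis
      using sums_integral[OF f_int sum1[OF \<zeta>] sum2[OF \<zeta>]] by (simp add: G_def)
  qed
  have hol: "G holomorphic_on ball c R"
    using G by (rule power_series_holomorphic)
  have val: "Re (2 * G \<zeta> - a 0) = (LINT t|unit_measure. poisson c R \<zeta> t * u t)" if \<zeta>: "\<zeta> \<in> ball c R" for \<zeta>
  proof -
    have suminf: "(\<Sum>n. of_real (u t) * (\<xi> \<zeta> / e t) ^ n) = of_real (u t) * (e t / (e t - \<xi> \<zeta>))" for t
      using geo[OF \<zeta>] by (rule sums_unique[symmetric])
    have iG: "integrable unit_measure (\<lambda>t. of_real (u t) * (e t / (e t - \<xi> \<zeta>)))"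
      using integrable_suminf[OF f_int sum1[OF \<zeta>] sum2[OF \<zeta>]] by (simp only: suminf)
    have iu: "integrable unit_measure (\<lambda>t. complex_of_real (u t))" using u by simp
    have "2 * G \<zeta> - a 0 = (LINT t|unit_measure. 2 * (of_real (u t) * (e t / (e t - \<xi> \<zeta>))) - of_real (u t))"
    proof -
      have "a 0 = (LINT t|unit_measure. complex_of_real (u t))" by (simp add: a_def)
      moreover have "2 * G \<zeta> = (LINT t|unit_measure. 2 * (of_real (u t) * (e t / (e t - \<xi> \<zeta>))))"
        unfolding G_def suminf by (rule integral_mult_right_zero[symmetric])
      ultimately show ?thesis
        using Bochner_Integration.integral_diff[OF integrable_mult_right[of 2, OF iG] iu] by simp
    qed
    then have "Re (2 * G \<zeta> - a 0) = (LINT t|unit_measure. Re (2 * (of_real (u t) * (e t / (e t - \<xi> \<zeta>))) - of_real (u t)))"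
      using Bochner_Integration.integrable_diff[OF integrable_mult_right[of 2, OF iG] iu]
      by (simp only: integral_Re)
    also have "\<dots> = (LINT t|unit_measure. poisson c R \<zeta> t * u t)"
    proof (intro Bochner_Integration.integral_cong refl)
      fix t
      define d where "d = e t - \<xi> \<zeta>"
      have d: "d \<noteq> 0" using \<xi>[OF \<zeta>] e1[of t] by (auto simp: d_def)
      have P: "poisson c R \<zeta> t = (1 - (norm (\<xi> \<zeta>))\<^sup>2) / (norm d)\<^sup>2"
      proof -
        have "of_real R * \<xi> \<zeta> = \<zeta> - c" using R by (simp add: \<xi>_def)
        then have "circlepath c R t - \<zeta> = of_real R * d"
          by (simp add: circlepath_eq d_def right_diff_distrib flip: e_def)
        then have 1: "(norm (circlepath c R t - \<zeta>))\<^sup>2 = R\<^sup>2 * (norm d)\<^sup>2"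
          by (simp add: norm_mult power_mult_distrib)
        have "norm (\<zeta> - c) = R * norm (\<xi> \<zeta>)" using R by (simp add: \<xi>_def norm_divide)
        then have 2: "R\<^sup>2 - (norm (\<zeta> - c))\<^sup>2 = R\<^sup>2 * (1 - (norm (\<xi> \<zeta>))\<^sup>2)"
          by (simp add: power_mult_distrib algebra_simps)
        show ?thesis unfolding poisson_def 1 2 using R by simp
      qed
      have "2 * Re (e t / d) - 1 = (1 - (norm (\<xi> \<zeta>))\<^sup>2) / (norm d)\<^sup>2"
      proof -
        have "e t / d = e t * cnj d / of_real ((norm d)\<^sup>2)"
          by (simp add: complex_div_cnj[of "e t" d])
        then have "Re (e t / d) = Re (e t * cnj d) / (norm d)\<^sup>2"
          by (simp only: Re_divide_of_real)
        moreover have "2 * Re (e t * cnj d) - (norm d)\<^sup>2 = (norm (e t))\<^sup>2 - (norm (\<xi> \<zeta>))\<^sup>2"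
          unfolding cmod_power2 d_def by (simp add: power2_eq_square algebra_simps)
        ultimately show ?thesis using d e1[of t] by (simp add: divide_simps algebra_simps)
      qed
      then show "Re (2 * (of_real (u t) * (e t / (e t - \<xi> \<zeta>))) - of_real (u t)) = poisson c R \<zeta> t * u t"
        unfolding P d_def[symmetric] by (simp add: algebra_simps flip: times_divide_eq_right)
    qed
    finally show ?thesis .
  qed
  show ?thesis
    by (rule that[of "\<lambda>\<zeta>. 2 * G \<zeta> - a 0"]) (intro holomorphic_intros hol val | assumption)+
qed

section \<open>Sweeping of the Green's function of the half-plane\<close>

text \<open>Harmonic measure of the disc, extended by the point mass outside of it. Integration against
  it replaces a function inside the disc by the Poisson integral of its boundary values. As a
  measure it lets Tonelli's theorem exchange sweeps in different variables.\<close>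

definition harmonic_measure :: "complex \<Rightarrow> real \<Rightarrow> complex \<Rightarrow> complex measure" where
  "harmonic_measure c R \<zeta> = (if \<zeta> \<in> ball c R
     then distr (density unit_measure (\<lambda>t. ennreal (poisson c R \<zeta> t))) borel (circlepath c R)
     else return borel \<zeta>)"

definition sweep :: "complex \<Rightarrow> real \<Rightarrow> (complex \<Rightarrow> ennreal) \<Rightarrow> complex \<Rightarrow> ennreal" where
  "sweep c R u \<zeta> = (\<integral>\<^sup>+z. u z \<partial>harmonic_measure c R \<zeta>)"

lemma sets_harmonic_measure [measurable_cong, simp]: "sets (harmonic_measure c R \<zeta>) = sets borel"
  by (simp add: harmonic_measure_def)

lemma space_harmonic_measure [simp]: "space (harmonic_measure c R \<zeta>) = UNIV"
  using sets_eq_imp_space_eq[OF sets_harmonic_measure] by simp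

lemma borel_measurable_unit: "f \<in> borel_measurable borel \<Longrightarrow> f \<in> borel_measurable unit_measure"
  by (intro measurable_restrict_space1) simp

lemma circlepath_measurable_unit [measurable]: "circlepath c R \<in> borel_measurable unit_measure"
  by (intro borel_measurable_unit) measurable

lemma poisson_measurable_unit [measurable]: "poisson c R \<zeta> \<in> borel_measurable unit_measure"
  by (intro borel_measurable_unit) measurable

lemma sweep_inside:
  assumes "\<zeta> \<in> ball c R" and [measurable]: "u \<in> borel_measurable borel"
  shows "sweep c R u \<zeta> = (\<integral>\<^sup>+t. ennreal (poisson c R \<zeta> t) * u (circlepath c R t) \<partial>unit_measure)"
  using assms(1) unfolding sweep_def harmonic_measure_def
  by (simp add: nn_integral_distr nn_integral_density)

lemma sweep_outside:
  assumes "\<zeta> \<notin> ball c R" and "u \<in> borel_measurable borel"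
  shows "sweep c R u \<zeta> = u \<zeta>"
  using assms unfolding sweep_def harmonic_measure_def by (simp add: nn_integral_return)

lemma sweep_mono: "(\<And>z. u z \<le> v z) \<Longrightarrow> sweep c R u \<zeta> \<le> sweep c R v \<zeta>"
  unfolding sweep_def by (rule nn_integral_mono)

lemma ball_radius_pos: "\<zeta> \<in> ball c R \<Longrightarrow> R > 0"
  for c :: complex by (metis mem_ball zero_le_dist order.strict_trans1)

lemma sweep_cong_circle:
  assumes "\<zeta> \<in> ball c R" and "u \<in> borel_measurable borel" "v \<in> borel_measurable borel"
    and "\<And>z. norm (z - c) = R \<Longrightarrow> u z = v z"
  shows "sweep c R u \<zeta> = sweep c R v \<zeta>"
  using assms ball_radius_pos[OF assms(1)] by (simp add: sweep_inside)

lemma sweep_Re: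
  assumes "\<zeta> \<in> ball c R" and u: "u \<in> borel_measurable borel" and F: "F holomorphic_on cball c R"
    and nonneg: "\<And>z. norm (z - c) = R \<Longrightarrow> Re (F z) \<ge> 0"
    and eq: "\<And>z. norm (z - c) = R \<Longrightarrow> u z = ennreal (Re (F z))"
  shows "sweep c R u \<zeta> = ennreal (Re (F \<zeta>))"
proof -
  have "sweep c R u \<zeta> = (\<integral>\<^sup>+t. ennreal (poisson c R \<zeta> t) * ennreal (Re (F (circlepath c R t))) \<partial>unit_measure)"
    using assms(1) u ball_radius_pos[OF assms(1)] by (simp add: sweep_inside eq)
  also have "\<dots> = ennreal (Re (F \<zeta>))"
    by (rule nn_integral_poisson_Re[OF F assms(1) nonneg])
  finally show ?thesis .
qed

lemma sweep_const [simp]: "sweep c R (\<lambda>_. a) \<zeta> = a"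
proof (cases "\<zeta> \<in> ball c R")
  case True
  have "sweep c R (\<lambda>_. 1) \<zeta> = ennreal (Re 1)"
    using True by (intro sweep_Re[where F="\<lambda>_. 1"]) auto
  moreover have "sweep c R (\<lambda>_. a) \<zeta> = a * sweep c R (\<lambda>_. 1) \<zeta>"
    unfolding sweep_def using nn_integral_cmult[of "\<lambda>_. 1" "harmonic_measure c R \<zeta>" a] by simp
  ultimately show ?thesis by simp
qed (simp add: sweep_outside)

lemma prob_space_harmonic_measure: "prob_space (harmonic_measure c R \<zeta>)"
proof
  show "emeasure (harmonic_measure c R \<zeta>) (space (harmonic_measure c R \<zeta>)) = 1"
    using sweep_const[of c R 1 \<zeta>] unfolding sweep_def by simp
qed

definition sweep_fst :: "complex \<Rightarrow> real \<Rightarrow> (complex \<times> complex \<Rightarrow> ennreal) \<Rightarrow> complex \<times> complex \<Rightarrow> ennreal" where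
  "sweep_fst c R K = (\<lambda>(z, w). sweep c R (\<lambda>z. K (z, w)) z)"

definition sweep_snd :: "complex \<Rightarrow> real \<Rightarrow> (complex \<times> complex \<Rightarrow> ennreal) \<Rightarrow> complex \<times> complex \<Rightarrow> ennreal" where
  "sweep_snd c R K = (\<lambda>(z, w). sweep c R (\<lambda>w. K (z, w)) w)"

lemma unit_measure_sigma_finite: "sigma_finite_measure unit_measure"
  by (intro sigma_finite_measure_restrict_space lborel.sigma_finite_measure_axioms) auto

lemma sweep_fst_measurable [measurable]:
  assumes [measurable]: "K \<in> borel_measurable (borel \<Otimes>\<^sub>M borel)"
  shows "sweep_fst c R K \<in> borel_measurable (borel \<Otimes>\<^sub>M borel)"
proof -
  interpret sigma_finite_measure unit_measure by (rule unit_measure_sigma_finite)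
  have "sweep_fst c R K = (\<lambda>p. if fst p \<in> ball c R
      then \<integral>\<^sup>+t. ennreal (poisson c R (fst p) t) * K (circlepath c R t, snd p) \<partial>unit_measure else K p)"
    by (auto simp: sweep_fst_def sweep_inside sweep_outside fun_eq_iff)
  also have "\<dots> \<in> borel_measurable (borel \<Otimes>\<^sub>M borel)"
  proof (rule measurable_If)
    have "(\<lambda>z. (fst (fst z), snd z)) \<in> (borel \<Otimes>\<^sub>M borel) \<Otimes>\<^sub>M unit_measure \<rightarrow>\<^sub>M borel \<Otimes>\<^sub>M (borel :: real measure)"
      by (intro measurable_Pair measurable_compose[OF measurable_snd borel_measurable_unit]) measurable
    from measurable_compose[OF this poisson_measurable]
    have [measurable]: "(\<lambda>z. poisson c R (fst (fst z)) (snd z)) \<in> borel_measurable ((borel \<Otimes>\<^sub>M borel) \<Otimes>\<^sub>M unit_measure)"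
      by simp
    have "Measurable.pred (borel \<Otimes>\<^sub>M borel) (\<lambda>p :: complex \<times> complex. fst p \<in> ball c R)"
      unfolding mem_ball dist_norm by measurable
    then show "{p \<in> space (borel \<Otimes>\<^sub>M borel). fst p \<in> ball c R} \<in> sets (borel \<Otimes>\<^sub>M (borel :: complex measure))"
      by (simp add: pred_def)
    show "(\<lambda>p. \<integral>\<^sup>+t. ennreal (poisson c R (fst p) t) * K (circlepath c R t, snd p) \<partial>unit_measure)
        \<in> borel_measurable (borel \<Otimes>\<^sub>M borel)"
      by (rule borel_measurable_nn_integral) (simp add: case_prod_unfold)
  qed measurable
  finally show ?thesis .
qed

lemma sweep_snd_eq_swap: "sweep_snd c R K p = sweep_fst c R (K \<circ> prod.swap) (prod.swap p)"
  by (cases p) (simp add: sweep_snd_def sweep_fst_def)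

lemma sweep_snd_measurable [measurable]:
  assumes [measurable]: "K \<in> borel_measurable (borel \<Otimes>\<^sub>M borel)"
  shows "sweep_snd c R K \<in> borel_measurable (borel \<Otimes>\<^sub>M borel)"
proof -
  have sw: "(prod.swap :: complex \<times> complex \<Rightarrow> _) \<in> borel \<Otimes>\<^sub>M borel \<rightarrow>\<^sub>M borel \<Otimes>\<^sub>M borel"
    by (simp add: prod.swap_def[abs_def])
  have "(\<lambda>p. sweep_fst c R (K \<circ> prod.swap) (prod.swap p)) \<in> borel_measurable (borel \<Otimes>\<^sub>M borel)"
    by (intro measurable_compose[OF sw] sweep_fst_measurable measurable_comp[OF sw]) fact
  then show ?thesis by (simp add: sweep_snd_eq_swap[abs_def])
qed

lemma sweep_fst_snd_commute:
  assumes [measurable]: "K \<in> borel_measurable (borel \<Otimes>\<^sub>M borel)"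
  shows "sweep_fst c R (sweep_snd d S K) = sweep_snd d S (sweep_fst c R K)"
proof
  fix p :: "complex \<times> complex"
  obtain z w where p: "p = (z, w)" by (cases p)
  interpret A: prob_space "harmonic_measure c R z" by (rule prob_space_harmonic_measure)
  interpret B: prob_space "harmonic_measure d S w" by (rule prob_space_harmonic_measure)
  interpret AB: pair_sigma_finite "harmonic_measure c R z" "harmonic_measure d S w" ..
  have [measurable]: "K \<in> borel_measurable (harmonic_measure c R z \<Otimes>\<^sub>M harmonic_measure d S w)"
    using assms by (simp cong: measurable_cong_sets sets_pair_measure_cong)
  show "sweep_fst c R (sweep_snd d S K) p = sweep_snd d S (sweep_fst c R K) p"
    unfolding p sweep_fst_def sweep_snd_def sweep_def
    using AB.Fubini[of K] by simp
qed

text \<open>The Green's function of the half-plane, without its factor \<open>1 / (2 \<pi>)\<close>, infinite on the diagonal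
  and extended by zero.\<close>

definition half_plane_kernel :: "complex \<times> complex \<Rightarrow> ennreal" where
  "half_plane_kernel p = (if Im (fst p) \<le> 0 \<or> Im (snd p) \<le> 0 then 0
     else if norm (fst p - snd p) = 0 then \<infinity>
     else ennreal (ln (norm (fst p - cnj (snd p)) / norm (fst p - snd p))))"

lemma half_plane_kernel_measurable [measurable]: "half_plane_kernel \<in> borel_measurable (borel \<Otimes>\<^sub>M borel)"
proof -
  have "(\<lambda>p. cnj (snd p)) \<in> borel_measurable (borel \<Otimes>\<^sub>M borel)"
    by (rule measurable_compose[OF measurable_snd]) (intro borel_measurable_continuous_onI continuous_intros)
  then show ?thesis unfolding half_plane_kernel_def by measurable
qed

lemma norm_diff_cnj_commute: "norm (z - cnj w) = norm (w - cnj z)"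
  by (metis complex_cnj_cnj complex_cnj_diff complex_mod_cnj norm_minus_commute)

lemma half_plane_kernel_commute: "half_plane_kernel (z, w) = half_plane_kernel (w, z)"
  by (auto simp: half_plane_kernel_def norm_minus_commute[of z w] norm_diff_cnj_commute[of z w])

lemma half_plane_kernel_eq:
  assumes "Im z > 0" "Im w > 0" "z \<noteq> w"
  shows "half_plane_kernel (z, w) = ennreal (ln (norm (z - cnj w) / norm (z - w)))"
  using assms by (simp add: half_plane_kernel_def)

lemma norm_diff_less_norm_diff_cnj:
  assumes "Im z > 0" "Im w > 0"
  shows "norm (z - w) < norm (z - cnj w)"
proof -
  have "(norm (z - cnj w))\<^sup>2 - (norm (z - w))\<^sup>2 = 4 * Im z * Im w"
    unfolding cmod_power2 by (simp add: power2_eq_square algebra_simps)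
  moreover have "0 < 4 * Im z * Im w" using assms by simp
  ultimately have "(norm (z - w))\<^sup>2 < (norm (z - cnj w))\<^sup>2" by linarith
  then show ?thesis by (rule power2_less_imp_less) simp
qed

text \<open>A logarithmic pole at \<open>w\<close>, with the constant \<open>M\<close> making it nonnegative on a disc.\<close>

definition log_kernel :: "real \<Rightarrow> complex \<Rightarrow> complex \<Rightarrow> ennreal" where
  "log_kernel M w z = (if norm (z - w) = 0 then \<infinity> else ennreal (ln (M / norm (z - w))))"

lemma log_kernel_measurable [measurable]: "log_kernel M w \<in> borel_measurable borel"
  unfolding log_kernel_def by measurable

lemma sweep_log_kernel_far:
  assumes \<zeta>: "\<zeta> \<in> ball c R" and w: "R < norm (w - c)" and M: "R + norm (w - c) \<le> M"
  shows "sweep c R (log_kernel M w) \<zeta> = log_kernel M w \<zeta>"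
proof -
  have R: "R > 0" by (rule ball_radius_pos[OF \<zeta>])
  have cw: "c - w \<noteq> 0" "w - c \<noteq> 0" using w R by auto
  have Mp: "M > 0" using M R w by linarith
  define F where "F z = of_real (ln (M / norm (c - w))) - Ln ((z - w) / (c - w))" for z
  have re: "0 < Re ((z - w) / (c - w))" if "z \<in> cball c R" for z
  proof -
    have "norm ((z - c) / (c - w)) < 1"
      using that w cw by (simp add: norm_divide divide_simps dist_norm norm_minus_commute)
    then have "\<bar>Re ((z - c) / (c - w))\<bar> < 1" using abs_Re_le_cmod order_le_less_trans by blast
    moreover have "(z - w) / (c - w) = 1 + (z - c) / (c - w)" using cw by (simp add: field_simps)
    ultimately show ?thesis by simp
  qed
  have zw: "z \<noteq> w" if "z \<in> cball c R" for z
    using that w by (auto simp: dist_norm norm_minus_commute)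
  have "(z - w) / (c - w) \<notin> \<real>\<^sub>\<le>\<^sub>0" if "z \<in> cball c R" for z
    using re[OF that] by (auto simp: complex_nonpos_Reals_iff)
  then have F: "F holomorphic_on cball c R"
    unfolding F_def by (intro holomorphic_intros) (use cw in auto)
  have ReF: "Re (F z) = ln (M / norm (z - w))" if "z \<in> cball c R" for z
  proof -
    have "(z - w) / (c - w) \<noteq> 0" using zw[OF that] cw by simp
    then have "Re (F z) = ln (M / norm (c - w)) - ln (norm (z - w) / norm (c - w))"
      by (simp add: F_def norm_divide)
    also have "\<dots> = ln (M / norm (z - w))" using zw[OF that] cw Mp by (simp add: ln_div)
    finally show ?thesis .
  qed
  have lk: "log_kernel M w z = ennreal (Re (F z))" if "z \<in> cball c R" for z
    using zw[OF that] by (simp add: log_kernel_def ReF[OF that])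
  have pos: "0 \<le> Re (F z)" if z: "z \<in> cball c R" for z
  proof -
    have "norm (z - w) \<le> norm (z - c) + norm (c - w)" using norm_triangle_ineq[of "z - c" "c - w"] by simp
    then have "norm (z - w) \<le> M" using z M by (simp add: dist_norm norm_minus_commute)
    then show ?thesis using zw[OF z] unfolding ReF[OF z] by (intro ln_ge_zero) (simp add: divide_simps)
  qed
  have "sweep c R (log_kernel M w) \<zeta> = ennreal (Re (F \<zeta>))"
    by (rule sweep_Re[OF \<zeta> _ F]) (use lk pos R in \<open>auto simp: dist_norm norm_minus_commute\<close>)
  also have "\<dots> = log_kernel M w \<zeta>" using lk \<zeta> by simp
  finally show ?thesis .
qed

text \<open>A logarithmic pole on the circle itself is reached from outside along the ray from the centre,
  on which the distance to every point of the closed disc increases, so that monotone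
  convergence applies.\<close>

lemma sweep_log_kernel:
  assumes \<zeta>: "\<zeta> \<in> ball c R" and w: "w \<notin> ball c R" and M: "R + norm (w - c) < M"
  shows "sweep c R (log_kernel M w) \<zeta> = log_kernel M w \<zeta>"
proof (cases "R < norm (w - c)")
  case True
  then show ?thesis using sweep_log_kernel_far[OF \<zeta>] M by simp
next
  case False
  have R: "R > 0" by (rule ball_radius_pos[OF \<zeta>])
  have wR: "norm (w - c) = R" using False w by (simp add: dist_norm norm_minus_commute)
  define \<delta> where "\<delta> = (M - 2 * R) / R"
  have \<delta>: "\<delta> > 0" using M wR R by (simp add: \<delta>_def)
  define s where "s n = \<delta> / (real n + 1)" for n :: nat
  have s: "0 < s n" "s n \<le> \<delta>" "s (Suc n) \<le> s n" for n
    using \<delta> by (auto simp: s_def field_simps)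
  define v where "v n = w + of_real (s n) * (w - c)" for n
  have v_far: "norm (v n - c) = R + s n * R" for n
  proof -
    have "v n - c = of_real (1 + s n) * (w - c)" by (simp add: v_def algebra_simps)
    then have "norm (v n - c) = \<bar>1 + s n\<bar> * R" by (simp only: norm_mult norm_of_real wR)
    then show ?thesis using s(1)[of n] by (simp add: algebra_simps)
  qed
  have decr: "norm (z - (w + of_real a * (w - c))) \<le> norm (z - (w + of_real b * (w - c)))"
    if z: "z \<in> cball c R" and ab: "0 \<le> a" "a \<le> b" for z a b
  proof -
    define x where "x = z - w"
    define y where "y = w - c"
    have xy: "Re (x * cnj y) \<le> 0"
    proof -
      have "x * cnj y = (z - c) * cnj y - y * cnj y" by (simp add: x_def y_def algebra_simps)
      moreover have "Re (y * cnj y) = R\<^sup>2"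
      proof -
        have "y * cnj y = of_real ((norm y)\<^sup>2)" by (rule complex_norm_square[symmetric])
        then have "Re (y * cnj y) = (norm y)\<^sup>2" by (simp only: Re_complex_of_real)
        then show ?thesis using wR by (simp add: y_def)
      qed
      moreover have "Re ((z - c) * cnj y) \<le> norm ((z - c) * cnj y)" by (rule complex_Re_le_cmod)
      moreover have "norm ((z - c) * cnj y) \<le> R * R"
        unfolding norm_mult complex_mod_cnj using z wR
        by (intro mult_mono) (auto simp: y_def dist_norm norm_minus_commute)
      ultimately show ?thesis by (simp add: power2_eq_square)
    qed
    have e: "(norm (z - (w + of_real r * (w - c))))\<^sup>2 = (norm x)\<^sup>2 - 2 * r * Re (x * cnj y) + r\<^sup>2 * (norm y)\<^sup>2" for r
      unfolding x_def[symmetric] y_def[symmetric] cmod_power2 by (simp add: x_def y_def power2_eq_square algebra_simps)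
    have "a * (- Re (x * cnj y)) \<le> b * (- Re (x * cnj y))" using ab xy by (intro mult_right_mono) auto
    moreover have "a\<^sup>2 * (norm y)\<^sup>2 \<le> b\<^sup>2 * (norm y)\<^sup>2" using ab by (intro mult_right_mono power_mono) auto
    ultimately have "(norm (z - (w + of_real a * (w - c))))\<^sup>2 \<le> (norm (z - (w + of_real b * (w - c))))\<^sup>2"
      unfolding e by linarith
    then show ?thesis by (rule power2_le_imp_le) simp
  qed
  have v0: "v n \<noteq> z" if "z \<in> cball c R" for n z
  proof
    assume "v n = z"
    with v_far[of n] that have "R + s n * R \<le> R" by (simp add: dist_norm norm_minus_commute)
    with s(1)[of n] R show False by (simp add: mult_le_0_iff)
  qed
  have lim: "(\<lambda>n. log_kernel M (v n) z) \<longlonglongrightarrow> log_kernel M w z" if z: "z \<in> cball c R" for z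
  proof (cases "z = w")
    case True
    have "norm (z - v n) = s n * R" for n
      using s(1)[of n] wR True by (simp add: v_def norm_mult)
    then have "log_kernel M (v n) z = ennreal (ln (M / (\<delta> / (real n + 1) * R)))" for n
      using \<delta> R by (simp add: log_kernel_def s_def)
    moreover have "filterlim (\<lambda>n. ln (M / (\<delta> / (real n + 1) * R))) at_top sequentially"
    proof -
      have "0 < M / (\<delta> * R)" using M R \<delta> wR by simp
      then have "filterlim (\<lambda>n. ln (M / (\<delta> * R) * (real n + 1))) at_top sequentially" by real_asymp
      then show ?thesis by (simp add: field_simps)
    qed
    ultimately show ?thesis using True by (simp add: log_kernel_def ennreal_tendsto_top_eq_at_top)
  next
    case False
    have "s \<longlonglongrightarrow> 0" unfolding s_def by real_asymp
    then have "(\<lambda>n. ln (M / norm (z - v n))) \<longlonglongrightarrow> ln (M / norm (z - (w + of_real 0 * (w - c))))"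
      unfolding v_def using False M R wR by (intro tendsto_intros) auto
    then have "(\<lambda>n. ennreal (ln (M / norm (z - v n)))) \<longlonglongrightarrow> ennreal (ln (M / norm (z - w)))"
      by (intro tendsto_ennrealI) simp
    moreover have "log_kernel M (v n) z = ennreal (ln (M / norm (z - v n)))" for n
      using v0[OF z, of n] by (simp add: log_kernel_def)
    ultimately show ?thesis using False by (simp add: log_kernel_def)
  qed
  have mono: "log_kernel M (v n) z \<le> log_kernel M (v (Suc n)) z" if z: "z \<in> cball c R" for n z
  proof -
    have pos: "norm (z - v n) > 0" "norm (z - v (Suc n)) > 0" using v0[OF z, of n] v0[OF z, of "Suc n"] by auto
    have "norm (z - v (Suc n)) \<le> norm (z - v n)"
      unfolding v_def using s by (intro decr z) (auto simp: less_imp_le)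
    then have "ln (M / norm (z - v n)) \<le> ln (M / norm (z - v (Suc n)))"
      using pos M R wR by (intro ln_mono divide_left_mono) (auto intro!: divide_pos_pos mult_pos_pos)
    then show ?thesis using pos by (simp add: log_kernel_def ennreal_leI)
  qed
  have cb: "circlepath c R t \<in> cball c R" for t
    using R norm_circlepath[of R c t] by (simp add: dist_norm norm_minus_commute[of c])
  have "(\<lambda>n. \<integral>\<^sup>+t. ennreal (poisson c R \<zeta> t) * log_kernel M (v n) (circlepath c R t) \<partial>unit_measure)
      \<longlonglongrightarrow> (\<integral>\<^sup>+t. ennreal (poisson c R \<zeta> t) * log_kernel M w (circlepath c R t) \<partial>unit_measure)"
  proof (rule nn_integral_LIMSEQ)
    show "incseq (\<lambda>n t. ennreal (poisson c R \<zeta> t) * log_kernel M (v n) (circlepath c R t))"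
      using mono[OF cb] by (intro incseq_SucI le_funI mult_left_mono) auto
    show "(\<lambda>n. ennreal (poisson c R \<zeta> t) * log_kernel M (v n) (circlepath c R t))
        \<longlonglongrightarrow> ennreal (poisson c R \<zeta> t) * log_kernel M w (circlepath c R t)" for t
      using poisson_pos[OF \<zeta>, of t] lim[OF cb] by (intro ennreal_tendsto_cmult) auto
  qed measurable
  then have "(\<lambda>n. sweep c R (log_kernel M (v n)) \<zeta>) \<longlonglongrightarrow> sweep c R (log_kernel M w) \<zeta>"
    using \<zeta> by (simp add: sweep_inside)
  moreover have "sweep c R (log_kernel M (v n)) \<zeta> = log_kernel M (v n) \<zeta>" for n
  proof (rule sweep_log_kernel_far[OF \<zeta>])
    have "s n * R \<le> \<delta> * R" using s(2)[of n] R by (intro mult_right_mono) auto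
    then show "R < norm (v n - c)" "R + norm (v n - c) \<le> M"
      using s(1)[of n] R by (auto simp: v_far \<delta>_def)
  qed
  ultimately have "(\<lambda>n. log_kernel M (v n) \<zeta>) \<longlonglongrightarrow> sweep c R (log_kernel M w) \<zeta>" by simp
  moreover have "(\<lambda>n. log_kernel M (v n) \<zeta>) \<longlonglongrightarrow> log_kernel M w \<zeta>"
    using lim \<zeta> by simp
  ultimately show ?thesis by (rule LIMSEQ_unique)
qed

lemma half_plane_kernel_section [measurable]: "(\<lambda>z. half_plane_kernel (z, w)) \<in> borel_measurable borel"
proof -
  have "(\<lambda>z. (z, w)) \<in> borel \<rightarrow>\<^sub>M borel \<Otimes>\<^sub>M (borel :: complex measure)" by measurable
  then show ?thesis by (rule measurable_compose) measurable
qed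

text \<open>The kernel is the difference of the logarithmic poles at \<open>w\<close> and at its reflection, both of
  which are reproduced by the Poisson integral. The subtraction is done by cancelling the finite
  contribution of the reflected pole.\<close>

lemma sweep_half_plane_kernel_outside:
  assumes disc: "cball c R \<subseteq> {z. Im z > 0}" and \<zeta>: "\<zeta> \<in> ball c R" and w: "w \<notin> ball c R"
  shows "sweep c R (\<lambda>z. half_plane_kernel (z, w)) \<zeta> = half_plane_kernel (\<zeta>, w)"
proof (cases "Im w > 0")
  case False
  then have "(\<lambda>z. half_plane_kernel (z, w)) = (\<lambda>_. 0)" by (auto simp: half_plane_kernel_def)
  then show ?thesis by (simp add: fun_eq_iff)
next
  case True
  have R: "R > 0" by (rule ball_radius_pos[OF \<zeta>])
  define M where "M = R + norm (w - c) + norm (cnj w - c) + 1"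
  have M: "R + norm (w - c) < M" "R + norm (cnj w - c) < M" by (auto simp: M_def add_nonneg_pos)
  have cw: "cnj w \<notin> ball c R"
  proof
    assume "cnj w \<in> ball c R"
    then have "cnj w \<in> cball c R" by simp
    with disc True show False by force
  qed
  have sum: "half_plane_kernel (z, w) + log_kernel M (cnj w) z = log_kernel M w z" if z: "z \<in> cball c R" for z
  proof -
    have Imz: "Im z > 0" using z disc by auto
    have a: "norm (z - cnj w) > 0" using Imz True by auto
    show ?thesis
    proof (cases "z = w")
      case True
      with \<open>Im w > 0\<close> show ?thesis by (simp add: half_plane_kernel_def log_kernel_def)
    next
      case False
      have b: "norm (z - w) > 0" using False by simp
      have ab: "norm (z - w) \<le> norm (z - cnj w)"
        using norm_diff_less_norm_diff_cnj[OF Imz True] by simp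
      have "norm (z - cnj w) \<le> norm (z - c) + norm (cnj w - c)"
        using norm_triangle_ineq4[of "z - c" "cnj w - c"] by simp
      then have aM: "norm (z - cnj w) \<le> M" using z M(2) by (simp add: dist_norm norm_minus_commute)
      have l: "0 \<le> ln (norm (z - cnj w) / norm (z - w))" "0 \<le> ln (M / norm (z - cnj w))"
        using a b ab aM by (auto intro!: ln_ge_zero simp: divide_simps)
      have "ln (norm (z - cnj w) / norm (z - w)) + ln (M / norm (z - cnj w)) = ln (M / norm (z - w))"
        using a b less_le_trans[OF a aM] by (simp add: ln_div)
      then have "ennreal (ln (norm (z - cnj w) / norm (z - w))) + ennreal (ln (M / norm (z - cnj w))) = ennreal (ln (M / norm (z - w)))"
        using l by (simp flip: ennreal_plus)
      then show ?thesis
        using a b Imz True False by (simp add: half_plane_kernel_eq log_kernel_def)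
    qed
  qed
  have "sweep c R (\<lambda>z. half_plane_kernel (z, w)) \<zeta> + sweep c R (log_kernel M (cnj w)) \<zeta>
      = sweep c R (\<lambda>z. half_plane_kernel (z, w) + log_kernel M (cnj w) z) \<zeta>"
    unfolding sweep_def by (rule nn_integral_add[symmetric]) measurable
  also have "\<dots> = sweep c R (log_kernel M w) \<zeta>"
    by (rule sweep_cong_circle[OF \<zeta>]) (simp_all add: sum dist_norm norm_minus_commute)
  also have "\<dots> = half_plane_kernel (\<zeta>, w) + log_kernel M (cnj w) \<zeta>"
    using sum \<zeta> by (simp add: sweep_log_kernel[OF \<zeta> w M(1)])
  finally have "sweep c R (\<lambda>z. half_plane_kernel (z, w)) \<zeta> + log_kernel M (cnj w) \<zeta>
      = half_plane_kernel (\<zeta>, w) + log_kernel M (cnj w) \<zeta>"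
    by (simp add: sweep_log_kernel[OF \<zeta> cw M(2)])
  moreover have "log_kernel M (cnj w) \<zeta> \<noteq> \<infinity>" using cw \<zeta> by (auto simp: log_kernel_def)
  ultimately show ?thesis
    by (simp add: add.commute[of _ "log_kernel M (cnj w) \<zeta>"] ennreal_add_left_cancel)
qed

text \<open>For a pole \<open>w\<close> inside the disc, reflection in the circle gives the swept kernel in closed form.\<close>

lemma sweep_half_plane_kernel_inside:
  assumes disc: "cball c R \<subseteq> {z. Im z > 0}" and \<zeta>: "\<zeta> \<in> ball c R" and w: "w \<in> ball c R"
  shows "sweep c R (\<lambda>z. half_plane_kernel (z, w)) \<zeta>
      = ennreal (ln (norm (\<zeta> - cnj w) * R / norm (of_real (R\<^sup>2) - cnj (w - c) * (\<zeta> - c))))"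
    and "sweep c R (\<lambda>z. half_plane_kernel (z, w)) \<zeta> \<le> half_plane_kernel (\<zeta>, w)"
proof -
  have R: "R > 0" by (rule ball_radius_pos[OF \<zeta>])
  have "w \<in> cball c R" "\<zeta> \<in> cball c R" using w \<zeta> by auto
  then have Imw: "Im w > 0" and Im\<zeta>: "Im \<zeta> > 0" using disc by blast+
  define Q where "Q z = of_real (R\<^sup>2) - cnj (w - c) * (z - c)" for z
  have wR: "norm (w - c) < R" using w by (simp add: dist_norm norm_minus_commute)
  have ReQ: "Re (Q z) > 0" if "z \<in> cball c R" for z
  proof -
    have "norm (cnj (w - c) * (z - c)) < R * R"
    proof -
      have "norm (z - c) \<le> R" using that by (simp add: dist_norm norm_minus_commute)
      then have "norm (w - c) * norm (z - c) < R * R"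
        using wR R by (meson mult_left_mono mult_strict_right_mono norm_ge_zero order_le_less_trans)
      then show ?thesis by (simp add: norm_mult del: complex_cnj_diff)
    qed
    moreover have "Re (cnj (w - c) * (z - c)) \<le> norm (cnj (w - c) * (z - c))" by (rule complex_Re_le_cmod)
    ultimately have "Re (cnj (w - c) * (z - c)) < R * R" by linarith
    moreover have "Re (Q z) = R * R - Re (cnj (w - c) * (z - c))"
      unfolding Q_def by (simp only: minus_complex.simps Re_complex_of_real power2_eq_square)
    ultimately show ?thesis by linarith
  qed
  define F where "F z = Ln (z - cnj w) - Ln (Q z) + of_real (ln R)" for z
  have nn1: "z - cnj w \<notin> \<real>\<^sub>\<le>\<^sub>0" if "z \<in> cball c R" for z
    using that disc Imw by (force simp: complex_nonpos_Reals_iff)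
  have nn2: "Q z \<notin> \<real>\<^sub>\<le>\<^sub>0" if "z \<in> cball c R" for z
    using ReQ[OF that] by (auto simp: complex_nonpos_Reals_iff)
  have F: "F holomorphic_on cball c R"
    unfolding F_def
    by (intro holomorphic_intros nn1 nn2) (auto simp: Q_def[abs_def] intro!: holomorphic_intros)
  have nz: "z - cnj w \<noteq> 0" "Q z \<noteq> 0" if "z \<in> cball c R" for z
    using nn1[OF that] nn2[OF that] by auto
  have ReF: "Re (F z) = ln (norm (z - cnj w) * R / norm (Q z))" if "z \<in> cball c R" for z
    using nz[OF that] R by (simp add: F_def ln_div ln_mult)
  have on_circle: "Re (F z) = ln (norm (z - cnj w) / norm (z - w)) \<and> z \<noteq> w \<and> Im z > 0"
    if z: "norm (z - c) = R" for z
  proof -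
    have zc: "z \<in> cball c R" using z by (simp add: dist_norm norm_minus_commute)
    have "of_real (R\<^sup>2) = (z - c) * cnj (z - c)"
      using z complex_norm_square[of "z - c"] by simp
    then have "Q z = (z - c) * cnj (z - w)" by (simp add: Q_def algebra_simps)
    then have "norm (Q z) = R * norm (z - w)" using z by (simp add: norm_mult del: complex_cnj_diff)
    moreover have "z \<noteq> w" using z wR by auto
    ultimately show ?thesis using R zc disc by (auto simp: ReF)
  qed
  have "sweep c R (\<lambda>z. half_plane_kernel (z, w)) \<zeta> = ennreal (Re (F \<zeta>))"
  proof (rule sweep_Re[OF \<zeta> _ F])
    show "0 \<le> Re (F z)" if "norm (z - c) = R" for z
      using on_circle[OF that] norm_diff_less_norm_diff_cnj[of z w] Imw
      by (auto intro!: ln_ge_zero simp: divide_simps less_imp_le)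
    show "half_plane_kernel (z, w) = ennreal (Re (F z))" if "norm (z - c) = R" for z
      using on_circle[OF that] Imw by (simp add: half_plane_kernel_eq)
  qed measurable
  also have "Re (F \<zeta>) = ln (norm (\<zeta> - cnj w) * R / norm (Q \<zeta>))" using ReF \<zeta> by simp
  finally show eq: "sweep c R (\<lambda>z. half_plane_kernel (z, w)) \<zeta>
      = ennreal (ln (norm (\<zeta> - cnj w) * R / norm (of_real (R\<^sup>2) - cnj (w - c) * (\<zeta> - c))))"
    by (simp add: Q_def)
  show "sweep c R (\<lambda>z. half_plane_kernel (z, w)) \<zeta> \<le> half_plane_kernel (\<zeta>, w)"
  proof (cases "\<zeta> = w")
    case True
    then show ?thesis using Imw by (simp add: half_plane_kernel_def)
  next
    case False
    define x where "x = \<zeta> - c"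
    define y where "y = w - c"
    have xy: "norm x < R" "norm y < R" using \<zeta> wR by (auto simp: x_def y_def dist_norm norm_minus_commute)
    have "(norm (Q \<zeta>))\<^sup>2 - (R * norm (x - y))\<^sup>2 = (R\<^sup>2 - (norm x)\<^sup>2) * (R\<^sup>2 - (norm y)\<^sup>2)"
      unfolding Q_def x_def[symmetric] y_def[symmetric] power_mult_distrib cmod_power2
      by (simp add: power2_eq_square algebra_simps)
    moreover have "(norm x)\<^sup>2 \<le> R\<^sup>2" "(norm y)\<^sup>2 \<le> R\<^sup>2" using xy by (auto intro!: power_mono)
    ultimately have "(R * norm (x - y))\<^sup>2 \<le> (norm (Q \<zeta>))\<^sup>2"
      using mult_nonneg_nonneg[of "R\<^sup>2 - (norm x)\<^sup>2" "R\<^sup>2 - (norm y)\<^sup>2"] by linarith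
    then have "R * norm (x - y) \<le> norm (Q \<zeta>)" by (rule power2_le_imp_le) simp
    then have le: "R * norm (\<zeta> - w) \<le> norm (Q \<zeta>)" by (simp add: x_def y_def)
    have pos: "norm (\<zeta> - w) > 0" "norm (Q \<zeta>) > 0" "norm (\<zeta> - cnj w) > 0"
      using False nz[of \<zeta>] \<zeta> by auto
    have "norm (\<zeta> - cnj w) * R / norm (Q \<zeta>) \<le> norm (\<zeta> - cnj w) * R / (R * norm (\<zeta> - w))"
      using le pos R by (intro divide_left_mono) auto
    also have "\<dots> = norm (\<zeta> - cnj w) / norm (\<zeta> - w)" using R by simp
    finally have "ln (norm (\<zeta> - cnj w) * R / norm (Q \<zeta>)) \<le> ln (norm (\<zeta> - cnj w) / norm (\<zeta> - w))"
      using pos R by (intro ln_mono) auto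
    then show ?thesis
      unfolding eq half_plane_kernel_eq[OF Im\<zeta> Imw False] Q_def by (rule ennreal_leI)
  qed
qed

text \<open>Sweeping the kernel in either variable has the same effect: if both points are in the disc, the
  closed form is symmetric, and otherwise the kernel does not change.\<close>

lemma sweep_fst_eq_sweep_snd_half_plane_kernel:
  assumes disc: "cball c R \<subseteq> {z. Im z > 0}"
  shows "sweep_fst c R half_plane_kernel = sweep_snd c R half_plane_kernel"
proof
  fix p :: "complex \<times> complex"
  obtain z w where p: "p = (z, w)" by (cases p)
  have snd: "sweep_snd c R half_plane_kernel (z, w) = sweep c R (\<lambda>x. half_plane_kernel (x, z)) w"
    by (simp add: sweep_snd_def half_plane_kernel_commute[of z])
  have fst: "sweep_fst c R half_plane_kernel (z, w) = sweep c R (\<lambda>x. half_plane_kernel (x, w)) z"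
    by (simp add: sweep_fst_def)
  consider "z \<notin> ball c R" | "w \<notin> ball c R" | "z \<in> ball c R" "w \<in> ball c R" by blast
  then show "sweep_fst c R half_plane_kernel p = sweep_snd c R half_plane_kernel p"
  proof cases
    case 1
    have "sweep c R (\<lambda>x. half_plane_kernel (x, z)) w = half_plane_kernel (w, z)"
      by (cases "w \<in> ball c R") (simp_all add: sweep_outside sweep_half_plane_kernel_outside[OF disc _ 1] del: mem_ball)
    then show ?thesis
      using 1 by (simp add: p fst snd sweep_outside half_plane_kernel_commute[of w] del: mem_ball)
  next
    case 2
    have "sweep c R (\<lambda>x. half_plane_kernel (x, w)) z = half_plane_kernel (z, w)"
      by (cases "z \<in> ball c R") (simp_all add: sweep_outside sweep_half_plane_kernel_outside[OF disc _ 2] del: mem_ball)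
    then show ?thesis
      using 2 by (simp add: p fst snd sweep_outside half_plane_kernel_commute[of w] del: mem_ball)
  next
    case 3
    have "norm (of_real (R\<^sup>2) - cnj (w - c) * (z - c)) = norm (cnj (of_real (R\<^sup>2) - cnj (w - c) * (z - c)))"
      by (rule complex_mod_cnj[symmetric])
    also have "cnj (of_real (R\<^sup>2) - cnj (w - c) * (z - c)) = of_real (R\<^sup>2) - cnj (z - c) * (w - c)"
      by (simp add: mult.commute)
    finally show ?thesis
      unfolding p fst snd sweep_half_plane_kernel_inside(1)[OF disc 3] sweep_half_plane_kernel_inside(1)[OF disc 3(2,1)]
        norm_diff_cnj_commute[of z w] by simp
  qed
qed

lemma sweep_fst_half_plane_kernel_le:
  assumes disc: "cball c R \<subseteq> {z. Im z > 0}"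
  shows "sweep_fst c R half_plane_kernel \<le> half_plane_kernel"
proof (rule le_funI)
  fix p :: "complex \<times> complex"
  obtain z w where p: "p = (z, w)" by (cases p)
  show "sweep_fst c R half_plane_kernel p \<le> half_plane_kernel p"
    unfolding p sweep_fst_def
    using sweep_half_plane_kernel_outside[OF disc, of z w] sweep_half_plane_kernel_inside(2)[OF disc, of z w]
    by (cases "z \<in> ball c R"; cases "w \<in> ball c R") (simp_all add: sweep_outside del: mem_ball)
qed

lemma sweep_half_plane_kernel_finite:
  assumes disc: "cball c R \<subseteq> {z. Im z > 0}" and \<zeta>: "\<zeta> \<in> ball c R"
  shows "sweep c R (\<lambda>z. half_plane_kernel (z, w)) \<zeta> < \<infinity>"
proof (cases "w \<in> ball c R")
  case True
  then show ?thesis by (simp add: sweep_half_plane_kernel_inside(1)[OF disc \<zeta>])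
next
  case False
  then have "half_plane_kernel (\<zeta>, w) < \<infinity>" using \<zeta> by (auto simp: half_plane_kernel_def)
  then show ?thesis by (simp add: sweep_half_plane_kernel_outside[OF disc \<zeta> False])
qed

subsection \<open>Words of sweeps\<close>

primrec sweeps_fst :: "(complex \<times> real) list \<Rightarrow> (complex \<times> complex \<Rightarrow> ennreal) \<Rightarrow> complex \<times> complex \<Rightarrow> ennreal" where
  "sweeps_fst [] K = K"
| "sweeps_fst (b # V) K = sweep_fst (fst b) (snd b) (sweeps_fst V K)"

primrec sweeps_snd :: "(complex \<times> real) list \<Rightarrow> (complex \<times> complex \<Rightarrow> ennreal) \<Rightarrow> complex \<times> complex \<Rightarrow> ennreal" where
  "sweeps_snd [] K = K"
| "sweeps_snd (b # V) K = sweep_snd (fst b) (snd b) (sweeps_snd V K)"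

lemma sweeps_fst_measurable [measurable]:
  "K \<in> borel_measurable (borel \<Otimes>\<^sub>M borel) \<Longrightarrow> sweeps_fst V K \<in> borel_measurable (borel \<Otimes>\<^sub>M borel)"
  by (induction V) auto

lemma sweeps_snd_measurable [measurable]:
  "K \<in> borel_measurable (borel \<Otimes>\<^sub>M borel) \<Longrightarrow> sweeps_snd V K \<in> borel_measurable (borel \<Otimes>\<^sub>M borel)"
  by (induction V) auto

lemma sweep_fst_mono: "K \<le> K' \<Longrightarrow> sweep_fst c R K \<le> sweep_fst c R K'"
  by (auto simp: le_fun_def sweep_fst_def intro!: sweep_mono)

lemma sweep_snd_mono: "K \<le> K' \<Longrightarrow> sweep_snd c R K \<le> sweep_snd c R K'"
  by (auto simp: le_fun_def sweep_snd_def intro!: sweep_mono)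

lemma sweeps_snd_mono: "K \<le> K' \<Longrightarrow> sweeps_snd V K \<le> sweeps_snd V K'"
  by (induction V) (auto intro: sweep_snd_mono)

lemma sweeps_snd_append: "sweeps_snd (U @ V) K = sweeps_snd U (sweeps_snd V K)"
  by (induction U) auto

lemma sweep_fst_sweeps_snd_commute:
  assumes "K \<in> borel_measurable (borel \<Otimes>\<^sub>M borel)"
  shows "sweep_fst c R (sweeps_snd V K) = sweeps_snd V (sweep_fst c R K)"
  using assms by (induction V) (simp_all add: sweep_fst_snd_commute sweeps_snd_measurable)

definition upper_discs :: "(complex \<times> real) set" where
  "upper_discs = {b. cball (fst b) (snd b) \<subseteq> {z. Im z > 0}}"

text \<open>Sweeping first in one variable over a sequence of discs amounts to sweeping in the other
  variable over the reversed sequence: each new sweep is moved past the others to the kernel, where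
  it changes its variable.\<close>

lemma sweeps_transpose:
  assumes "set V \<subseteq> upper_discs"
  shows "sweeps_fst V half_plane_kernel = sweeps_snd (rev V) half_plane_kernel"
  using assms
proof (induction V)
  case (Cons b V)
  then have b: "cball (fst b) (snd b) \<subseteq> {z. Im z > 0}" by (auto simp: upper_discs_def)
  have "sweeps_fst (b # V) half_plane_kernel
      = sweep_fst (fst b) (snd b) (sweeps_snd (rev V) half_plane_kernel)" using Cons by simp
  also have "\<dots> = sweeps_snd (rev V) (sweep_snd (fst b) (snd b) half_plane_kernel)"
    by (simp add: sweep_fst_sweeps_snd_commute sweep_fst_eq_sweep_snd_half_plane_kernel[OF b] half_plane_kernel_measurable)
  finally show ?case by (simp add: sweeps_snd_append)
qed simp

text \<open>That the swept kernels are still superharmonic follows from the transposition: the new sweep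
  commutes past the earlier ones and then acts on the kernel itself.\<close>

lemma sweep_fst_sweeps_fst_le:
  assumes "b \<in> upper_discs" "set V \<subseteq> upper_discs"
  shows "sweep_fst (fst b) (snd b) (sweeps_fst V half_plane_kernel) \<le> sweeps_fst V half_plane_kernel"
proof -
  have b: "cball (fst b) (snd b) \<subseteq> {z. Im z > 0}" using assms by (auto simp: upper_discs_def)
  have "sweep_fst (fst b) (snd b) (sweeps_fst V half_plane_kernel)
      = sweeps_snd (rev V) (sweep_fst (fst b) (snd b) half_plane_kernel)"
    by (simp add: sweeps_transpose[OF assms(2)] sweep_fst_sweeps_snd_commute half_plane_kernel_measurable)
  also have "\<dots> \<le> sweeps_snd (rev V) half_plane_kernel"
    by (intro sweeps_snd_mono sweep_fst_half_plane_kernel_le b)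
  also have "\<dots> = sweeps_fst V half_plane_kernel" by (simp add: sweeps_transpose[OF assms(2)])
  finally show ?thesis .
qed

subsection \<open>The greatest harmonic minorant as a limit of sweeps\<close>

text \<open>Two forms of harmonicity. The first is what sweeping needs of a given harmonic minorant, the
  Poisson formula on every closed disc of the domain; the second is what can be read off from a
  limit that is known only on the discs of a covering.\<close>

definition Re_on_discs :: "complex set \<Rightarrow> (complex \<Rightarrow> real) \<Rightarrow> bool" where
  "Re_on_discs D a \<longleftrightarrow> (\<forall>c R. cball c R \<subseteq> D \<longrightarrow>
     (\<exists>F. F holomorphic_on cball c R \<and> (\<forall>z\<in>cball c R. a z = Re (F z))))"

definition locally_Re :: "complex set \<Rightarrow> (complex \<Rightarrow> real) \<Rightarrow> bool" where
  "locally_Re D a \<longleftrightarrow> (\<forall>z\<in>D. \<exists>c R F. z \<in> ball c R \<and> ball c R \<subseteq> D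
     \<and> F holomorphic_on ball c R \<and> (\<forall>x\<in>ball c R. a x = Re (F x)))"

text \<open>A harmonic function equals its own sweep, so that sweeping preserves being a majorant of it.\<close>

lemma sweep_ge_harmonic:
  assumes a: "Re_on_discs D a" and disc: "cball c R \<subseteq> D"
    and nonneg: "\<And>z. z \<in> D \<Longrightarrow> 0 \<le> a z" and le: "\<And>z. z \<in> D \<Longrightarrow> ennreal (a z) \<le> u z"
    and [measurable]: "u \<in> borel_measurable borel" and \<zeta>: "\<zeta> \<in> D"
  shows "ennreal (a \<zeta>) \<le> sweep c R u \<zeta>"
proof (cases "\<zeta> \<in> ball c R")
  case False
  then show ?thesis using le[OF \<zeta>] by (simp add: sweep_outside del: mem_ball)
next
  case True
  have R: "R > 0" by (rule ball_radius_pos[OF True])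
  obtain F where F: "F holomorphic_on cball c R" "\<And>z. z \<in> cball c R \<Longrightarrow> a z = Re (F z)"
    using a disc unfolding Re_on_discs_def by blast
  have circ: "circlepath c R t \<in> cball c R" for t
    using R norm_circlepath[of R c t] by (simp add: dist_norm norm_minus_commute[of c])
  have "ennreal (a \<zeta>) = ennreal (Re (F \<zeta>))" using F(2) True by simp
  also have "\<dots> = (\<integral>\<^sup>+t. ennreal (poisson c R \<zeta> t) * ennreal (Re (F (circlepath c R t))) \<partial>unit_measure)"
  proof (rule nn_integral_poisson_Re[OF F(1) True, symmetric])
    fix z assume "norm (z - c) = R"
    then have "z \<in> cball c R" by (simp add: dist_norm norm_minus_commute)
    then show "0 \<le> Re (F z)" using F(2) nonneg disc by force
  qed
  also have "\<dots> \<le> (\<integral>\<^sup>+t. ennreal (poisson c R \<zeta> t) * u (circlepath c R t) \<partial>unit_measure)"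
  proof (intro nn_integral_mono mult_left_mono)
    fix t
    have "circlepath c R t \<in> D" using circ disc by blast
    from le[OF this] show "ennreal (Re (F (circlepath c R t))) \<le> u (circlepath c R t)"
      using F(2)[OF circ] by simp
  qed auto
  also have "\<dots> = sweep c R u \<zeta>" using True by (simp add: sweep_inside)
  finally show ?thesis .
qed

lemma kernel_sections_measurable:
  assumes "K \<in> borel_measurable (borel \<Otimes>\<^sub>M (borel :: complex measure))"
  shows "(\<lambda>z. K (z, w)) \<in> borel_measurable borel" "(\<lambda>w. K (z, w)) \<in> borel_measurable borel"
proof -
  have "(\<lambda>z. (z, w)) \<in> borel \<rightarrow>\<^sub>M borel \<Otimes>\<^sub>M (borel :: complex measure)" by measurable
  from measurable_compose[OF this assms] show "(\<lambda>z. K (z, w)) \<in> borel_measurable borel" .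
  have "(\<lambda>w. (z, w)) \<in> borel \<rightarrow>\<^sub>M borel \<Otimes>\<^sub>M (borel :: complex measure)" by measurable
  from measurable_compose[OF this assms] show "(\<lambda>w. K (z, w)) \<in> borel_measurable borel" .
qed

lemma sweeps_fst_ge_harmonic:
  assumes a: "Re_on_discs D a" and V: "\<And>b. b \<in> set V \<Longrightarrow> cball (fst b) (snd b) \<subseteq> D"
    and nonneg: "\<And>z. z \<in> D \<Longrightarrow> 0 \<le> a z" and le: "\<And>z. z \<in> D \<Longrightarrow> ennreal (a z) \<le> K (z, w)"
    and K: "K \<in> borel_measurable (borel \<Otimes>\<^sub>M borel)" and "z \<in> D"
  shows "ennreal (a z) \<le> sweeps_fst V K (z, w)"
  using V \<open>z \<in> D\<close>
proof (induction V arbitrary: z)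
  case (Cons b V)
  have "ennreal (a z) \<le> sweep (fst b) (snd b) (\<lambda>z. sweeps_fst V K (z, w)) z"
    by (rule sweep_ge_harmonic[OF a _ nonneg])
      (use Cons kernel_sections_measurable(1)[OF sweeps_fst_measurable[OF K]] in auto)
  then show ?case by (simp add: sweep_fst_def)
qed (simp add: le)

lemma sweeps_snd_ge_harmonic:
  assumes a: "Re_on_discs D a" and V: "\<And>b. b \<in> set V \<Longrightarrow> cball (fst b) (snd b) \<subseteq> D"
    and nonneg: "\<And>w. w \<in> D \<Longrightarrow> 0 \<le> a w" and le: "\<And>w. w \<in> D \<Longrightarrow> ennreal (a w) \<le> K (z, w)"
    and K: "K \<in> borel_measurable (borel \<Otimes>\<^sub>M borel)" and "w \<in> D"
  shows "ennreal (a w) \<le> sweeps_snd V K (z, w)"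
  using V \<open>w \<in> D\<close>
proof (induction V arbitrary: w)
  case (Cons b V)
  have "ennreal (a w) \<le> sweep (fst b) (snd b) (\<lambda>w. sweeps_snd V K (z, w)) w"
    by (rule sweep_ge_harmonic[OF a _ nonneg])
      (use Cons kernel_sections_measurable(2)[OF sweeps_snd_measurable[OF K]] in auto)
  then show ?case by (simp add: sweep_snd_def)
qed (simp add: le)

lemma obtain_recurrent_discs:
  assumes "open D" "D \<noteq> {}"
  obtains B :: "nat \<Rightarrow> complex \<times> real" where
    "\<And>n. cball (fst (B n)) (snd (B n)) \<subseteq> D"
    "\<And>z. z \<in> D \<Longrightarrow> \<exists>n. z \<in> ball (fst (B n)) (snd (B n))"
    "\<And>m n. \<exists>k\<ge>n. B k = B m"
proof -
  define \<F> where "\<F> = {b. cball (fst b) (snd b) \<subseteq> D}"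
  obtain F' where F': "F' \<subseteq> (\<lambda>b. ball (fst b) (snd b)) ` \<F>" "countable F'" "\<Union>F' = (\<Union>b\<in>\<F>. ball (fst b) (snd b))"
    using Lindelof[of "(\<lambda>b. ball (fst b) (snd b)) ` \<F>"] by auto
  obtain C where C: "C \<subseteq> \<F>" "F' = (\<lambda>b. ball (fst b) (snd b)) ` C" "inj_on (\<lambda>b. ball (fst b) (snd b)) C"
    using F'(1) by (meson subset_image_inj)
  have countC: "countable C" using F'(2) C(2,3) countable_image_inj_on by blast
  have cover: "\<exists>b\<in>C. z \<in> ball (fst b) (snd b)" if z: "z \<in> D" for z
  proof -
    obtain e where "e > 0" "cball z e \<subseteq> D" using assms(1) z open_contains_cball by blast
    then have "(z, e) \<in> \<F>" "z \<in> ball (fst (z, e)) (snd (z, e))" by (auto simp: \<F>_def)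
    then have "z \<in> (\<Union>b\<in>\<F>. ball (fst b) (snd b))" by blast
    then show ?thesis unfolding F'(3)[symmetric] C(2) by blast
  qed
  have "C \<noteq> {}" using cover assms(2) by blast
  define B where "B n = from_nat_into C (fst (prod_decode n))" for n
  show ?thesis
  proof
    show "cball (fst (B n)) (snd (B n)) \<subseteq> D" for n
      using from_nat_into[OF \<open>C \<noteq> {}\<close>, of "fst (prod_decode n)"] C(1) by (auto simp: B_def \<F>_def)
    show "\<exists>n. z \<in> ball (fst (B n)) (snd (B n))" if z: "z \<in> D" for z
    proof -
      obtain b where b: "b \<in> C" "z \<in> ball (fst b) (snd b)" using cover[OF z] by blast
      obtain m where "from_nat_into C m = b" using from_nat_into_surj[OF countC b(1)] by blast
      then have "B (prod_encode (m, 0)) = b" by (simp add: B_def)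
      with b(2) show ?thesis by metis
    qed
    show "\<exists>k\<ge>n. B k = B m" for m n
      by (rule exI[of _ "prod_encode (fst (prod_decode m), n)"]) (simp add: B_def le_prod_encode_2)
  qed
qed

text \<open>The successive sweeps decrease, and each of them recurs, so by monotone convergence their limit is
  reproduced by every single sweep. It thus is a Poisson integral on each disc of the covering.\<close>

lemma swept_limit_locally_Re:
  assumes B: "\<And>n. cball (fst (B n)) (snd (B n)) \<subseteq> D" "\<forall>z\<in>D. \<exists>n. z \<in> ball (fst (B n)) (snd (B n))"
      "\<And>m n. \<exists>k\<ge>n. B k = B m" and D: "D \<subseteq> {z. Im z > 0}"
    and V: "\<And>n. V (Suc n) = B n # V n" "V 0 = []"
  defines "k \<equiv> \<lambda>p. INF n. sweeps_fst (V n) half_plane_kernel p"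
  shows "\<And>z w. z \<in> D \<Longrightarrow> k (z, w) < \<infinity>"
    and "\<And>w. locally_Re D (\<lambda>z. enn2real (k (z, w)))"
    and "k \<le> half_plane_kernel" and "k \<in> borel_measurable (borel \<Otimes>\<^sub>M borel)"
proof -
  define u where "u n = sweeps_fst (V n) half_plane_kernel" for n
  have k: "k p = (INF n. u n p)" for p by (simp add: k_def u_def)
  have um [measurable]: "u n \<in> borel_measurable (borel \<Otimes>\<^sub>M borel)" for n unfolding u_def by measurable
  have km [measurable]: "k \<in> borel_measurable (borel \<Otimes>\<^sub>M borel)"
    unfolding k_def by (rule borel_measurable_INF) measurable
  then show "k \<in> borel_measurable (borel \<Otimes>\<^sub>M borel)" .
  have Bu: "B n \<in> upper_discs" for n using B(1)[of n] D by (auto simp: upper_discs_def)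
  have Vu: "set (V n) \<subseteq> upper_discs" for n by (induction n) (auto simp: V Bu)
  have u_Suc: "u (Suc n) = sweep_fst (fst (B n)) (snd (B n)) (u n)" for n by (simp add: u_def V)
  have sweep_u: "sweep_fst (fst (B m)) (snd (B m)) (u n) \<le> u n" for m n
    unfolding u_def by (rule sweep_fst_sweeps_fst_le[OF Bu Vu])
  have dec: "decseq u" by (rule decseq_SucI) (simp add: u_Suc sweep_u)
  have u0: "u 0 = half_plane_kernel" by (simp add: u_def V)
  have ku: "k p \<le> u n p" for p n unfolding k by (rule INF_lower) simp
  show "k \<le> half_plane_kernel" using ku[of _ 0] by (simp add: le_fun_def u0)
  have inv: "sweep (fst (B m)) (snd (B m)) (\<lambda>z. k (z, w)) \<zeta> = k (\<zeta>, w)"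
    and fin: "k (\<zeta>, w) < \<infinity>"
    if \<zeta>: "\<zeta> \<in> ball (fst (B m)) (snd (B m))" for m \<zeta> w
  proof -
    let ?H = "harmonic_measure (fst (B m)) (snd (B m)) \<zeta>"
    have fin0: "sweep (fst (B m)) (snd (B m)) (\<lambda>z. u 0 (z, w)) \<zeta> < \<infinity>"
      unfolding u0 using Bu[of m] \<zeta> by (intro sweep_half_plane_kernel_finite) (auto simp: upper_discs_def)
    have [measurable]: "(\<lambda>z. u n (z, w)) \<in> borel_measurable ?H" for n
      using kernel_sections_measurable(1)[OF um[of n], of w] by (simp cong: measurable_cong_sets)
    have "sweep (fst (B m)) (snd (B m)) (\<lambda>z. k (z, w)) \<zeta> = (\<integral>\<^sup>+z. (INF n. u n (z, w)) \<partial>?H)"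
      by (simp add: sweep_def k)
    also have "\<dots> = (INF n. \<integral>\<^sup>+z. u n (z, w) \<partial>?H)"
    proof (rule nn_integral_monotone_convergence_INF_decseq)
      show "decseq (\<lambda>n z. u n (z, w))" 
        using decseq_SucD[OF dec] unfolding decseq_Suc_iff by (simp add: le_fun_def)
      show "(\<integral>\<^sup>+z. u 0 (z, w) \<partial>?H) < \<infinity>" using fin0 by (simp add: sweep_def)
    qed measurable
    also have "\<dots> = (INF n. sweep_fst (fst (B m)) (snd (B m)) (u n) (\<zeta>, w))"
      by (simp add: sweep_fst_def sweep_def)
    also have "\<dots> = k (\<zeta>, w)"
    proof (rule antisym)
      show "(INF n. sweep_fst (fst (B m)) (snd (B m)) (u n) (\<zeta>, w)) \<le> k (\<zeta>, w)"
        unfolding k using le_funD[OF sweep_u] by (intro INF_mono) blast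
      show "k (\<zeta>, w) \<le> (INF n. sweep_fst (fst (B m)) (snd (B m)) (u n) (\<zeta>, w))"
      proof (rule INF_greatest)
        fix n
        \<comment> \<open>the next sweep over the disc \<open>B m\<close> acts on a smaller function than the \<open>n\<close>-th one\<close>
        obtain j where j: "j \<ge> n" "B j = B m" using B(3) by blast
        have "k (\<zeta>, w) \<le> u (Suc j) (\<zeta>, w)" by (rule ku)
        also have "\<dots> = sweep_fst (fst (B m)) (snd (B m)) (u j) (\<zeta>, w)" by (simp add: u_Suc j(2))
        also have "\<dots> \<le> sweep_fst (fst (B m)) (snd (B m)) (u n) (\<zeta>, w)"
          using sweep_fst_mono[of "u j" "u n"] decseqD[OF dec j(1)] by (auto simp: le_fun_def)
        finally show "k (\<zeta>, w) \<le> sweep_fst (fst (B m)) (snd (B m)) (u n) (\<zeta>, w)" .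
      qed
    qed
    finally show inv: "sweep (fst (B m)) (snd (B m)) (\<lambda>z. k (z, w)) \<zeta> = k (\<zeta>, w)" .
    have "k (\<zeta>, w) \<le> sweep (fst (B m)) (snd (B m)) (\<lambda>z. u 0 (z, w)) \<zeta>"
      unfolding inv[symmetric] by (rule sweep_mono) (rule ku)
    with fin0 show "k (\<zeta>, w) < \<infinity>" by simp
  qed
  show "k (z, w) < \<infinity>" if "z \<in> D" for z w
    using B(2) that fin by blast
  show "locally_Re D (\<lambda>z. enn2real (k (z, w)))" for w
    unfolding locally_Re_def
  proof
    fix z assume "z \<in> D"
    then obtain m where z: "z \<in> ball (fst (B m)) (snd (B m))" using B(2) by blast
    define c where "c = fst (B m)"
    define R where "R = snd (B m)"
    have R: "R > 0" using ball_radius_pos[OF z] by (simp add: R_def)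
    have cb: "c \<in> ball c R" using R by simp
    have kw [measurable]: "(\<lambda>z. k (z, w)) \<in> borel_measurable borel" by (rule kernel_sections_measurable(1)[OF km])
    have kc: "(\<lambda>t. k (circlepath c R t, w)) \<in> borel_measurable unit_measure"
      by (rule measurable_compose[OF circlepath_measurable_unit kw])
    define v where "v t = enn2real (k (circlepath c R t, w))" for t
    have vm [measurable]: "v \<in> borel_measurable unit_measure" unfolding v_def using kc by measurable
    have "(\<integral>\<^sup>+t. k (circlepath c R t, w) \<partial>unit_measure) = k (c, w)"
      using inv[of c m w] cb R kw by (simp add: sweep_inside c_def R_def poisson_center)
    also have "\<dots> < \<infinity>" using fin[of c m w] cb by (simp add: c_def R_def)
    finally have ifin: "(\<integral>\<^sup>+t. k (circlepath c R t, w) \<partial>unit_measure) < \<infinity>" .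
    have ae: "AE t in unit_measure. k (circlepath c R t, w) = ennreal (v t)"
      using nn_integral_PInf_AE[OF kc] ifin
      by (auto simp: v_def less_top elim!: eventually_mono)
    have "integrable unit_measure v"
    proof (rule integrableI_nonneg)
      have "(\<integral>\<^sup>+t. ennreal (v t) \<partial>unit_measure) = (\<integral>\<^sup>+t. k (circlepath c R t, w) \<partial>unit_measure)"
        using ae by (intro nn_integral_cong_AE) auto
      then show "(\<integral>\<^sup>+t. ennreal (v t) \<partial>unit_measure) < \<infinity>" using ifin by simp
    qed (auto simp: v_def)
    then obtain F where F: "F holomorphic_on ball c R"
      "\<And>\<zeta>. \<zeta> \<in> ball c R \<Longrightarrow> Re (F \<zeta>) = (LINT t|unit_measure. poisson c R \<zeta> t * v t)"
      using poisson_integral_holomorphic[OF R] by blast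
    have "enn2real (k (\<zeta>, w)) = Re (F \<zeta>)" if \<zeta>: "\<zeta> \<in> ball c R" for \<zeta>
    proof -
      have "k (\<zeta>, w) = (\<integral>\<^sup>+t. ennreal (poisson c R \<zeta> t) * k (circlepath c R t, w) \<partial>unit_measure)"
        using inv[of \<zeta> m w] \<zeta> kw by (simp add: sweep_inside c_def R_def)
      also have "\<dots> = (\<integral>\<^sup>+t. ennreal (poisson c R \<zeta> t * v t) \<partial>unit_measure)"
      proof (rule nn_integral_cong_AE)
        have "0 \<le> poisson c R \<zeta> t" for t using poisson_pos[OF \<zeta>, of t] by simp
        then show "AE t in unit_measure. ennreal (poisson c R \<zeta> t) * k (circlepath c R t, w) = ennreal (poisson c R \<zeta> t * v t)"
          using ae by (auto simp: v_def ennreal_mult elim!: eventually_mono)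
      qed
      finally have "enn2real (k (\<zeta>, w)) = enn2real (\<integral>\<^sup>+t. ennreal (poisson c R \<zeta> t * v t) \<partial>unit_measure)" by simp
      also have "\<dots> = (LINT t|unit_measure. poisson c R \<zeta> t * v t)"
        using poisson_pos[OF \<zeta>] by (intro integral_eq_nn_integral[symmetric]) (auto simp: v_def less_imp_le)
      finally show ?thesis using F(2)[OF \<zeta>] by simp
    qed
    moreover have "ball c R \<subseteq> D" using B(1)[of m] ball_subset_cball by (auto simp: c_def R_def)
    ultimately show "\<exists>c R F. z \<in> ball c R \<and> ball c R \<subseteq> D \<and> F holomorphic_on ball c R
        \<and> (\<forall>x\<in>ball c R. enn2real (k (x, w)) = Re (F x))"
      using z F(1) by (intro exI[of _ c] exI[of _ R] exI[of _ F]) (simp add: c_def R_def)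
  qed
qed

text \<open>Symmetry: sweeping in the first variable over each of countably many discs infinitely often
  produces the greatest harmonic minorant \<open>a(\<cdot>, w)\<close> of the kernel. By transposition the same swept
  kernels arise by sweeping in the second variable, hence also lie above \<open>a(\<cdot>, z)\<close> at \<open>w\<close>.\<close>

theorem greatest_harmonic_minorant_symmetric:
  fixes a :: "complex \<Rightarrow> complex \<Rightarrow> real"
  assumes D: "open D" "D \<subseteq> {z. Im z > 0}"
    and harm: "\<And>w. w \<in> D \<Longrightarrow> Re_on_discs D (\<lambda>z. a z w)"
    and nonneg: "\<And>z w. z \<in> D \<Longrightarrow> w \<in> D \<Longrightarrow> 0 \<le> a z w"
    and le: "\<And>z w. z \<in> D \<Longrightarrow> w \<in> D \<Longrightarrow> ennreal (a z w) \<le> half_plane_kernel (z, w)"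
    and greatest: "\<And>w h z. w \<in> D \<Longrightarrow> locally_Re D h \<Longrightarrow>
      (\<And>x. x \<in> D \<Longrightarrow> x \<noteq> w \<Longrightarrow> 0 \<le> h x \<and> ennreal (h x) \<le> half_plane_kernel (x, w)) \<Longrightarrow> z \<in> D \<Longrightarrow> h z \<le> a z w"
  shows "\<And>z w. z \<in> D \<Longrightarrow> w \<in> D \<Longrightarrow> a z w = a w z"
    and "\<exists>K \<in> borel_measurable (borel \<Otimes>\<^sub>M borel). \<forall>z\<in>D. \<forall>w\<in>D. K (z, w) = ennreal (a z w)"
proof -
  have *: "(\<forall>z\<in>D. \<forall>w\<in>D. a z w = a w z) \<and>
    (\<exists>K \<in> borel_measurable (borel \<Otimes>\<^sub>M borel). \<forall>z\<in>D. \<forall>w\<in>D. K (z, w) = ennreal (a z w))"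
  proof (cases "D = {}")
    case True
    have "(\<lambda>_. 0 :: ennreal) \<in> borel_measurable (borel \<Otimes>\<^sub>M (borel :: complex measure) :: (complex \<times> complex) measure)"
      by simp
    with True show ?thesis by blast
  next
    case False
    obtain B where B: "\<And>n. cball (fst (B n)) (snd (B n)) \<subseteq> D" "\<forall>z\<in>D. \<exists>n. z \<in> ball (fst (B n)) (snd (B n))"
      "\<And>m n :: nat. \<exists>k\<ge>n. B k = B m"
      using obtain_recurrent_discs[OF D(1) False] by metis
    define V where "V = rec_nat [] (\<lambda>n U. B n # U)"
    have V: "\<And>n. V (Suc n) = B n # V n" "V 0 = []" by (simp_all add: V_def)
    define k where "k p = (INF n. sweeps_fst (V n) half_plane_kernel p)" for p
    note K = swept_limit_locally_Re[OF B D(2) V, folded k_def]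
    have VD: "cball (fst b) (snd b) \<subseteq> D" if "b \<in> set (V n)" for b n
      using that B(1) by (induction n) (auto simp: V simp del: mem_cball)
    then have Vu: "set (V n) \<subseteq> upper_discs" for n using D(2) by (fastforce simp: upper_discs_def)
    have ak: "k (z, w) = ennreal (a z w)" if zw: "z \<in> D" "w \<in> D" for z w
    proof (rule antisym)
      have "enn2real (k (z, w)) \<le> a z w"
      proof (rule greatest[OF zw(2) K(2) _ zw(1)])
        fix x assume "x \<in> D"
        then show "0 \<le> enn2real (k (x, w)) \<and> ennreal (enn2real (k (x, w))) \<le> half_plane_kernel (x, w)"
          using K(1)[of x w] K(3) by (simp add: le_fun_def less_top)
      qed
      then have "ennreal (enn2real (k (z, w))) \<le> ennreal (a z w)" by (rule ennreal_leI)
      then show "k (z, w) \<le> ennreal (a z w)" using K(1)[OF zw(1), of w] by (simp add: less_top)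
      show "ennreal (a z w) \<le> k (z, w)"
        unfolding k_def
      proof (rule INF_greatest)
        fix n
        show "ennreal (a z w) \<le> sweeps_fst (V n) half_plane_kernel (z, w)"
          by (rule sweeps_fst_ge_harmonic[OF harm[OF zw(2)]])
            (use VD nonneg le zw in \<open>auto intro: half_plane_kernel_measurable\<close>)
      qed
    qed
    have sym: "a w z \<le> a z w" if zw: "z \<in> D" "w \<in> D" for z w
    proof -
      have "ennreal (a w z) \<le> k (z, w)"
        unfolding k_def
      proof (rule INF_greatest)
        fix n
        have "ennreal (a w z) \<le> sweeps_snd (rev (V n)) half_plane_kernel (z, w)"
          by (rule sweeps_snd_ge_harmonic[OF harm[OF zw(1)]])
            (use VD nonneg le zw in \<open>auto intro: half_plane_kernel_measurable simp: half_plane_kernel_commute[of z]\<close>)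
        then show "ennreal (a w z) \<le> sweeps_fst (V n) half_plane_kernel (z, w)"
          by (simp add: sweeps_transpose[OF Vu])
      qed
      then show ?thesis using ak[OF zw] nonneg[OF zw] by simp
    qed
    show ?thesis
    proof (intro conjI ballI bexI[of _ k])
      show "a z w = a w z" if "z \<in> D" "w \<in> D" for z w using sym that by (meson antisym)
      show "k (z, w) = ennreal (a z w)" if "z \<in> D" "w \<in> D" for z w by (rule ak[OF that])
      show "k \<in> borel_measurable (borel \<Otimes>\<^sub>M borel)" using K(4) by (simp add: k_def[abs_def])
    qed
  qed
  show "\<And>z w. z \<in> D \<Longrightarrow> w \<in> D \<Longrightarrow> a z w = a w z" using * by blast
  show "\<exists>K \<in> borel_measurable (borel \<Otimes>\<^sub>M borel). \<forall>z\<in>D. \<forall>w\<in>D. K (z, w) = ennreal (a z w)" using * by blast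
qed

section \<open>Harmonic functions as real parts of holomorphic functions\<close>

definition to_complex :: "real^2 \<Rightarrow> complex" where
  "to_complex x = Complex (x $ 1) (x $ 2)"

definition of_complex :: "complex \<Rightarrow> real^2" where
  "of_complex z = (\<chi> i. if i = 1 then Re z else Im z)"

lemma of_complex_nth [simp]: "of_complex z $ 1 = Re z" "of_complex z $ 2 = Im z"
  by (simp_all add: of_complex_def)

lemma to_complex_sel [simp]: "Re (to_complex x) = x $ 1" "Im (to_complex x) = x $ 2"
  by (simp_all add: to_complex_def)

lemma to_of_complex [simp]: "to_complex (of_complex z) = z"
  by (simp add: complex_eq_iff)

lemma of_to_complex [simp]: "of_complex (to_complex x) = x"
  by (simp add: vec_eq_iff forall_2)

lemma norm_to_complex_diff: "norm (to_complex x - to_complex y) = norm (x - y)"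
  by (simp add: cmod_def norm_vec_def L2_set_def UNIV_2)

lemma bounded_linear_to_complex: "bounded_linear to_complex"
proof
  show "\<exists>K. \<forall>x. norm (to_complex x) \<le> norm x * K"
    by (intro exI[of _ 1]) (simp add: cmod_def norm_vec_def L2_set_def UNIV_2)
qed (simp_all add: complex_eq_iff)

lemma bounded_linear_of_complex: "bounded_linear of_complex"
proof
  show "\<exists>K. \<forall>x. norm (of_complex x) \<le> norm x * K"
    by (intro exI[of _ 1]) (simp add: cmod_def norm_vec_def L2_set_def UNIV_2)
qed (simp_all add: vec_eq_iff forall_2)

lemma to_complex_axis [simp]: "to_complex (axis 1 1) = 1" "to_complex (axis 2 1) = \<i>"
  by (simp_all add: complex_eq_iff axis_def)

lemma to_complex_image_eq: "to_complex ` D = of_complex -` D"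
  by (auto intro: image_eqI[of _ _ "of_complex _"])

lemma open_to_complex_image:
  assumes "open D"
  shows "open (to_complex ` D)"
  unfolding to_complex_image_eq
  by (intro open_vimage assms linear_continuous_on bounded_linear_of_complex)

lemma to_complex_measurable [measurable]: "to_complex \<in> borel_measurable borel"
  by (intro borel_measurable_continuous_onI linear_continuous_on bounded_linear_to_complex)

lemma frechet_derivative_eq_partials:
  fixes f :: "real^2 \<Rightarrow> real"
  assumes "f differentiable (at x)"
  shows "frechet_derivative f (at x) v = v $ 1 * partial 1 f x + v $ 2 * partial 2 f x"
proof -
  have l: "linear (frechet_derivative f (at x))" by (rule linear_frechet_derivative[OF assms])
  have "v = v $ 1 *\<^sub>R axis 1 1 + v $ 2 *\<^sub>R axis 2 1" by (simp add: vec_eq_iff forall_2 axis_def)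
  then have "frechet_derivative f (at x) v = frechet_derivative f (at x) (v $ 1 *\<^sub>R axis 1 1 + v $ 2 *\<^sub>R axis 2 1)"
    by simp
  also have "\<dots> = v $ 1 * partial 1 f x + v $ 2 * partial 2 f x"
    by (simp add: linear_add[OF l] linear_cmul[OF l] partial_def)
  finally show ?thesis .
qed

text \<open>The mean value theorem, applied in each of the two directions.\<close>

lemma mixed_difference_mean_value:
  fixes f :: "real^2 \<Rightarrow> real"
  assumes "h > 0"
    and f: "\<And>s t. 0 \<le> s \<Longrightarrow> s \<le> h \<Longrightarrow> 0 \<le> t \<Longrightarrow> t \<le> h \<Longrightarrow>
      f differentiable (at (x + s *\<^sub>R axis i 1 + t *\<^sub>R axis j 1))
      \<and> partial i f differentiable (at (x + s *\<^sub>R axis i 1 + t *\<^sub>R axis j 1))"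
  shows "\<exists>\<xi> \<eta>. 0 < \<xi> \<and> \<xi> < h \<and> 0 < \<eta> \<and> \<eta> < h \<and>
    f (x + h *\<^sub>R axis i 1 + h *\<^sub>R axis j 1) - f (x + h *\<^sub>R axis i 1) - f (x + h *\<^sub>R axis j 1) + f x
      = h\<^sup>2 * partial j (partial i f) (x + \<xi> *\<^sub>R axis i 1 + \<eta> *\<^sub>R axis j 1)"
proof -
  let ?p = "\<lambda>s t. x + s *\<^sub>R axis i 1 + t *\<^sub>R axis j (1::real)"
  have p: "(x + t *\<^sub>R axis j 1) + s *\<^sub>R axis i 1 = ?p s t" for s t by (simp add: algebra_simps)
  have d: "((\<lambda>s. f (?p s t)) has_real_derivative partial i f (?p s t)) (at s)"
    if "0 \<le> s" "s \<le> h" "0 \<le> t" "t \<le> h" for s t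
    using has_derivative_partial_line[of f "x + t *\<^sub>R axis j 1" s i] f[OF that] by (simp add: p)
  have "\<exists>\<xi>>0. \<xi> < h \<and> (f (?p h h) - f (?p h 0)) - (f (?p 0 h) - f (?p 0 0))
      = (h - 0) * (partial i f (?p \<xi> h) - partial i f (?p \<xi> 0))"
    using assms(1) by (intro MVT2 DERIV_diff d) auto
  then obtain \<xi> where \<xi>: "0 < \<xi>" "\<xi> < h"
    "(f (?p h h) - f (?p h 0)) - (f (?p 0 h) - f (?p 0 0)) = (h - 0) * (partial i f (?p \<xi> h) - partial i f (?p \<xi> 0))"
    by blast
  have "\<exists>\<eta>>0. \<eta> < h \<and> partial i f (?p \<xi> h) - partial i f (?p \<xi> 0) = (h - 0) * partial j (partial i f) (?p \<xi> \<eta>)"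
  proof (rule MVT2[OF assms(1)])
    fix t assume "0 \<le> t" "t \<le> h"
    then show "((\<lambda>t. partial i f (?p \<xi> t)) has_real_derivative partial j (partial i f) (?p \<xi> t)) (at t)"
      using f[of \<xi> t] \<xi> by (intro has_derivative_partial_line) auto
  qed
  then obtain \<eta> where "0 < \<eta>" "\<eta> < h"
    "partial i f (?p \<xi> h) - partial i f (?p \<xi> 0) = (h - 0) * partial j (partial i f) (?p \<xi> \<eta>)" by blast
  with \<xi> show ?thesis
    by (intro exI[of _ \<xi>] exI[of _ \<eta>]) (simp add: power2_eq_square algebra_simps)
qed

text \<open>Both mixed derivatives are limits of the same second difference quotient.\<close>

lemma mixed_partials_commute:
  assumes "open D" "x \<in> D" and f: "C1_on D f" "\<And>i. C1_on D (partial i f)"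
  shows "partial 2 (partial 1 f) x = partial 1 (partial 2 f) x"
proof -
  obtain r where r: "r > 0" "ball x r \<subseteq> D" using assms(1,2) openE by blast
  define h where "h n = r / (2 * (real n + 2))" for n :: nat
  have h: "0 < h n" "2 * h n < r" for n
    using r by (auto simp: h_def field_simps intro!: add_pos_nonneg)
  have h0: "h \<longlonglongrightarrow> 0" unfolding h_def by real_asymp
  have close: "norm (s *\<^sub>R axis i (1::real) + t *\<^sub>R axis j 1 :: real^2) \<le> 2 * h n"
    if "0 \<le> s" "s \<le> h n" "0 \<le> t" "t \<le> h n" for s t n and i j :: 2
  proof -
    have "norm (s *\<^sub>R axis i (1::real) + t *\<^sub>R axis j 1 :: real^2)
        \<le> norm (s *\<^sub>R axis i (1::real) :: real^2) + norm (t *\<^sub>R axis j (1::real) :: real^2)"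
      by (rule norm_triangle_ineq)
    also have "\<dots> \<le> 2 * h n" using that by (simp add: norm_axis_1)
    finally show ?thesis .
  qed
  have inD: "x + s *\<^sub>R axis i 1 + t *\<^sub>R axis j 1 \<in> D"
    if "0 \<le> s" "s \<le> h n" "0 \<le> t" "t \<le> h n" for s t n and i j :: 2
  proof -
    have "dist x (x + v) = norm v" for v by (simp add: dist_norm)
    then have "dist x (x + (s *\<^sub>R axis i 1 + t *\<^sub>R axis j 1)) < r"
      using close[OF that, of i j] h(2)[of n] by (simp only:)
    then show ?thesis using r by (auto simp: add.assoc)
  qed
  have ex: "\<exists>q. (q \<longlonglongrightarrow> x) \<and> (\<forall>n. q n \<in> D \<and>
      f (x + h n *\<^sub>R axis i 1 + h n *\<^sub>R axis j 1) - f (x + h n *\<^sub>R axis i 1) - f (x + h n *\<^sub>R axis j 1) + f x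
      = (h n)\<^sup>2 * partial j (partial i f) (q n))" for i j :: 2
  proof -
    have "\<exists>\<xi> \<eta>. 0 < \<xi> \<and> \<xi> < h n \<and> 0 < \<eta> \<and> \<eta> < h n \<and>
      f (x + h n *\<^sub>R axis i 1 + h n *\<^sub>R axis j 1) - f (x + h n *\<^sub>R axis i 1) - f (x + h n *\<^sub>R axis j 1) + f x
        = (h n)\<^sup>2 * partial j (partial i f) (x + \<xi> *\<^sub>R axis i 1 + \<eta> *\<^sub>R axis j 1)" for n
      by (rule mixed_difference_mean_value[OF h(1)]) (use inD f in \<open>auto simp: C1_on_def\<close>)
    then obtain \<xi> \<eta> where \<xi>\<eta>: "\<And>n. 0 < \<xi> n \<and> \<xi> n < h n \<and> 0 < \<eta> n \<and> \<eta> n < h n \<and>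
      f (x + h n *\<^sub>R axis i 1 + h n *\<^sub>R axis j 1) - f (x + h n *\<^sub>R axis i 1) - f (x + h n *\<^sub>R axis j 1) + f x
        = (h n)\<^sup>2 * partial j (partial i f) (x + \<xi> n *\<^sub>R axis i 1 + \<eta> n *\<^sub>R axis j 1)"
      by metis
    define q where "q n = x + \<xi> n *\<^sub>R axis i 1 + \<eta> n *\<^sub>R axis j (1::real)" for n
    have "norm (q n - x) \<le> 2 * h n" for n
    proof -
      have "q n - x = \<xi> n *\<^sub>R axis i 1 + \<eta> n *\<^sub>R axis j 1" by (simp add: q_def)
      then show ?thesis using close[of "\<xi> n" n "\<eta> n" i j] \<xi>\<eta>[of n] by simp
    qed
    moreover have "(\<lambda>n. 2 * h n) \<longlonglongrightarrow> 0" using tendsto_mult[OF tendsto_const[of 2] h0] by simp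
    ultimately have "(\<lambda>n. q n - x) \<longlonglongrightarrow> 0" 
      by (intro Lim_null_comparison[of "\<lambda>n. q n - x" "\<lambda>n. 2 * h n"]) auto
    then have "q \<longlonglongrightarrow> x" by (simp add: LIM_zero_iff)
    moreover have "q n \<in> D" for n using inD[of "\<xi> n" n "\<eta> n"] \<xi>\<eta>[of n] by (simp add: q_def)
    ultimately show ?thesis using \<xi>\<eta> by (intro exI[of _ q]) (simp add: q_def)
  qed
  obtain q1 where q1: "q1 \<longlonglongrightarrow> x" "\<And>n. q1 n \<in> D"
    "\<And>n. f (x + h n *\<^sub>R axis 1 1 + h n *\<^sub>R axis 2 1) - f (x + h n *\<^sub>R axis 1 1) - f (x + h n *\<^sub>R axis 2 1) + f x
      = (h n)\<^sup>2 * partial 2 (partial 1 f) (q1 n)" using ex[of 1 2] by blast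
  obtain q2 where q2: "q2 \<longlonglongrightarrow> x" "\<And>n. q2 n \<in> D"
    "\<And>n. f (x + h n *\<^sub>R axis 2 1 + h n *\<^sub>R axis 1 1) - f (x + h n *\<^sub>R axis 2 1) - f (x + h n *\<^sub>R axis 1 1) + f x
      = (h n)\<^sup>2 * partial 1 (partial 2 f) (q2 n)" using ex[of 2 1] by blast
  have quot: "(h n)\<^sup>2 * partial 2 (partial 1 f) (q1 n) = (h n)\<^sup>2 * partial 1 (partial 2 f) (q2 n)" for n
    using q1(3)[of n] q2(3)[of n] by (simp add: algebra_simps)
  have eq: "partial 2 (partial 1 f) (q1 n) = partial 1 (partial 2 f) (q2 n)" for n
    using quot[of n] h(1)[of n] by simp
  have c: "continuous_on D (partial j (partial i f))" for i j using f(2)[of i] by (simp add: C1_on_def)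
  have "(\<lambda>n. partial 2 (partial 1 f) (q1 n)) \<longlonglongrightarrow> partial 2 (partial 1 f) x"
    by (rule continuous_on_tendsto_compose[OF c q1(1) assms(2)]) (simp add: q1(2))
  then have "(\<lambda>n. partial 1 (partial 2 f) (q2 n)) \<longlonglongrightarrow> partial 2 (partial 1 f) x"
    by (simp only: eq)
  moreover have "(\<lambda>n. partial 1 (partial 2 f) (q2 n)) \<longlonglongrightarrow> partial 1 (partial 2 f) x"
    by (rule continuous_on_tendsto_compose[OF c q2(1) assms(2)]) (simp add: q2(2))
  ultimately show ?thesis by (rule LIMSEQ_unique)
qed

text \<open>For harmonic \<open>h\<close> the function \<open>\<partial>\<^sub>1 h - \<i> \<partial>\<^sub>2 h\<close> satisfies the Cauchy-Riemann equations. On a convex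
  neighbourhood of the disc it has a primitive, whose real part is \<open>h\<close> up to a constant.\<close>

lemma harmonic_on_imp_Re_on_discs:
  assumes D: "open D" and h: "harmonic_on D h"
  shows "Re_on_discs (to_complex ` D) (\<lambda>z. h (of_complex z))"
  unfolding Re_on_discs_def
proof (intro allI impI)
  fix c R assume "cball c R \<subseteq> to_complex ` D"
  then obtain e where e: "e > 0" "(\<Union>x\<in>cball c R. ball x e) \<subseteq> to_complex ` D"
    using compact_subset_open_imp_ball_epsilon_subset[OF compact_cball open_to_complex_image[OF D]]
    by metis
  define S where "S = (\<Union>x\<in>cball c R. \<Union>y\<in>ball 0 e. {x + y})"
  have S: "cball c R \<subseteq> S" "S \<subseteq> to_complex ` D" "convex S" "open S"
  proof -
    show "cball c R \<subseteq> S" using e(1) unfolding S_def by (auto intro!: exI[of _ 0] bexI[of _ 0])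
    have "x + y \<in> ball x e" if "y \<in> ball 0 e" for x y :: complex using that by (simp add: dist_norm)
    then show "S \<subseteq> to_complex ` D" using e(2) unfolding S_def by blast
    show "convex S" unfolding S_def by (intro convex_sums convex_cball convex_ball)
    show "open S" unfolding S_def by (intro open_sums disjI2 open_ball)
  qed
  have h1: "h differentiable (at x)" "partial i h differentiable (at x)" if "x \<in> D" for x i
    using h that by (auto simp: harmonic_on_def C1_on_def)
  define \<phi> where "\<phi> z = Complex (partial 1 h (of_complex z)) (- partial 2 h (of_complex z))" for z
  have \<phi>: "\<exists>d. (\<phi> has_field_derivative d) (at z)" if "z \<in> to_complex ` D" for z
  proof -
    define x where "x = of_complex z"
    have x: "x \<in> D" using that by (auto simp: x_def)
    have d: "((\<lambda>z. partial i h (of_complex z)) has_derivative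
        (\<lambda>v. Re v * partial 1 (partial i h) x + Im v * partial 2 (partial i h) x)) (at z)" for i
    proof -
      have "(partial i h has_derivative frechet_derivative (partial i h) (at x)) (at (of_complex z))"
        using h1(2)[OF x, of i] frechet_derivative_works by (auto simp: x_def)
      from has_derivative_compose[OF bounded_linear_imp_has_derivative[OF bounded_linear_of_complex] this]
      show ?thesis by (simp add: frechet_derivative_eq_partials[OF h1(2)[OF x]])
    qed
    have mixed: "partial 2 (partial 1 h) x = partial 1 (partial 2 h) x"
      using h by (intro mixed_partials_commute[OF D x]) (auto simp: harmonic_on_def)
    have lap: "partial 1 (partial 1 h) x + partial 2 (partial 2 h) x = 0"
      using h x by (auto simp: harmonic_on_def)
    define d where "d = Complex (partial 1 (partial 1 h) x) (- partial 1 (partial 2 h) x)"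
    have "((\<lambda>z. of_real (partial 1 h (of_complex z)) + \<i> * of_real (- partial 2 h (of_complex z))) has_derivative
        (\<lambda>v. of_real (Re v * partial 1 (partial 1 h) x + Im v * partial 2 (partial 1 h) x)
          + \<i> * of_real (- (Re v * partial 1 (partial 2 h) x + Im v * partial 2 (partial 2 h) x)))) (at z)"
      by (intro has_derivative_add has_derivative_mult_right has_derivative_of_real has_derivative_minus d)
    moreover have "of_real (Re v * partial 1 (partial 1 h) x + Im v * partial 2 (partial 1 h) x)
          + \<i> * of_real (- (Re v * partial 1 (partial 2 h) x + Im v * partial 2 (partial 2 h) x)) = d * v" for v
    proof -
      have "partial 2 (partial 2 h) x = - partial 1 (partial 1 h) x" using lap by linarith
      then show ?thesis by (simp add: complex_eq_iff d_def mixed algebra_simps)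
    qed
    moreover have "(\<lambda>z. of_real (partial 1 h (of_complex z)) + \<i> * of_real (- partial 2 h (of_complex z))) = \<phi>"
      by (simp add: \<phi>_def fun_eq_iff complex_eq_iff)
    ultimately have "(\<phi> has_derivative (\<lambda>v. d * v)) (at z)" by simp
    then show ?thesis by (auto simp: has_field_derivative_def)
  qed
  have hol: "\<phi> holomorphic_on S"
    using \<phi> S(2) unfolding holomorphic_on_def field_differentiable_def
    by (meson has_field_derivative_at_within subsetD)
  then obtain F where F: "\<And>z. z \<in> S \<Longrightarrow> (F has_field_derivative \<phi> z) (at z)"
    using holomorphic_convex_primitive'[OF S(3,4) hol] at_within_open[OF _ S(4)] by metis
  have "\<exists>C. \<forall>z\<in>S. h (of_complex z) - Re (F z) = C"
  proof (rule has_derivative_zero_constant[OF S(3)])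
    fix z assume z: "z \<in> S"
    define x where "x = of_complex z"
    have x: "x \<in> D" using z S(2) by (auto simp: x_def)
    have "(h has_derivative frechet_derivative h (at x)) (at (of_complex z))"
      using h1(1)[OF x] frechet_derivative_works by (auto simp: x_def)
    from has_derivative_compose[OF bounded_linear_imp_has_derivative[OF bounded_linear_of_complex] this]
    have 1: "((\<lambda>z. h (of_complex z)) has_derivative (\<lambda>v. Re v * partial 1 h x + Im v * partial 2 h x)) (at z)"
      by (simp add: frechet_derivative_eq_partials[OF h1(1)[OF x]])
    have "(F has_derivative (\<lambda>v. \<phi> z * v)) (at z)"
      using F[OF z] by (simp add: has_field_derivative_def)
    then have "((\<lambda>z. Re (F z)) has_derivative (\<lambda>v. Re (\<phi> z * v))) (at z)"
      by (rule bounded_linear.has_derivative[OF bounded_linear_Re])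
    from has_derivative_diff[OF 1 this]
    have "((\<lambda>z. h (of_complex z) - Re (F z)) has_derivative (\<lambda>v. 0)) (at z)"
      by (simp add: \<phi>_def x_def mult.commute)
    then show "((\<lambda>z. h (of_complex z) - Re (F z)) has_derivative (\<lambda>v. 0)) (at z within S)"
      by (rule has_derivative_at_withinI)
  qed
  then obtain C where C: "\<And>z. z \<in> S \<Longrightarrow> h (of_complex z) = Re (F z + of_real C)"
    by (metis Re_complex_of_real diff_eq_eq add.commute plus_complex.simps(1))
  show "\<exists>F. F holomorphic_on cball c R \<and> (\<forall>z\<in>cball c R. h (of_complex z) = Re (F z))"
  proof (intro exI[of _ "\<lambda>z. F z + of_real C"] conjI ballI)
    have "F holomorphic_on S"
      using F by (auto simp: holomorphic_on_def field_differentiable_def intro: has_field_derivative_at_within)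
    then show "(\<lambda>z. F z + of_real C) holomorphic_on cball c R"
      using S(1) by (intro holomorphic_intros) (rule holomorphic_on_subset)
  qed (use C S(1) in blast)
qed

lemma partial_Re_holomorphic:
  assumes F: "F holomorphic_on S" "open S" and eq: "\<And>x. to_complex x \<in> S \<Longrightarrow> f x = Re (F (to_complex x))"
    and x: "to_complex x \<in> S"
  shows "f differentiable (at x)" "partial i f x = Re (deriv F (to_complex x) * to_complex (axis i 1))"
proof -
  have "(F has_field_derivative deriv F (to_complex x)) (at (to_complex x))"
    using F x by (rule holomorphic_derivI)
  then have "(F has_derivative (\<lambda>v. deriv F (to_complex x) * v)) (at (to_complex x))"
    by (simp add: has_field_derivative_def)
  from has_derivative_compose[OF bounded_linear_imp_has_derivative[OF bounded_linear_to_complex] this]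
  have "((\<lambda>x. Re (F (to_complex x))) has_derivative (\<lambda>v. Re (deriv F (to_complex x) * to_complex v))) (at x)"
    by (rule bounded_linear.has_derivative[OF bounded_linear_Re])
  moreover have "open (to_complex -` S)"
    by (intro open_vimage F(2) linear_continuous_on bounded_linear_to_complex)
  ultimately have d: "(f has_derivative (\<lambda>v. Re (deriv F (to_complex x) * to_complex v))) (at x)"
    by (rule has_derivative_transform_within_open) (use x eq in auto)
  then show "f differentiable (at x)" by (auto simp: differentiable_def)
  have "(\<lambda>v. Re (deriv F (to_complex x) * to_complex v)) = frechet_derivative f (at x)"
    using d by (rule frechet_derivative_at)
  then show "partial i f x = Re (deriv F (to_complex x) * to_complex (axis i 1))"
    unfolding partial_def by (metis (no_types))
qed

lemma locally_Re_imp_harmonic_on: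
  assumes a: "locally_Re (to_complex ` D) a"
  shows "harmonic_on D (\<lambda>x. a (to_complex x))"
proof -
  let ?f = "\<lambda>x. a (to_complex x)"
  have loc: "?f differentiable (at x) \<and> partial i ?f differentiable (at x)
      \<and> partial j (partial i ?f) differentiable (at x)
      \<and> partial 1 (partial 1 ?f) x + partial 2 (partial 2 ?f) x = 0" if x: "x \<in> D" for x i j
  proof -
    obtain c R F where F: "to_complex x \<in> ball c R" "F holomorphic_on ball c R" "\<And>z. z \<in> ball c R \<Longrightarrow> a z = Re (F z)"
      using a x unfolding locally_Re_def by blast
    note 0 = partial_Re_holomorphic[OF F(2) open_ball]
    have f: "?f differentiable (at y)" "partial i ?f y = Re (deriv F (to_complex y) * to_complex (axis i 1))"
      if "to_complex y \<in> ball c R" for y i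
      by (rule 0; use F(3) that in simp)+
    have h1: "(\<lambda>z. deriv F z * to_complex (axis i 1)) holomorphic_on ball c R" for i
      by (intro holomorphic_intros F(2) open_ball)
    have p1: "partial i ?f differentiable (at y)"
      "partial j (partial i ?f) y = Re (deriv (\<lambda>z. deriv F z * to_complex (axis i 1)) (to_complex y) * to_complex (axis j 1))"
      if "to_complex y \<in> ball c R" for y i j
      by (rule partial_Re_holomorphic[OF h1 open_ball]; use f(2) that in simp)+
    have h2: "(\<lambda>z. deriv (\<lambda>z. deriv F z * to_complex (axis i 1)) z * to_complex (axis j 1)) holomorphic_on ball c R" for i j
      by (intro holomorphic_intros h1 open_ball)
    have p2: "partial j (partial i ?f) differentiable (at y)" if "to_complex y \<in> ball c R" for y i j
      by (rule partial_Re_holomorphic(1)[OF h2 open_ball]; use p1(2) that in simp)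
    have "(deriv F) field_differentiable (at (to_complex x))"
      using F(1,2) holomorphic_deriv holomorphic_on_imp_differentiable_at open_ball by blast
    then have "deriv (\<lambda>z. deriv F z * e) (to_complex x) = deriv (deriv F) (to_complex x) * e" for e
      by simp
    then have "partial 1 (partial 1 ?f) x + partial 2 (partial 2 ?f) x = 0"
      using F(1) by (simp add: p1(2))
    then show ?thesis using f(1) p1(1) p2 F(1) by blast
  qed
  have cont: "continuous_on D g" if "\<And>x. x \<in> D \<Longrightarrow> g differentiable (at x)" for g :: "real^2 \<Rightarrow> real"
    using that by (meson continuous_at_imp_continuous_on differentiable_imp_continuous_within)
  show ?thesis
    unfolding harmonic_on_def C1_on_def using loc by (auto intro!: cont)
qed

section \<open>The Green's function of a general domain\<close>

lemma green_half_plane_eq_ln: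
  assumes "x \<in> half_plane" "y \<in> half_plane" "x \<noteq> y"
  shows "2 * pi * green_half_plane x y = ln (norm (to_complex x - cnj (to_complex y)) / norm (to_complex x - to_complex y))"
proof -
  define m where "m = norm (to_complex x - cnj (to_complex y))"
  define d where "d = norm (x - y)"
  have d: "d > 0" using assms by (simp add: d_def)
  have m: "m > 0" using assms by (auto simp: m_def half_plane_def complex_eq_iff)
  have "m\<^sup>2 = d\<^sup>2 + 4 * x $ 2 * y $ 2"
    unfolding m_def d_def norm_to_complex_diff[symmetric] cmod_power2
    by (simp add: power2_eq_square algebra_simps)
  then have "1 + 4 * x $ 2 * y $ 2 / d\<^sup>2 = (m / d)\<^sup>2" using d by (simp add: field_simps)
  then have "2 * pi * green_half_plane x y = 1 / 2 * ln ((m / d)\<^sup>2)"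
    by (simp add: green_half_plane_def d_def)
  also have "\<dots> = ln (m / d)" using m d by (simp add: ln_realpow)
  finally show ?thesis by (simp add: m_def d_def norm_to_complex_diff)
qed

lemma green_half_plane_nonneg: "x \<in> half_plane \<Longrightarrow> y \<in> half_plane \<Longrightarrow> 0 \<le> green_half_plane x y"
  by (auto simp: green_half_plane_def half_plane_def)

lemma green_half_plane_commute: "green_half_plane x y = green_half_plane y x"
  by (simp add: green_half_plane_def norm_minus_commute mult_ac)

lemma green_half_plane_measurable [measurable]:
  "(\<lambda>p. green_half_plane (fst p) (snd p)) \<in> borel_measurable (borel \<Otimes>\<^sub>M borel)"
proof -
  have [measurable]: "(\<lambda>p :: (real^2) \<times> (real^2). fst p $ 2) \<in> borel_measurable (borel \<Otimes>\<^sub>M borel)"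
    "(\<lambda>p :: (real^2) \<times> (real^2). snd p $ 2) \<in> borel_measurable (borel \<Otimes>\<^sub>M borel)"
    "(\<lambda>p :: (real^2) \<times> (real^2). (norm (fst p - snd p))\<^sup>2) \<in> borel_measurable (borel \<Otimes>\<^sub>M borel)"
    unfolding borel_prod by (intro borel_measurable_continuous_onI continuous_intros)+
  show ?thesis unfolding green_half_plane_def by measurable
qed

text \<open>The harmonic function by which the fundamental solution exceeds the Green's function of the
  half-plane; it is the fundamental solution with the reflected pole.\<close>

definition image_potential :: "complex \<Rightarrow> complex \<Rightarrow> real" where
  "image_potential w z = - (1 / (2 * pi)) * ln (norm (z - cnj w))"

text \<open>In place of the greatest harmonic minorant \<open>h\<^sub>y\<close> of the fundamental solution, consider that of the
  half-plane Green's function, which is \<open>h\<^sub>y\<close> minus the image potential. It is nonnegative, whence the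
  comparison with the half-plane, and \<open>greatest_harmonic_minorant_symmetric\<close> applies to it.\<close>

lemma dirichlet_green_kernel:
  assumes D: "open D" "D \<subseteq> half_plane" and G: "dirichlet_green D G"
  obtains g where "case_prod g \<in> borel_measurable (borel \<Otimes>\<^sub>M borel)"
    "\<And>x y. x \<in> D \<Longrightarrow> y \<in> D \<Longrightarrow> g x y = g y x"
    "\<And>x y. x \<in> D \<Longrightarrow> y \<in> D \<Longrightarrow> 0 \<le> g x y \<and> g x y \<le> green_half_plane x y"
    "\<And>x y. x \<in> D \<Longrightarrow> y \<in> D \<Longrightarrow> x \<noteq> y \<Longrightarrow> G x y = g x y"
proof -
  let ?D = "to_complex ` D"
  have upper: "?D \<subseteq> {z. Im z > 0}" using D(2) by (auto simp: half_plane_def)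
  have oD: "open ?D" by (rule open_to_complex_image[OF D(1)])
  obtain h where hD: "\<forall>y\<in>D. harmonic_on D (h y)
    \<and> (\<forall>x\<in>D - {y}. h y x \<le> fund_sol x y)
    \<and> (\<forall>k. harmonic_on D k \<and> (\<forall>x\<in>D - {y}. k x \<le> fund_sol x y) \<longrightarrow> (\<forall>x\<in>D. k x \<le> h y x))
    \<and> (\<forall>x\<in>D - {y}. G x y = fund_sol x y - h y x)"
    using bchoice[OF G[unfolded dirichlet_green_def]] ..
  have h: "\<And>y. y \<in> D \<Longrightarrow> harmonic_on D (h y)"
    "\<And>x y. y \<in> D \<Longrightarrow> x \<in> D \<Longrightarrow> x \<noteq> y \<Longrightarrow> h y x \<le> fund_sol x y"
    "\<And>x y k. y \<in> D \<Longrightarrow> harmonic_on D k \<Longrightarrow> (\<And>x. x \<in> D \<Longrightarrow> x \<noteq> y \<Longrightarrow> k x \<le> fund_sol x y) \<Longrightarrow> x \<in> D \<Longrightarrow> k x \<le> h y x"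
    "\<And>x y. y \<in> D \<Longrightarrow> x \<in> D \<Longrightarrow> x \<noteq> y \<Longrightarrow> G x y = fund_sol x y - h y x"
    using hD by simp_all
  have fund: "fund_sol x y = green_half_plane x y + image_potential (to_complex y) (to_complex x)"
    if "x \<in> D" "y \<in> D" "x \<noteq> y" for x y
  proof -
    have xy: "x \<in> half_plane" "y \<in> half_plane" using that D(2) by auto
    have "0 < norm (to_complex x - cnj (to_complex y))" "0 < norm (x - y)"
      using xy that by (auto simp: half_plane_def complex_eq_iff)
    then have "2 * pi * green_half_plane x y = ln (norm (to_complex x - cnj (to_complex y))) - ln (norm (x - y))"
      using green_half_plane_eq_ln[OF xy that(3)] by (simp add: ln_div norm_to_complex_diff)
    then have "green_half_plane x y = (ln (norm (to_complex x - cnj (to_complex y))) - ln (norm (x - y))) / (2 * pi)"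
      by (simp add: field_simps)
    then show ?thesis by (simp add: fund_sol_def image_potential_def field_simps)
  qed
  \<comment> \<open>adding the image potential turns harmonic minorants of the half-plane kernel into those of the fundamental solution\<close>
  have combine: "locally_Re ?D (\<lambda>z. image_potential (to_complex y) z + k z / (2 * pi))"
    if y: "y \<in> D" and k: "locally_Re ?D k" for y k
    unfolding locally_Re_def
  proof
    fix z assume "z \<in> ?D"
    then obtain c R F where F: "z \<in> ball c R" "ball c R \<subseteq> ?D" "F holomorphic_on ball c R" "\<And>x. x \<in> ball c R \<Longrightarrow> k x = Re (F x)"
      using k unfolding locally_Re_def by blast
    define P where "P x = - (1 / (2 * of_real pi)) * Ln (x - cnj (to_complex y)) + F x / (2 * of_real pi)" for x
    have im: "Im (x - cnj (to_complex y)) > 0" if "x \<in> ball c R" for x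
    proof -
      have "Im x > 0" "Im (to_complex y) > 0" using that F(2) upper y by blast+
      then show ?thesis by simp
    qed
    have "P holomorphic_on ball c R"
    proof -
      have "x - cnj (to_complex y) \<notin> \<real>\<^sub>\<le>\<^sub>0" if "x \<in> ball c R" for x
        using im[OF that] unfolding complex_nonpos_Reals_iff by linarith
      then show ?thesis unfolding P_def by (intro holomorphic_intros F(3)) auto
    qed
    moreover have "image_potential (to_complex y) x + k x / (2 * pi) = Re (P x)" if "x \<in> ball c R" for x
    proof -
      have nz: "x - cnj (to_complex y) \<noteq> 0" using im[OF that] by auto
      have "P x = of_real (- 1 / (2 * pi)) * Ln (x - cnj (to_complex y)) + of_real (1 / (2 * pi)) * F x"
        by (simp add: P_def)
      then have "Re (P x) = (- 1 / (2 * pi)) * Re (Ln (x - cnj (to_complex y))) + 1 / (2 * pi) * Re (F x)"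
        by (simp only: plus_complex.simps Re_complex_of_real Im_complex_of_real times_complex.simps)
      then show ?thesis using nz F(4)[OF that] by (simp add: image_potential_def)
    qed
    ultimately show "\<exists>c R F. z \<in> ball c R \<and> ball c R \<subseteq> ?D \<and> F holomorphic_on ball c R
        \<and> (\<forall>x\<in>ball c R. image_potential (to_complex y) x + k x / (2 * pi) = Re (F x))"
      using F(1,2) by blast
  qed
  have "locally_Re ?D (\<lambda>_. 0)"
    unfolding locally_Re_def
  proof
    fix z assume "z \<in> ?D"
    then obtain e where "e > 0" "ball z e \<subseteq> ?D" using oD openE by blast
    then show "\<exists>c R F. z \<in> ball c R \<and> ball c R \<subseteq> ?D \<and> F holomorphic_on ball c R \<and> (\<forall>x\<in>ball c R. 0 = Re (F x))"
      by (intro exI[of _ z] exI[of _ e] exI[of _ "\<lambda>_. 0"]) auto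
  qed
  from locally_Re_imp_harmonic_on[OF combine[OF _ this]]
  have image_harm: "harmonic_on D (\<lambda>x. image_potential (to_complex y) (to_complex x))" if "y \<in> D" for y
    using that by simp
  define a where "a z w = 2 * pi * (h (of_complex w) (of_complex z) - image_potential w z)" for z w
  have a: "a (to_complex x) (to_complex y) = 2 * pi * (h y x - image_potential (to_complex y) (to_complex x))" for x y
    by (simp add: a_def)
  have kernel: "half_plane_kernel (to_complex x, to_complex y) = ennreal (2 * pi * green_half_plane x y)"
    if "x \<in> D" "y \<in> D" "x \<noteq> y" for x y
  proof -
    have xy: "x \<in> half_plane" "y \<in> half_plane" using that D(2) by auto
    have "to_complex x \<noteq> to_complex y" using that(3) by (metis of_to_complex)
    then show ?thesis
      using xy unfolding green_half_plane_eq_ln[OF xy that(3)]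
      by (intro half_plane_kernel_eq) (auto simp: half_plane_def)
  qed
  have harm: "Re_on_discs ?D (\<lambda>z. a z w)" if "w \<in> ?D" for w
  proof -
    have y: "of_complex w \<in> D" using that by (auto simp: to_complex_image_eq)
    have "harmonic_on D (\<lambda>x. h (of_complex w) x - image_potential w (to_complex x))"
      using harmonic_on_diff[OF D(1) h(1)[OF y] image_harm[OF y]] by simp
    from harmonic_on_imp_Re_on_discs[OF D(1) this]
    have H: "Re_on_discs ?D (\<lambda>z. h (of_complex w) (of_complex z) - image_potential w z)" by simp
    show ?thesis
      unfolding Re_on_discs_def
    proof (intro allI impI)
      fix c R assume "cball c R \<subseteq> ?D"
      then obtain F where F: "F holomorphic_on cball c R"
        "\<And>z. z \<in> cball c R \<Longrightarrow> h (of_complex w) (of_complex z) - image_potential w z = Re (F z)"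
        using H unfolding Re_on_discs_def by blast
      show "\<exists>F. F holomorphic_on cball c R \<and> (\<forall>z\<in>cball c R. a z w = Re (F z))"
        by (intro exI[of _ "\<lambda>z. of_real (2 * pi) * F z"] conjI ballI holomorphic_intros F(1))
          (simp add: a_def F(2) del: mem_cball of_real_mult)
    qed
  qed
  have nonneg: "0 \<le> a (to_complex x) (to_complex y)" if "x \<in> D" "y \<in> D" for x y
  proof -
    have "image_potential (to_complex y) (to_complex x) \<le> h y x"
    proof (rule h(3)[OF that(2) image_harm[OF that(2)] _ that(1)])
      fix x assume "x \<in> D" "x \<noteq> y"
      then show "image_potential (to_complex y) (to_complex x) \<le> fund_sol x y"
        using fund[of x y] green_half_plane_nonneg[of x y] that(2) D(2) by auto
    qed
    then show ?thesis by (simp add: a)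
  qed
  have le: "a (to_complex x) (to_complex y) \<le> 2 * pi * green_half_plane x y"
    if "x \<in> D" "y \<in> D" "x \<noteq> y" for x y
    using h(2)[OF that(2,1,3)] fund[OF that] unfolding a by (intro mult_left_mono) auto
  have le_kernel: "ennreal (a z w) \<le> half_plane_kernel (z, w)" if "z \<in> ?D" "w \<in> ?D" for z w
  proof (cases "z = w")
    case True
    with that upper show ?thesis by (auto simp: half_plane_kernel_def subset_iff)
  next
    case False
    with that obtain x y where "z = to_complex x" "w = to_complex y" "x \<in> D" "y \<in> D" "x \<noteq> y" by auto
    then show ?thesis using le by (simp add: kernel ennreal_leI)
  qed
  have greatest: "k z \<le> a z w" if w: "w \<in> ?D" and k: "locally_Re ?D k"
    and m: "\<And>x. x \<in> ?D \<Longrightarrow> x \<noteq> w \<Longrightarrow> 0 \<le> k x \<and> ennreal (k x) \<le> half_plane_kernel (x, w)" and z: "z \<in> ?D"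
    for w k z
  proof -
    obtain x y where xy: "z = to_complex x" "w = to_complex y" "x \<in> D" "y \<in> D" using w z by auto
    have "image_potential (to_complex y) (to_complex x) + k (to_complex x) / (2 * pi) \<le> h y x"
    proof (rule h(3)[OF xy(4) locally_Re_imp_harmonic_on[OF combine[OF xy(4) k]] _ xy(3)])
      fix v assume v: "v \<in> D" "v \<noteq> y"
      have "to_complex v \<noteq> to_complex y" using v(2) by (metis of_to_complex)
      then have "0 \<le> k (to_complex v) \<and> ennreal (k (to_complex v)) \<le> ennreal (2 * pi * green_half_plane v y)"
        using m[of "to_complex v"] v xy by (simp add: kernel)
      moreover have "0 \<le> green_half_plane v y" using v xy(4) D(2) by (intro green_half_plane_nonneg) auto
      ultimately have "k (to_complex v) \<le> 2 * pi * green_half_plane v y" by (simp add: ennreal_le_iff)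
      then have "k (to_complex v) / (2 * pi) \<le> green_half_plane v y" by (simp add: field_simps)
      then show "image_potential (to_complex y) (to_complex v) + k (to_complex v) / (2 * pi) \<le> fund_sol v y"
        using fund[OF v(1) xy(4) v(2)] by linarith
    qed
    then show ?thesis unfolding xy(1,2) a by (simp add: field_simps)
  qed
  have nonneg': "0 \<le> a z w" if "z \<in> ?D" "w \<in> ?D" for z w using nonneg that by auto
  have sym: "a z w = a w z" if "z \<in> ?D" "w \<in> ?D" for z w
    by (rule greatest_harmonic_minorant_symmetric(1)[where D="?D" and a=a])
      (fact oD upper harm nonneg' le_kernel greatest that)+
  have "\<exists>K \<in> borel_measurable (borel \<Otimes>\<^sub>M borel). \<forall>z\<in>?D. \<forall>w\<in>?D. K (z, w) = ennreal (a z w)"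
    by (rule greatest_harmonic_minorant_symmetric(2)[where D="?D" and a=a])
      (fact oD upper harm nonneg' le_kernel greatest)+
  then obtain K where K [measurable]: "K \<in> borel_measurable (borel \<Otimes>\<^sub>M borel)"
    and Ka: "\<And>x y. x \<in> D \<Longrightarrow> y \<in> D \<Longrightarrow> K (to_complex x, to_complex y) = ennreal (a (to_complex x) (to_complex y))"
    by auto
  define g where "g x y = (if norm (x - y) = 0 then 0 else max 0 (green_half_plane x y - enn2real (K (to_complex x, to_complex y)) / (2 * pi)))" for x y
  show ?thesis
  proof
    have "(\<lambda>p. K (to_complex (fst p), to_complex (snd p))) \<in> borel_measurable (borel \<Otimes>\<^sub>M borel)"
      by (rule measurable_compose[OF _ K]) measurable
    then show "case_prod g \<in> borel_measurable (borel \<Otimes>\<^sub>M borel)"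
      unfolding g_def case_prod_unfold by measurable
    fix x y assume xy: "x \<in> D" "y \<in> D"
    have s: "a (to_complex x) (to_complex y) = a (to_complex y) (to_complex x)"
      using xy by (intro sym) auto
    show "g x y = g y x"
      using xy by (simp add: g_def Ka s green_half_plane_commute[of x] norm_minus_commute[of x])
    show "0 \<le> g x y \<and> g x y \<le> green_half_plane x y"
      using green_half_plane_nonneg[of x y] xy D(2) by (auto simp: g_def)
    show "G x y = g x y" if "x \<noteq> y"
    proof -
      have ka: "enn2real (K (to_complex x, to_complex y)) / (2 * pi) = h y x - image_potential (to_complex y) (to_complex x)"
        using nonneg[OF xy] by (simp add: Ka[OF xy]) (simp add: a)
      have "G x y = green_half_plane x y - (h y x - image_potential (to_complex y) (to_complex x))"
        using h(4)[OF xy(2,1) that] fund[OF xy that] by simp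
      moreover have "0 \<le> G x y" using h(4)[OF xy(2,1) that] h(2)[OF xy(2,1) that] by simp
      ultimately show ?thesis using that by (simp add: g_def ka)
    qed
  qed
qed

section \<open>Minimizers\<close>

text \<open>For each of the three kinds of domains, \<open>G\<close> agrees off the diagonal with a symmetric measurable
  kernel dominated by the half-plane kernel. The values of \<open>G\<close> on the diagonal are unspecified, but
  each point is a null set of the integrals in which they occur.\<close>

lemma admissible_domain_kernel:
  assumes "admissible_domain \<Omega> G"
  obtains g where "\<Omega> \<in> sets lebesgue" "\<Omega> \<subseteq> half_plane"
    "case_prod g \<in> borel_measurable (borel \<Otimes>\<^sub>M borel)"
    "\<And>x y. x \<in> \<Omega> \<Longrightarrow> y \<in> \<Omega> \<Longrightarrow> g x y = g y x"
    "\<And>x y. x \<in> \<Omega> \<Longrightarrow> y \<in> \<Omega> \<Longrightarrow> 0 \<le> g x y \<and> g x y \<le> green_half_plane x y"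
    "\<And>x y. x \<in> \<Omega> \<Longrightarrow> y \<in> \<Omega> \<Longrightarrow> x \<noteq> y \<Longrightarrow> G x y = g x y"
proof -
  consider (half) "\<Omega> = half_plane" "G = green_half_plane"
    | (strip) L where "L > 0" "\<Omega> = strip L" "G = green_strip L"
    | (general) "open \<Omega>" "\<Omega> \<subseteq> half_plane" "dirichlet_green \<Omega> G"
    using assms unfolding admissible_domain_def by blast
  then show ?thesis
  proof cases
    case half
    have "open half_plane" unfolding half_plane_def by (intro open_Collect_less continuous_intros)
    with half show ?thesis
      using green_half_plane_measurable
      by (intro that[of green_half_plane]) (auto simp: case_prod_unfold green_half_plane_nonneg green_half_plane_commute)
  next
    case strip
    have "open (strip L)"
      unfolding strip_def by (intro open_Collect_conj open_Collect_less continuous_intros)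
    moreover have "strip L \<subseteq> half_plane" by (auto simp: strip_def half_plane_def)
    moreover have "case_prod (green_strip L) \<in> borel_measurable (borel \<Otimes>\<^sub>M borel)"
    proof -
      have [measurable]: "(\<lambda>p :: (real^2) \<times> (real^2). sin (pi / L * fst p $ 2) * sin (pi / L * snd p $ 2)) \<in> borel_measurable (borel \<Otimes>\<^sub>M borel)"
        "(\<lambda>p :: (real^2) \<times> (real^2). (sinh (pi / (2 * L) * (fst p $ 1 - snd p $ 1)))\<^sup>2
          + (sin (pi / (2 * L) * (fst p $ 2 - snd p $ 2)))\<^sup>2) \<in> borel_measurable (borel \<Otimes>\<^sub>M borel)"
        unfolding borel_prod by (intro borel_measurable_continuous_onI continuous_intros)+
      show ?thesis unfolding green_strip_def case_prod_unfold by measurable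
    qed
    moreover have "green_strip L x y = green_strip L y x" for x y
    proof -
      have "pi / (2 * L) * (x $ i - y $ i) = - (pi / (2 * L) * (y $ i - x $ i))" for i
        unfolding mult_minus_right[symmetric] minus_diff_eq ..
      then have "(sinh (pi / (2 * L) * (x $ 1 - y $ 1)))\<^sup>2 = (sinh (pi / (2 * L) * (y $ 1 - x $ 1)))\<^sup>2"
        "(sin (pi / (2 * L) * (x $ 2 - y $ 2)))\<^sup>2 = (sin (pi / (2 * L) * (y $ 2 - x $ 2)))\<^sup>2"
        by (simp_all only: sinh_minus sin_minus power2_minus)
      then show ?thesis by (simp add: green_strip_def mult.commute)
    qed
    ultimately show ?thesis
      using strip green_strip_le_green_half_plane[OF strip(1)]
      by (intro that[of "green_strip L"]) auto
  next
    case general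
    obtain g where g: "case_prod g \<in> borel_measurable (borel \<Otimes>\<^sub>M borel)"
      "\<And>x y. x \<in> \<Omega> \<Longrightarrow> y \<in> \<Omega> \<Longrightarrow> g x y = g y x"
      "\<And>x y. x \<in> \<Omega> \<Longrightarrow> y \<in> \<Omega> \<Longrightarrow> 0 \<le> g x y \<and> g x y \<le> green_half_plane x y"
      "\<And>x y. x \<in> \<Omega> \<Longrightarrow> y \<in> \<Omega> \<Longrightarrow> x \<noteq> y \<Longrightarrow> G x y = g x y"
      using dirichlet_green_kernel[OF general] by blast
    have "\<Omega> \<in> sets lebesgue" using general(1) by simp
    then show ?thesis by (rule that[OF _ general(2) g])
  qed
qed

lemma AE_lebesgue_on_neq:
  fixes x :: "'a::euclidean_space"
  assumes "\<Omega> \<in> sets lebesgue"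
  shows "AE y in lebesgue_on \<Omega>. y \<noteq> x"
proof -
  have "AE y in lebesgue. y \<noteq> x" by (rule AE_completion[OF AE_lborel_singleton])
  then show ?thesis using assms 
    by (auto simp: AE_restrict_space_iff elim: eventually_mono)
qed

lemma integral_lebesgue_on_eq_off_point:
  fixes f F :: "'a::euclidean_space \<Rightarrow> real"
  assumes \<Omega>: "\<Omega> \<in> sets lebesgue" and f [measurable]: "f \<in> borel_measurable (lebesgue_on \<Omega>)"
    and eq: "\<And>y. y \<in> \<Omega> \<Longrightarrow> y \<noteq> x \<Longrightarrow> F y = f y"
  shows "(LINT y|lebesgue_on \<Omega>. F y) = (LINT y|lebesgue_on \<Omega>. f y)"
proof (rule integral_cong_AE)
  have "{y \<in> space (lebesgue_on \<Omega>). y = x} = \<Omega> \<inter> {x}" by auto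
  then have "{y \<in> space (lebesgue_on \<Omega>). y = x} \<in> sets (lebesgue_on \<Omega>)"
    using \<Omega> by (auto simp: sets_restrict_space intro!: image_eqI[of _ _ "{x}"])
  then have "(\<lambda>y. if y = x then F x else f y) \<in> borel_measurable (lebesgue_on \<Omega>)"
    by (intro measurable_If) auto
  then show "F \<in> borel_measurable (lebesgue_on \<Omega>)"
    by (rule subst[OF measurable_cong, rotated]) (use eq in auto)
  show "AE y in lebesgue_on \<Omega>. F y = f y"
    using AE_lebesgue_on_neq[OF \<Omega>, of x] AE_space by eventually_elim (use eq in auto)
qed measurable

text \<open>The threshold is nonnegative because \<open>G\<close> is, so the negativity range only contains positive
  parameters.\<close>

lemma negativity_range_pos:
  assumes "p > 1" and range: "(\<mu>, lam) \<in> negativity_range \<Omega> G p"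
    and G: "\<And>x y. x \<in> \<Omega> \<Longrightarrow> y \<in> \<Omega> \<Longrightarrow> x \<noteq> y \<Longrightarrow> 0 \<le> G x y"
  shows "\<mu> > 0" "lam > 0"
proof -
  obtain K where K: "\<mu> > 0" "K \<in> sets lebesgue" "K \<subseteq> \<Omega>" "lam > negativity_threshold G p K \<mu>"
    using range unfolding negativity_range_def by blast
  have "0 \<le> (LINT y|lebesgue_on K. G x y)" if "x \<in> K" for x
  proof (rule integral_nonneg_AE)
    show "AE y in lebesgue_on K. 0 \<le> G x y"
      using AE_lebesgue_on_neq[OF K(2), of x] AE_space
      by eventually_elim (use G K(3) that in auto)
  qed
  then have "0 \<le> (LINT x|lebesgue_on K. LINT y|lebesgue_on K. G x y)"
    by (rule Bochner_Integration.integral_nonneg) simp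
  then have "0 \<le> negativity_threshold G p K \<mu>"
    using \<open>p > 1\<close> unfolding negativity_threshold_def by (intro mult_nonneg_nonneg divide_nonneg_nonneg) auto
  with K show "\<mu> > 0" "lam > 0" by auto
qed

text \<open>Passing to the kernel \<open>g\<close> changes neither energies nor potentials, so \<open>\<omega>\<close> maximizes the
  functional of \<open>weighted_energy\<close> on the Lebesgue measure of \<open>\<Omega>\<close> with weight \<open>x\<^sub>2\<close>.\<close>

theorem proposition2p6:
  fixes \<Omega> :: "(real^2) set" and G :: "real^2 \<Rightarrow> real^2 \<Rightarrow> real"
    and p \<mu> lam :: real and \<omega> :: "real^2 \<Rightarrow> real"
  assumes "admissible_domain \<Omega> G" and "p > 1"
    and "(\<mu>, lam) \<in> negativity_range \<Omega> G p"
    and "\<omega> \<in> minimizers \<Omega> G p \<mu> lam"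
  shows "\<exists>!W::real. AE x in lebesgue_on \<Omega>.
           \<omega> x powr (p - 1) = lam * max 0 (potential \<Omega> G \<omega> x - W * x $ 2)"
proof -
  let ?M = "lebesgue_on \<Omega>"
  obtain g where \<Omega>: "\<Omega> \<in> sets lebesgue" "\<Omega> \<subseteq> half_plane"
    and g_borel: "case_prod g \<in> borel_measurable (borel \<Otimes>\<^sub>M borel)"
    and g_sym: "\<And>x y. x \<in> \<Omega> \<Longrightarrow> y \<in> \<Omega> \<Longrightarrow> g x y = g y x"
    and g_bound: "\<And>x y. x \<in> \<Omega> \<Longrightarrow> y \<in> \<Omega> \<Longrightarrow> 0 \<le> g x y \<and> g x y \<le> green_half_plane x y"
    and g_eq: "\<And>x y. x \<in> \<Omega> \<Longrightarrow> y \<in> \<Omega> \<Longrightarrow> x \<noteq> y \<Longrightarrow> G x y = g x y"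
    using admissible_domain_kernel[OF assms(1)] by blast
  have pos: "\<mu> > 0" "lam > 0"
    using negativity_range_pos[OF assms(2,3)] g_bound g_eq by auto
  have id: "(\<lambda>x. x) \<in> ?M \<rightarrow>\<^sub>M (borel :: (real^2) measure)"
    by (intro measurable_restrict_space1 measurable_completion) measurable
  have g_meas: "case_prod g \<in> borel_measurable (?M \<Otimes>\<^sub>M ?M)"
  proof -
    have "(\<lambda>z. (fst z, snd z)) \<in> ?M \<Otimes>\<^sub>M ?M \<rightarrow>\<^sub>M borel \<Otimes>\<^sub>M (borel :: (real^2) measure)"
      by (intro measurable_Pair measurable_compose[OF measurable_fst id] measurable_compose[OF measurable_snd id])
    from measurable_compose[OF this g_borel] show ?thesis by simp
  qed
  have height: "(\<lambda>x :: real^2. x $ 2) \<in> borel_measurable ?M"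
    by (intro measurable_restrict_space1 measurable_completion) measurable
  interpret S: sigma_finite_measure ?M by (rule sigma_finite_lebesgue_on[OF \<Omega>(1)])
  have W: "weighted_energy ?M (\<lambda>x :: real^2. x $ 2) g p"
    by unfold_locales (use \<Omega>(2) height g_meas g_sym assms(2) in \<open>auto simp: half_plane_def\<close>)
  interpret E: finite_weighted_energy ?M "\<lambda>x :: real^2. x $ 2" g p
  proof (intro finite_weighted_energy.intro W finite_weighted_energy_axioms.intro)
    fix u assume "u \<in> weighted_energy.densities ?M (\<lambda>x :: real^2. x $ 2) p"
    then show "integrable (?M \<Otimes>\<^sub>M ?M) (\<lambda>z. g (fst z) (snd z) * u (fst z) * u (snd z))"
      using energy_integrable_dominated[OF \<Omega> assms(2) g_meas g_bound]
      by (simp add: weighted_energy.densities_def[OF W])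
  qed
  have adm: "u \<in> admissible_vorticities \<Omega> p \<mu> \<longleftrightarrow> u \<in> E.densities \<and> (LINT x|?M. x $ 2 * u x) = \<mu>" for u
    by (auto simp: admissible_vorticities_def E.densities_def)
  have g_section: "(\<lambda>y. g x y) \<in> borel_measurable ?M" for x
  proof -
    have "(\<lambda>y. (x, y)) \<in> ?M \<rightarrow>\<^sub>M borel \<Otimes>\<^sub>M (borel :: (real^2) measure)"
      by (intro measurable_Pair id) simp
    from measurable_compose[OF this g_borel] show ?thesis by simp
  qed
  have pot: "potential \<Omega> G u x = E.pot u x" if "u \<in> E.densities" "x \<in> \<Omega>" for u x
    unfolding potential_def E.pot_def
    by (rule integral_lebesgue_on_eq_off_point[OF \<Omega>(1), of _ x])
      (use that g_section g_eq in \<open>auto simp: E.densities_def\<close>)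
  have energy: "energy \<Omega> G u = 1 / 2 * E.form u u" if u: "u \<in> E.densities" for u
  proof -
    have "(LINT y|?M. G x y * u x * u y) = (LINT y|?M. g x y * u x * u y)" if "x \<in> \<Omega>" for x
      by (rule integral_lebesgue_on_eq_off_point[OF \<Omega>(1), of _ x])
        (use that u g_section g_eq in \<open>auto simp: E.densities_def\<close>)
    then have "(LINT x|?M. LINT y|?M. G x y * u x * u y) = (LINT x|?M. LINT y|?M. g x y * u x * u y)"
      by (rule Bochner_Integration.integral_cong[OF refl]) simp
    then show ?thesis by (simp add: energy_def E.form_eq_iterated[OF u u])
  qed
  have \<omega>: "\<omega> \<in> E.densities" "(LINT x|?M. x $ 2 * \<omega> x) = \<mu>"
    using assms(4) by (auto simp: minimizers_def adm)
  have functional: "penalized_energy \<Omega> G p lam u = E.functional lam u" if "u \<in> E.densities" for u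
    using that by (simp add: penalized_energy_def energy E.functional_def)
  have min: "E.functional lam v \<le> E.functional lam \<omega>"
    if v: "v \<in> E.densities" "(LINT x|?M. x $ 2 * v x) = \<mu>" for v
  proof -
    have "ereal (- penalized_energy \<Omega> G p lam \<omega>) \<le> ereal (- penalized_energy \<Omega> G p lam v)"
    proof -
      have "v \<in> admissible_vorticities \<Omega> p \<mu>" using v by (simp add: adm)
      then have "min_value \<Omega> G p \<mu> lam \<le> ereal (- penalized_energy \<Omega> G p lam v)"
        unfolding min_value_def by (rule INF_lower)
      then show ?thesis using assms(4) by (simp add: minimizers_def)
    qed
    then show ?thesis by (simp add: functional \<omega>(1) v(1))
  qed
  have "\<exists>!W. AE x in ?M. \<omega> x powr (p - 1) = lam * max 0 (E.pot \<omega> x - W * x $ 2)"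
    by (rule E.euler_lagrange[OF pos(2,1) \<omega> min])
  moreover have "(AE x in ?M. \<omega> x powr (p - 1) = lam * max 0 (E.pot \<omega> x - W * x $ 2))
      \<longleftrightarrow> (AE x in ?M. \<omega> x powr (p - 1) = lam * max 0 (potential \<Omega> G \<omega> x - W * x $ 2))" for W
    by (intro AE_cong) (simp add: pot[OF \<omega>(1)])
  ultimately show ?thesis by simp
qed

end
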